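(* Consider the closed-loop stochastic Schrödinger equation on $S^{2n-1}$ $$d|\psi\rangle=\Big(\big(\tfrac{-i}{\hbar}H(U)-\kappa(X-\langle X\rangle)^2\big)dt+\sqrt{2\kappa}\,(X-\langle X\rangle)\,dW\Big)|\psi\rangle,\qquad |\psi(0)\rangle=|\psi_0\rangle\ \text{a.s.},$$ with $H(U)=H_0+\sum_{j=1}^m u_j(t)H_j$ and feedback controls $$u_j(t)=\alpha_j\operatorname{Im}\Big(e^{i\arg\langle\psi|\psi_f\rangle}\langle\psi_f|H_j|\psi\rangle\Big),\qquad \alpha_j>0 .$$ Assume (A1)–(A4) below. Then the equivalence class $[|\psi_f\rangle]$ is stochastically stable, i.e. for every $\varepsilon>0$, $$\lim_{\|\,|\partial\psi\rangle\|\to0}\mathrm{P}\Big\{\sup_{t\ge0}\big\||\psi^{|\psi_f\rangle+|\partial\psi\rangle}(t)\rangle-[|\psi_f\rangle]\big\|\ge\varepsilon\Big\}=0,$$ where $|\psi^{|\psi_0\rangle}(t)\rangle$ denotes the solution started at $|\psi_0\rangle$ (with $|\psi_f\rangle+|\partial\psi\rangle\in S^{2n-1}$). (A1) $H_0,H_1,\dots,H_m$ are $n\times n$ Hermitian matrices with $iH_j\in su(n)$, and the controls enter the Hamiltonian affinely as $H(U)=H_0+\sum_j u_j H_j$. (A2) $|\psi_f\rangle$ is an eigenvector of $H_0$ with eigenvalue $\lambda_{Hf}$, and the corresponding eigenspace is degenerate. (A3) $|\psi_f\rangle$ is not an eigenvector of $H_j$ for at least one $j\in\{1,\dots,m\}$.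 (A4) $|\psi_f\rangle$ is an eigenvector of $X$ with eigenvalue $\lambda_{Xf}$.
   Context: $n\ge2$, $S^{2n-1}$ is the unit sphere in $\mathbb{C}^n$ (pure states), $\hbar>0$, $\kappa>0$ is the measurement strength, $X$ is a Hermitian $n\times n$ matrix (the continuously measured observable), $\langle X\rangle=\langle\psi|X|\psi\rangle$, $W$ is a standard real Wiener process on a complete probability space $(\Omega,\Xi,\mathrm{P})$, and $\arg z$ is the argument of $z\in\mathbb{C}$. $|\psi_f\rangle\in S^{2n-1}$ is the target state, $[|\psi_f\rangle]=\{e^{i\varrho}|\psi_f\rangle:\varrho\in\mathbb{R}\}$, and $\||\phi\rangle-[|\psi_f\rangle]\|=\inf_{\varrho\in\mathbb{R}}\||\phi\rangle-e^{i\varrho}|\psi_f\rangle\|$. *)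

theory Defs
  imports "HOL-Probability.Probability"
begin

type_synonym 'n cvec = "complex ^ 'n"
type_synonym 'n cmat = "complex ^ 'n ^ 'n"

definition braket :: "'n::finite cvec \<Rightarrow> 'n cvec \<Rightarrow> complex" where
  "braket \<phi> \<psi> = (\<Sum>i\<in>UNIV. cnj (\<phi> $ i) * \<psi> $ i)"

definition hermitian :: "'n::finite cmat \<Rightarrow> bool" where
  "hermitian A \<longleftrightarrow> (\<forall>i j. A $ i $ j = cnj (A $ j $ i))"

definition mtrace :: "'n::finite cmat \<Rightarrow> complex" where
  "mtrace A = (\<Sum>i\<in>UNIV. A $ i $ i)"

definition cscale :: "complex \<Rightarrow> 'n::finite cmat \<Rightarrow> 'n cmat" where
  "cscale c A = (\<chi> i j. c * A $ i $ j)"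

definition su :: "'n::finite cmat set" where
  "su = {A. (\<forall>i j. A $ i $ j = - cnj (A $ j $ i)) \<and> mtrace A = 0}"

definition is_eigvec :: "'n::finite cmat \<Rightarrow> 'n cvec \<Rightarrow> bool" where
  "is_eigvec A v \<longleftrightarrow> v \<noteq> 0 \<and> (\<exists>c. A *v v = c *s v)"

definition dist_class :: "'n::finite cvec \<Rightarrow> 'n cvec \<Rightarrow> real" where
  "dist_class \<phi> \<psi>f = (INF \<rho>\<in>(UNIV::real set). norm (\<phi> - cis \<rho> *s \<psi>f))"

definition wiener :: "'w measure \<Rightarrow> (real \<Rightarrow> 'w \<Rightarrow> real) \<Rightarrow> bool" where
  "wiener M W \<longleftrightarrow> prob_space M \<and>
     (\<forall>t. W t \<in> borel_measurable M) \<and>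
     (AE \<omega> in M. W 0 \<omega> = 0) \<and>
     (AE \<omega> in M. continuous_on {0..} (\<lambda>t. W t \<omega>)) \<and>
     (\<forall>s t. 0 \<le> s \<and> s < t \<longrightarrow>
        distributed M lborel (\<lambda>\<omega>. W t \<omega> - W s \<omega>) (normal_density 0 (sqrt (t - s)))) \<and>
     (\<forall>(ts::nat \<Rightarrow> real) k. 0 \<le> ts 0 \<and> (\<forall>i<k. ts i \<le> ts (Suc i)) \<longrightarrow>
        prob_space.indep_vars M (\<lambda>_. borel) (\<lambda>i \<omega>. W (ts (Suc i)) \<omega> - W (ts i) \<omega>) {..<k})"

definition nat_filt :: "'w measure \<Rightarrow> (real \<Rightarrow> 'w \<Rightarrow> real) \<Rightarrow> real \<Rightarrow> 'w measure" where
  "nat_filt M W t = sigma (space M)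
     (\<Union>s\<in>{0..t}. {W s -` B \<inter> space M | B. B \<in> sets borel})"

text \<open>Adapted to the (completed) natural filtration of W.\<close>
definition adapted :: "'w measure \<Rightarrow> (real \<Rightarrow> 'w \<Rightarrow> real) \<Rightarrow> (real \<Rightarrow> 'w \<Rightarrow> 'b::topological_space) \<Rightarrow> bool" where
  "adapted M W Y \<longleftrightarrow> (\<forall>t\<ge>0. \<exists>g. g \<in> borel_measurable (nat_filt M W t) \<and> (AE \<omega> in M. Y t \<omega> = g \<omega>))"

text \<open>I is (a version of) the Ito integral of the continuous adapted integrand f
  over [0,t]: limit in probability of the left-point Riemann-Ito sums.\<close>
definition ito_sum :: "(real \<Rightarrow> 'w \<Rightarrow> real) \<Rightarrow> (real \<Rightarrow> 'w \<Rightarrow> 'b::real_vector) \<Rightarrow> real \<Rightarrow> nat \<Rightarrow> 'w \<Rightarrow> 'b" where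
  "ito_sum W f t N \<omega> = (\<Sum>k<N. (W (real (Suc k) * t / real N) \<omega> - W (real k * t / real N) \<omega>) *\<^sub>R f (real k * t / real N) \<omega>)"

definition is_ito_integral :: "'w measure \<Rightarrow> (real \<Rightarrow> 'w \<Rightarrow> real) \<Rightarrow> (real \<Rightarrow> 'w \<Rightarrow> 'b::real_normed_vector) \<Rightarrow> real \<Rightarrow> ('w \<Rightarrow> 'b) \<Rightarrow> bool" where
  "is_ito_integral M W f t I \<longleftrightarrow>
     (\<forall>\<epsilon>>0. (\<lambda>N. measure M {\<omega>\<in>space M. \<epsilon> < dist (ito_sum W f t N \<omega>) (I \<omega>)}) \<longlonglongrightarrow> 0)"

definition sde_solution :: "'w measure \<Rightarrow> (real \<Rightarrow> 'w \<Rightarrow> real) \<Rightarrow> ('b \<Rightarrow> 'b) \<Rightarrow> ('b \<Rightarrow> 'b) \<Rightarrow> 'b::euclidean_space \<Rightarrow> (real \<Rightarrow> 'w \<Rightarrow> 'b) \<Rightarrow> bool" where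
  "sde_solution M W b s y0 Y \<longleftrightarrow>
     (\<forall>t. Y t \<in> borel_measurable M) \<and> adapted M W Y \<and>
     (AE \<omega> in M. continuous_on {0..} (\<lambda>t. Y t \<omega>)) \<and>
     (AE \<omega> in M. Y 0 \<omega> = y0) \<and>
     (\<forall>t\<ge>0. is_ito_integral M W (\<lambda>r \<omega>. s (Y r \<omega>)) t
              (\<lambda>\<omega>. Y t \<omega> - y0 - integral {0..t} (\<lambda>r. b (Y r \<omega>))))"

definition ctrl :: "real \<Rightarrow> 'n::finite cmat \<Rightarrow> 'n cvec \<Rightarrow> 'n cvec \<Rightarrow> real" where
  "ctrl \<alpha> Hj \<psi>f \<psi> = \<alpha> * Im (cis (Arg (braket \<psi> \<psi>f)) * braket \<psi>f (Hj *v \<psi>))"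

definition ham :: "nat \<Rightarrow> (nat \<Rightarrow> real) \<Rightarrow> (nat \<Rightarrow> 'n::finite cmat) \<Rightarrow> 'n cvec \<Rightarrow> 'n cvec \<Rightarrow> 'n cmat" where
  "ham m \<alpha> H \<psi>f \<psi> = H 0 + (\<Sum>j\<in>{1..m}. ctrl (\<alpha> j) (H j) \<psi>f \<psi> *\<^sub>R H j)"

definition Xc :: "'n::finite cmat \<Rightarrow> 'n cvec \<Rightarrow> 'n cmat" where
  "Xc X \<psi> = X - mat (braket \<psi> (X *v \<psi>))"

definition drift :: "real \<Rightarrow> real \<Rightarrow> 'n::finite cmat \<Rightarrow> nat \<Rightarrow> (nat \<Rightarrow> real) \<Rightarrow> (nat \<Rightarrow> 'n cmat) \<Rightarrow> 'n cvec \<Rightarrow> 'n cvec \<Rightarrow> 'n cvec" where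
  "drift hbar \<kappa> X m \<alpha> H \<psi>f \<psi> =
     (- \<i> / complex_of_real hbar) *s (ham m \<alpha> H \<psi>f \<psi> *v \<psi>)
     - complex_of_real \<kappa> *s (Xc X \<psi> *v (Xc X \<psi> *v \<psi>))"

definition diffusion :: "real \<Rightarrow> 'n::finite cmat \<Rightarrow> 'n cvec \<Rightarrow> 'n cvec" where
  "diffusion \<kappa> X \<psi> = sqrt (2 * \<kappa>) *\<^sub>R (Xc X \<psi> *v \<psi>)"

end

theory Submission
  imports Defs
begin

text \<open>
  Write \<open>q = \<langle>\<psi>\<^sub>f|\<psi>\<rangle>\<close>. Ito's formula for quadratic forms gives, for \<open>R = \<parallel>\<psi>\<parallel>\<^sup>2\<close>, an equation
  \<open>dR = 2 \<surd>(2\<kappa>) \<langle>X\<rangle> (1 - R) dW\<close> without drift, which is linear in \<open>1 - R\<close>; since \<open>R\<close> starts at \<open>1\<close>, it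
  stays there. For \<open>|q|\<^sup>2\<close> the measurement terms cancel in the drift because \<open>\<psi>\<^sub>f\<close> is an eigenvector of
  \<open>X\<close>, the \<open>H\<^sub>0\<close> term vanishes because its eigenvalue is real, and the feedback makes the remaining
  terms nonnegative. Hence \<open>1 - |q|\<^sup>2\<close> is a nonnegative supermartingale, and the maximal inequality
  together with \<open>dist\<^sup>2 \<le> 2 (1 - |q|\<^sup>2)\<close> bounds the exit probability by a multiple of its initial value.

  Ito's formula for squares is obtained directly from the Riemann sums that define the integral: the
  discrete process with increments \<open>\<integral>\<beta> dt + \<sigma> \<Delta>W\<close> is squared exactly, and all error terms are
  martingale transforms controlled in probability by their quadratic variation.
\<close>

section \<open>Convergence in probability\<close>

text \<open>Two obstacles shape the proof. First, the solution is known only through limits in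
  probability of left-point sums at each fixed time, so integrability, uniformity in time and even
  staying on the sphere have to be won, while off the sphere the coefficients grow faster than
  linearly. Stopping times are replaced by indicators of adapted events that shrink with time, which
  the discrete isometry tolerates, and by truncating integrands at a level that is exceeded with
  small probability. Second, the feedback may jump where \<open>q = 0\<close>, so along a path the
  drift is merely Borel and locally bounded: it is integrated exactly over every grid cell, and only
  continuous factors are sampled. The distance estimate comes from rotating the target by the phase
  of \<open>q\<close>, which gives a squared distance of at most 2 - 2 |q|, hence at most 2 (1 -
  |q|^2). Applied at the threshold \<open>\<epsilon> / 2\<close>, it produces the constant 8 /
  \<epsilon>^2 of the exit bound.\<close>

context prob_space
begin

text \<open>The usual bounded metric for convergence in probability: one number per variable,
  subadditive and meaningful without integrability of \<open>X\<close>, so that error terms can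
  simply be added up.\<close>

definition psize :: "('a \<Rightarrow> real) \<Rightarrow> real" where
  "psize X = expectation (\<lambda>\<omega>. min 1 \<bar>X \<omega>\<bar>)"

text \<open>Measurability is part of the notion because the Bochner integral of a non-measurable
  function is 0, which would make such a sequence vanish for free.\<close>

definition vanishes :: "(nat \<Rightarrow> 'a \<Rightarrow> real) \<Rightarrow> bool" where
  "vanishes X \<longleftrightarrow> (\<forall>n. X n \<in> borel_measurable M) \<and> (\<lambda>n. psize (X n)) \<longlonglongrightarrow> 0"

lemma vanishes_measurable: "vanishes X \<Longrightarrow> X n \<in> borel_measurable M"
  by (simp add: vanishes_def)

lemma integrable_min_abs:
  "X \<in> borel_measurable M \<Longrightarrow> integrable M (\<lambda>\<omega>. min 1 \<bar>X \<omega> :: real\<bar>)"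
  by (rule integrable_const_bound[where B=1]) auto

lemma psize_nonneg: "0 \<le> psize X"
  unfolding psize_def by (rule integral_nonneg_AE) auto

lemma psize_mono:
  assumes "Y \<in> borel_measurable M" "X \<in> borel_measurable M" "AE \<omega> in M. \<bar>Y \<omega>\<bar> \<le> \<bar>X \<omega>\<bar>"
  shows "psize Y \<le> psize X"
  unfolding psize_def using assms
  by (intro integral_mono_AE integrable_min_abs) (auto elim!: eventually_mono)

lemma psize_add_le:
  assumes "X \<in> borel_measurable M" "Y \<in> borel_measurable M"
  shows "psize (\<lambda>\<omega>. X \<omega> + Y \<omega>) \<le> psize X + psize Y"
proof -
  have "psize (\<lambda>\<omega>. X \<omega> + Y \<omega>) \<le> expectation (\<lambda>\<omega>. min 1 \<bar>X \<omega>\<bar> + min 1 \<bar>Y \<omega>\<bar>)"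
    unfolding psize_def using assms
    by (intro integral_mono_AE integrable_min_abs Bochner_Integration.integrable_add) auto
  also have "\<dots> = psize X + psize Y"
    unfolding psize_def using assms
    by (intro Bochner_Integration.integral_add integrable_min_abs)
  finally show ?thesis .
qed

lemma psize_le_expectation_abs:
  assumes "integrable M X"
  shows "psize X \<le> expectation (\<lambda>\<omega>. \<bar>X \<omega>\<bar>)"
  unfolding psize_def using assms
  by (intro integral_mono_AE integrable_min_abs integrable_abs) auto

text \<open>The vehicle for localisation: a variable is exchanged for a truncated one at the price
  of the probability that the truncation acts.\<close>

lemma psize_le_except:
  assumes [measurable]: "X \<in> borel_measurable M" "Y \<in> borel_measurable M" "A \<in> events"
    and eq: "AE \<omega> in M. \<omega> \<notin> A \<longrightarrow> \<bar>X \<omega>\<bar> \<le> \<bar>Y \<omega>\<bar>"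
  shows "psize X \<le> prob A + psize Y"
proof -
  have "psize X \<le> expectation (\<lambda>\<omega>. indicator A \<omega> + min 1 \<bar>Y \<omega>\<bar>)"
    unfolding psize_def
  proof (intro integral_mono_AE integrable_min_abs Bochner_Integration.integrable_add)
    show "AE \<omega> in M. min 1 \<bar>X \<omega>\<bar> \<le> indicator A \<omega> + min 1 \<bar>Y \<omega>\<bar>"
      using eq by eventually_elim (auto simp: indicator_def)
  qed (auto simp: emeasure_eq_measure)
  also have "\<dots> = prob A + psize Y"
    unfolding psize_def
    by (subst Bochner_Integration.integral_add)
       (auto intro!: integrable_min_abs simp: emeasure_eq_measure)
  finally show ?thesis .
qed

lemma prob_gt_le_psize:
  assumes [measurable]: "X \<in> borel_measurable M" and d: "0 < d" "d \<le> 1"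
  shows "d * prob {\<omega> \<in> space M. d < \<bar>X \<omega>\<bar>} \<le> psize X"
proof -
  let ?A = "{\<omega> \<in> space M. d < \<bar>X \<omega>\<bar>}"
  have "d * prob ?A = expectation (\<lambda>\<omega>. d * indicator ?A \<omega>)"
    by simp
  also have "\<dots> \<le> psize X"
    unfolding psize_def using d
    by (intro integral_mono_AE integrable_min_abs integrable_mult_right)
       (auto split: split_indicator simp: emeasure_eq_measure)
  finally show ?thesis .
qed

lemma vanishesI_eventually:
  assumes "\<And>n. X n \<in> borel_measurable M"
    and "\<And>e. 0 < e \<Longrightarrow> eventually (\<lambda>n. psize (X n) \<le> e) sequentially"
  shows "vanishes X"
  unfolding vanishes_def
proof (intro conjI allI assms(1) tendstoI)
  fix e :: real assume "0 < e"
  then have "eventually (\<lambda>n. psize (X n) \<le> e / 2) sequentially"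
    by (intro assms(2)) auto
  then show "eventually (\<lambda>n. dist (psize (X n)) 0 < e) sequentially"
    by eventually_elim (use \<open>0 < e\<close> psize_nonneg in \<open>auto simp: dist_real_def\<close>)
qed

lemma vanishesD_eventually:
  assumes "vanishes X" "0 < e"
  shows "eventually (\<lambda>n. psize (X n) < e) sequentially"
  using assms order_tendstoD(2) unfolding vanishes_def by blast

lemma vanishes_mono:
  assumes "vanishes X" "\<And>n. Y n \<in> borel_measurable M"
    and "\<And>n. AE \<omega> in M. \<bar>Y n \<omega>\<bar> \<le> \<bar>X n \<omega>\<bar>"
  shows "vanishes Y"
proof (rule vanishesI_eventually)
  fix e :: real assume "0 < e"
  with assms(1) have "eventually (\<lambda>n. psize (X n) < e) sequentially"
    by (rule vanishesD_eventually)
  then show "eventually (\<lambda>n. psize (Y n) \<le> e) sequentially"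
    by eventually_elim
       (meson assms order.trans less_imp_le psize_mono vanishes_measurable)
qed (fact assms)

lemma vanishes_add:
  assumes "vanishes X" "vanishes Y"
  shows "vanishes (\<lambda>n \<omega>. X n \<omega> + Y n \<omega>)"
proof (rule vanishesI_eventually)
  have [measurable]: "\<And>n. X n \<in> borel_measurable M" "\<And>n. Y n \<in> borel_measurable M"
    using assms by (auto intro: vanishes_measurable)
  show "\<And>n. (\<lambda>\<omega>. X n \<omega> + Y n \<omega>) \<in> borel_measurable M" by measurable
  fix e :: real assume "0 < e"
  then have "eventually (\<lambda>n. psize (X n) < e / 2) sequentially"
    "eventually (\<lambda>n. psize (Y n) < e / 2) sequentially"
    using assms by (simp_all add: vanishesD_eventually del: less_divide_eq_numeral1)
  then show "eventually (\<lambda>n. psize (\<lambda>\<omega>. X n \<omega> + Y n \<omega>) \<le> e) sequentially"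
  proof eventually_elim
    case (elim n)
    have "psize (\<lambda>\<omega>. X n \<omega> + Y n \<omega>) \<le> psize (X n) + psize (Y n)"
      by (rule psize_add_le) auto
    with elim show ?case by simp
  qed
qed

lemma vanishes_zero: "vanishes (\<lambda>_ _. 0)"
  by (simp add: vanishes_def psize_def)

lemma vanishes_sum:
  assumes "finite I" "\<And>i. i \<in> I \<Longrightarrow> vanishes (X i)"
  shows "vanishes (\<lambda>n \<omega>. \<Sum>i\<in>I. X i n \<omega>)"
  using assms by (induction I rule: finite_induct) (auto intro: vanishes_add vanishes_zero)

lemma vanishes_AE:
  assumes [measurable]: "\<And>n. X n \<in> borel_measurable M"
    and lim: "AE \<omega> in M. (\<lambda>n. X n \<omega>) \<longlonglongrightarrow> 0"
  shows "vanishes X"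
  unfolding vanishes_def
proof (intro conjI allI assms(1))
  have "(\<lambda>n. expectation (\<lambda>\<omega>. min 1 \<bar>X n \<omega>\<bar>)) \<longlonglongrightarrow> expectation (\<lambda>\<omega>. 0)"
  proof (rule integral_dominated_convergence[where w="\<lambda>_. 1"])
    show "AE \<omega> in M. (\<lambda>n. min 1 \<bar>X n \<omega>\<bar>) \<longlonglongrightarrow> 0"
      using lim
    proof eventually_elim
      case (elim \<omega>)
      then have "(\<lambda>n. min 1 \<bar>X n \<omega>\<bar>) \<longlonglongrightarrow> min 1 \<bar>0\<bar>" by (intro tendsto_intros)
      then show ?case by simp
    qed
  qed auto
  then show "(\<lambda>n. psize (X n)) \<longlonglongrightarrow> 0" by (simp add: psize_def)
qed

lemma prob_gt_tendsto_0:
  assumes [measurable]: "C \<in> borel_measurable M"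
  shows "(\<lambda>n. prob {\<omega> \<in> space M. real n < \<bar>C \<omega>\<bar>}) \<longlonglongrightarrow> 0"
proof -
  have "(\<lambda>n. prob {\<omega> \<in> space M. real n < \<bar>C \<omega>\<bar>})
      \<longlonglongrightarrow> prob (\<Inter>n. {\<omega> \<in> space M. real n < \<bar>C \<omega>\<bar>})"
    by (rule finite_Lim_measure_decseq) (auto simp: decseq_def)
  moreover have "(\<Inter>n. {\<omega> \<in> space M. real n < \<bar>C \<omega>\<bar>}) = {}"
  proof (intro equals0I)
    fix \<omega> assume \<omega>: "\<omega> \<in> (\<Inter>n. {\<omega> \<in> space M. real n < \<bar>C \<omega>\<bar>})"
    obtain n where "\<bar>C \<omega>\<bar> < real n" using reals_Archimedean2 by blast
    moreover have "real n < \<bar>C \<omega>\<bar>" using \<omega> by auto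
    ultimately show False by simp
  qed
  ultimately show ?thesis by simp
qed

lemma prob_gt_small:
  assumes "C \<in> borel_measurable M" "0 < e"
  obtains K :: nat where "0 < K" "prob {\<omega> \<in> space M. real K < \<bar>C \<omega>\<bar>} < e"
proof -
  have "eventually (\<lambda>n. prob {\<omega> \<in> space M. real n < \<bar>C \<omega>\<bar>} < e) sequentially"
    using prob_gt_tendsto_0[OF assms(1)] assms(2) by (rule order_tendstoD(2))
  then have "eventually (\<lambda>n. prob {\<omega> \<in> space M. real n < \<bar>C \<omega>\<bar>} < e \<and> 0 < n) sequentially"
    using eventually_gt_at_top by (rule eventually_conj)
  then show ?thesis using that by (auto simp: eventually_sequentially)
qed

text \<open>The factor is one fixed finite random variable, typically a bound along a path, so it
  exceeds a large level \<open>K\<close> with small probability; below that level min(1, K x) \<le>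
  K min(1, x) because \<open>K\<close> is at least 1.\<close>

lemma vanishes_mult:
  assumes X: "vanishes X" and [measurable]: "C \<in> borel_measurable M"
  shows "vanishes (\<lambda>n \<omega>. C \<omega> * X n \<omega>)"
proof (rule vanishesI_eventually)
  have [measurable]: "\<And>n. X n \<in> borel_measurable M"
    using assms by (auto intro: vanishes_measurable)
  show "\<And>n. (\<lambda>\<omega>. C \<omega> * X n \<omega>) \<in> borel_measurable M" by measurable
  fix e :: real assume "0 < e"
  then obtain K :: nat where K: "0 < K" "prob {\<omega> \<in> space M. real K < \<bar>C \<omega>\<bar>} < e / 2"
    using prob_gt_small[of C "e / 2"] by auto
  have "eventually (\<lambda>n. psize (X n) < e / 2 / K) sequentially"
    using X \<open>0 < e\<close> K by (intro vanishesD_eventually) auto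
  then show "eventually (\<lambda>n. psize (\<lambda>\<omega>. C \<omega> * X n \<omega>) \<le> e) sequentially"
  proof eventually_elim
    case (elim n)
    have "psize (\<lambda>\<omega>. C \<omega> * X n \<omega>)
        \<le> prob {\<omega> \<in> space M. real K < \<bar>C \<omega>\<bar>} + psize (\<lambda>\<omega>. real K * X n \<omega>)"
      by (rule psize_le_except) (auto simp: abs_mult not_less intro!: mult_right_mono)
    also have "psize (\<lambda>\<omega>. real K * X n \<omega>) \<le> expectation (\<lambda>\<omega>. real K * min 1 \<bar>X n \<omega>\<bar>)"
      unfolding psize_def
    proof (intro integral_mono_AE integrable_min_abs integrable_mult_right AE_I2)
      fix \<omega> show "min 1 \<bar>real K * X n \<omega>\<bar> \<le> real K * min 1 \<bar>X n \<omega>\<bar>"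
      proof (cases "\<bar>X n \<omega>\<bar> \<le> 1")
        case True
        then show ?thesis by (simp add: abs_mult)
      next
        case False
        with K(1) show ?thesis by simp
      qed
    qed auto
    also have "\<dots> = real K * psize (X n)" by (simp add: psize_def)
    also have "\<dots> \<le> e / 2" using elim K by (simp add: field_simps)
    finally show ?case using K by simp
  qed
qed

lemma vanishes_cmult: "vanishes X \<Longrightarrow> vanishes (\<lambda>n \<omega>. c * X n \<omega>)"
  by (rule vanishes_mult) auto

lemma vanishes_diff:
  "vanishes X \<Longrightarrow> vanishes Y \<Longrightarrow> vanishes (\<lambda>n \<omega>. X n \<omega> - Y n \<omega>)"
  using vanishes_add[of X "\<lambda>n \<omega>. - 1 * Y n \<omega>"] vanishes_cmult[of Y "- 1"] by simp

lemma vanishes_cong_AE: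
  assumes "vanishes X" "\<And>n. Y n \<in> borel_measurable M" "\<And>n. AE \<omega> in M. Y n \<omega> = X n \<omega>"
  shows "vanishes Y"
proof (rule vanishes_mono[OF assms(1,2)])
  show "AE \<omega> in M. \<bar>Y n \<omega>\<bar> \<le> \<bar>X n \<omega>\<bar>" for n
    using assms(3)[of n] by eventually_elim simp
qed

lemma vanishes_square:
  assumes "vanishes X"
  shows "vanishes (\<lambda>n \<omega>. (X n \<omega>)\<^sup>2)"
proof (rule vanishesI_eventually)
  have [measurable]: "\<And>n. X n \<in> borel_measurable M"
    using assms by (auto intro: vanishes_measurable)
  show "\<And>n. (\<lambda>\<omega>. (X n \<omega>)\<^sup>2) \<in> borel_measurable M" by measurable
  fix e :: real assume "0 < e"
  then have "eventually (\<lambda>n. psize (X n) < e) sequentially"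
    using assms by (auto intro: vanishesD_eventually)
  then show "eventually (\<lambda>n. psize (\<lambda>\<omega>. (X n \<omega>)\<^sup>2) \<le> e) sequentially"
  proof eventually_elim
    case (elim n)
    have "psize (\<lambda>\<omega>. (X n \<omega>)\<^sup>2) \<le> psize (X n)"
      unfolding psize_def
    proof (intro integral_mono_AE integrable_min_abs AE_I2)
      fix \<omega>
      have "(X n \<omega>)\<^sup>2 \<le> \<bar>X n \<omega>\<bar>" if "\<bar>X n \<omega>\<bar> \<le> 1"
        using that mult_left_le_one_le[of "\<bar>X n \<omega>\<bar>" "\<bar>X n \<omega>\<bar>"] by (simp add: power2_eq_square)
      then show "min 1 \<bar>(X n \<omega>)\<^sup>2\<bar> \<le> min 1 \<bar>X n \<omega>\<bar>" by (cases "\<bar>X n \<omega>\<bar> \<le> 1") auto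
    qed auto
    with elim show ?case by simp
  qed
qed

lemma vanishes_diff_squares:
  assumes "vanishes (\<lambda>n \<omega>. X n \<omega> - x \<omega>)" and x: "x \<in> borel_measurable M"
  shows "vanishes (\<lambda>n \<omega>. (X n \<omega>)\<^sup>2 - (x \<omega>)\<^sup>2)"
proof -
  have "vanishes (\<lambda>n \<omega>. (X n \<omega> - x \<omega>)\<^sup>2 + (2 * x \<omega>) * (X n \<omega> - x \<omega>))"
    using x by (intro vanishes_add vanishes_square vanishes_mult assms) auto
  then show ?thesis by (simp add: power2_eq_square algebra_simps)
qed

lemma vanishes_prob_gt:
  assumes "vanishes X" "0 < d"
  shows "(\<lambda>n. prob {\<omega> \<in> space M. d < \<bar>X n \<omega>\<bar>}) \<longlonglongrightarrow> 0"
proof -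
  have [measurable]: "\<And>n. X n \<in> borel_measurable M"
    using assms by (auto intro: vanishes_measurable)
  \<comment> \<open>\<open>psize\<close> is capped at 1, so Markov's inequality is available for
    thresholds up to 1.\<close>
  let ?d = "min 1 d"
  have "(\<lambda>n. psize (X n) / ?d) \<longlonglongrightarrow> 0 / ?d"
    using assms by (intro tendsto_divide) (auto simp: vanishes_def)
  then have *: "(\<lambda>n. psize (X n) / ?d) \<longlonglongrightarrow> 0" by simp
  show ?thesis
  proof (rule tendsto_sandwich[OF _ _ tendsto_const *])
    show "eventually (\<lambda>n. prob {\<omega> \<in> space M. d < \<bar>X n \<omega>\<bar>} \<le> psize (X n) / ?d) sequentially"
    proof (intro always_eventually allI)
      fix n
      have "prob {\<omega> \<in> space M. d < \<bar>X n \<omega>\<bar>} \<le> prob {\<omega> \<in> space M. ?d < \<bar>X n \<omega>\<bar>}"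
        by (intro finite_measure_mono) auto
      also have "\<dots> \<le> psize (X n) / ?d"
        using prob_gt_le_psize[of "X n" ?d] assms(2) by (simp add: field_simps)
      finally show "prob {\<omega> \<in> space M. d < \<bar>X n \<omega>\<bar>} \<le> psize (X n) / ?d" .
    qed
  qed auto
qed

lemma vanishesI_prob_gt:
  assumes [measurable]: "\<And>n. X n \<in> borel_measurable M"
    and lim: "\<And>d. 0 < d \<Longrightarrow> (\<lambda>n. prob {\<omega> \<in> space M. d < \<bar>X n \<omega>\<bar>}) \<longlonglongrightarrow> 0"
  shows "vanishes X"
proof (rule vanishesI_eventually)
  fix e :: real assume e: "0 < e"
  have "eventually (\<lambda>n. prob {\<omega> \<in> space M. e / 2 < \<bar>X n \<omega>\<bar>} < e / 2) sequentially"
    using e by (intro order_tendstoD(2)[OF lim]) auto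
  then show "eventually (\<lambda>n. psize (X n) \<le> e) sequentially"
  proof eventually_elim
    case (elim n)
    have "psize (X n) \<le> prob {\<omega> \<in> space M. e / 2 < \<bar>X n \<omega>\<bar>} + psize (\<lambda>_. e / 2)"
      by (rule psize_le_except) (use e in auto)
    also have "psize (\<lambda>_. e / 2) \<le> e / 2"
      using psize_le_expectation_abs[of "\<lambda>_. e / 2"] e by (simp add: prob_space)
    finally show ?case using elim by simp
  qed
qed (fact assms)

end

section \<open>Discrete martingale transforms\<close>

text \<open>Martingale differences in the strong form that holds for Brownian increments:
  independent of the past and of constant variance \<open>v\<close>. The abstraction is instantiated
  twice, with the increments themselves and with their centred squares.\<close>

locale noise = prob_space M for M :: "'w measure" +
  fixes G :: "nat \<Rightarrow> 'w measure" and d :: "nat \<Rightarrow> 'w \<Rightarrow> real" and v :: real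
  assumes subalg: "subalgebra M (G k)"
    and G_mono: "sets (G k) \<subseteq> sets (G (Suc k))"
    and d_measurable: "d k \<in> borel_measurable (G (Suc k))"
    and d_square_integrable: "integrable M (\<lambda>\<omega>. (d k \<omega>)\<^sup>2)"
    and d_mean: "expectation (d k) = 0"
    and d_variance: "expectation (\<lambda>\<omega>. (d k \<omega>)\<^sup>2) = v"
    and d_indep: "g \<in> borel_measurable (G k) \<Longrightarrow> indep_var borel g borel (d k)"
begin

lemma measurable_G_Suc: "f \<in> borel_measurable (G k) \<Longrightarrow> f \<in> borel_measurable (G (Suc k))"
  for f :: "'w \<Rightarrow> real"
  by (rule measurable_from_subalg[rotated])
     (use subalg G_mono[of k] in \<open>auto simp: subalgebra_def\<close>)

lemma measurable_G_mono:
  "f \<in> borel_measurable (G k) \<Longrightarrow> k \<le> l \<Longrightarrow> f \<in> borel_measurable (G l)"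
  for f :: "'w \<Rightarrow> real"
  by (rule dec_induct) (auto intro: measurable_G_Suc)

lemma measurable_G_M: "f \<in> borel_measurable (G k) \<Longrightarrow> f \<in> borel_measurable M"
  for f :: "'w \<Rightarrow> real"
  using subalg by (rule measurable_from_subalg)

lemma d_measurable_M [measurable]: "d k \<in> borel_measurable M"
  using d_measurable by (rule measurable_G_M)

lemma d_integrable: "integrable M (d k)"
  using d_square_integrable by (rule square_integrable_imp_integrable[rotated]) measurable

lemma expectation_mult_d:
  assumes g: "g \<in> borel_measurable (G k)" "integrable M g"
  shows "integrable M (\<lambda>\<omega>. g \<omega> * d k \<omega>)" "expectation (\<lambda>\<omega>. g \<omega> * d k \<omega>) = 0"
  using indep_var_integrable[OF d_indep[OF g(1)] g(2) d_integrable]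
    indep_var_lebesgue_integral[OF d_indep[OF g(1)] g(2) d_integrable] d_mean
  by auto

lemma expectation_mult_d_square:
  assumes g: "g \<in> borel_measurable (G k)" "integrable M g"
  shows "integrable M (\<lambda>\<omega>. g \<omega> * (d k \<omega>)\<^sup>2)"
    "expectation (\<lambda>\<omega>. g \<omega> * (d k \<omega>)\<^sup>2) = expectation g * v"
proof -
  have "indep_var borel ((\<lambda>x. x) \<circ> g) borel ((\<lambda>x. x\<^sup>2) \<circ> d k)"
    by (rule indep_var_compose[OF d_indep[OF g(1)]]) auto
  then have "indep_var borel g borel (\<lambda>\<omega>. (d k \<omega>)\<^sup>2)"
    by (simp add: comp_def)
  from indep_var_integrable[OF this g(2) d_square_integrable]
    indep_var_lebesgue_integral[OF this g(2) d_square_integrable]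
  show "integrable M (\<lambda>\<omega>. g \<omega> * (d k \<omega>)\<^sup>2)"
    "expectation (\<lambda>\<omega>. g \<omega> * (d k \<omega>)\<^sup>2) = expectation g * v"
    using d_variance by auto
qed

lemma transform_measurable:
  assumes "\<And>k. f k \<in> borel_measurable (G k)"
  shows "(\<lambda>\<omega>. \<Sum>k<n. f k \<omega> * d k \<omega>) \<in> borel_measurable (G n)"
  by (intro borel_measurable_sum borel_measurable_times)
     (auto intro: measurable_G_mono[OF assms] measurable_G_mono[OF d_measurable])

text \<open>Ito isometry by induction on \<open>n\<close>: the cross term is a past variable times
  the centred, independent \<open>d n\<close>. The bound on \<open>f\<close> makes the product of
  the partial sum with \<open>f n\<close> integrable.\<close>

lemma transform_isometry:
  assumes f: "\<And>k. f k \<in> borel_measurable (G k)" and bd: "\<And>k \<omega>. \<bar>f k \<omega>\<bar> \<le> C"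
  shows "integrable M (\<lambda>\<omega>. (\<Sum>k<n. f k \<omega> * d k \<omega>)\<^sup>2)"
    and "expectation (\<lambda>\<omega>. (\<Sum>k<n. f k \<omega> * d k \<omega>)\<^sup>2) = v * (\<Sum>k<n. expectation (\<lambda>\<omega>. (f k \<omega>)\<^sup>2))"
proof (induction n)
  case (Suc n)
  let ?Z = "\<lambda>\<omega>. \<Sum>k<n. f k \<omega> * d k \<omega>"
  have Zm: "?Z \<in> borel_measurable (G n)" by (rule transform_measurable[OF f])
  have Z: "integrable M ?Z"
    using Suc.IH(1) by (rule square_integrable_imp_integrable[OF measurable_G_M[OF Zm]])
  have fM: "f n \<in> borel_measurable M" by (rule measurable_G_M[OF f])
  have Zf: "integrable M (\<lambda>\<omega>. ?Z \<omega> * f n \<omega>)"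
  proof (rule Bochner_Integration.integrable_bound[OF integrable_mult_left[OF Z, of C]])
    show "AE \<omega> in M. norm (?Z \<omega> * f n \<omega>) \<le> norm (?Z \<omega> * C)"
    proof (rule AE_I2)
      fix \<omega>
      have "\<bar>f n \<omega>\<bar> \<le> \<bar>C\<bar>" using bd[of n \<omega>] by linarith
      then show "norm (?Z \<omega> * f n \<omega>) \<le> norm (?Z \<omega> * C)"
        by (auto simp: abs_mult intro!: mult_left_mono)
    qed
  qed (use fM measurable_G_M[OF Zm] in measurable)
  have f2: "integrable M (\<lambda>\<omega>. (f n \<omega>)\<^sup>2)"
    using fM power_mono[OF bd[of n] abs_ge_zero, where n=2]
    by (intro integrable_const_bound[where B="C\<^sup>2"] AE_I2) auto
  have cross: "integrable M (\<lambda>\<omega>. (?Z \<omega> * f n \<omega>) * d n \<omega>)"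
      "expectation (\<lambda>\<omega>. (?Z \<omega> * f n \<omega>) * d n \<omega>) = 0"
    by (rule expectation_mult_d[OF borel_measurable_times[OF Zm f] Zf])+
  have sq: "integrable M (\<lambda>\<omega>. (f n \<omega>)\<^sup>2 * (d n \<omega>)\<^sup>2)"
      "expectation (\<lambda>\<omega>. (f n \<omega>)\<^sup>2 * (d n \<omega>)\<^sup>2) = expectation (\<lambda>\<omega>. (f n \<omega>)\<^sup>2) * v"
    using f by (intro expectation_mult_d_square f2; measurable)+
  have eq: "(\<lambda>\<omega>. (\<Sum>k<Suc n. f k \<omega> * d k \<omega>)\<^sup>2) =
      (\<lambda>\<omega>. (?Z \<omega>)\<^sup>2 + (2 * ((?Z \<omega> * f n \<omega>) * d n \<omega>) + (f n \<omega>)\<^sup>2 * (d n \<omega>)\<^sup>2))"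
    by (auto simp: power2_eq_square algebra_simps)
  show "integrable M (\<lambda>\<omega>. (\<Sum>k<Suc n. f k \<omega> * d k \<omega>)\<^sup>2)"
    unfolding eq by (intro Bochner_Integration.integrable_add integrable_mult_right Suc.IH(1) cross(1) sq(1))
  show "expectation (\<lambda>\<omega>. (\<Sum>k<Suc n. f k \<omega> * d k \<omega>)\<^sup>2)
      = v * (\<Sum>k<Suc n. expectation (\<lambda>\<omega>. (f k \<omega>)\<^sup>2))"
    unfolding eq
    by (subst Bochner_Integration.integral_add[OF Suc.IH(1)],
        intro Bochner_Integration.integrable_add integrable_mult_right cross(1) sq(1),
        subst Bochner_Integration.integral_add)
       (use Suc.IH(2) cross sq in \<open>auto simp: algebra_simps\<close>)
qed auto

lemma transform_mean_zero:
  assumes f: "\<And>k. f k \<in> borel_measurable (G k)" and bd: "\<And>k \<omega>. \<bar>f k \<omega>\<bar> \<le> C"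
  shows "expectation (\<lambda>\<omega>. \<Sum>k<n. f k \<omega> * d k \<omega>) = 0"
proof -
  have "integrable M (f k)" for k
    using bd by (intro integrable_const_bound[where B=C]) (auto intro: measurable_G_M[OF f])
  then show ?thesis
    by (subst Bochner_Integration.integral_sum) (auto intro!: sum.neutral simp: expectation_mult_d[OF f])
qed

text \<open>Lenglart's domination: the quadratic variation controls the transform in probability,
  because stopping at level \<open>\<delta>\<close> of the (predictable) quadratic variation
  makes the isometry applicable.\<close>

lemma transform_psize_le:
  assumes f: "\<And>k. f k \<in> borel_measurable (G k)" and v: "0 < v" and \<delta>: "0 < \<delta>"
  shows "psize (\<lambda>\<omega>. \<Sum>k<n. f k \<omega> * d k \<omega>)
    \<le> prob {\<omega> \<in> space M. \<delta> < v * (\<Sum>k<n. (f k \<omega>)\<^sup>2)} + sqrt \<delta>"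
proof -
  \<comment> \<open>The sum includes the current index: \<open>f k\<close> is already known at stage
    \<open>k\<close>, so cutting before the level is passed keeps \<open>g\<close> adapted and its
    weighted square sum below \<open>\<delta>\<close> without overshoot.\<close>
  define g where "g k \<omega> = (if v * (\<Sum>j<Suc k. (f j \<omega>)\<^sup>2) \<le> \<delta> then f k \<omega> else 0)" for k \<omega>
  have fm: "f j \<in> borel_measurable (G k)" if "j \<le> k" for j k
    using f that by (rule measurable_G_mono)
  have [measurable]: "f k \<in> borel_measurable M" for k by (rule measurable_G_M[OF f])
  have g: "g k \<in> borel_measurable (G k)" for k
  proof -
    have "(\<lambda>\<omega>. v * (\<Sum>j<Suc k. (f j \<omega>)\<^sup>2)) \<in> borel_measurable (G k)"
      by (intro borel_measurable_times borel_measurable_const borel_measurable_sum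
          borel_measurable_power fm) auto
    then show ?thesis unfolding g_def using f[of k] by measurable
  qed
  have [measurable]: "g k \<in> borel_measurable M" for k by (rule measurable_G_M[OF g])
  have sum_g: "v * (\<Sum>k<n. (g k \<omega>)\<^sup>2) \<le> \<delta> \<and> (\<Sum>k<n. (g k \<omega>)\<^sup>2) \<le> (\<Sum>k<n. (f k \<omega>)\<^sup>2)" for n \<omega>
  proof (induction n)
    case (Suc n)
    then show ?case
    proof (cases "v * (\<Sum>j<Suc n. (f j \<omega>)\<^sup>2) \<le> \<delta>")
      case True
      have "(\<Sum>k<Suc n. (g k \<omega>)\<^sup>2) \<le> (\<Sum>k<Suc n. (f k \<omega>)\<^sup>2)"
        using Suc True by (simp add: g_def)
      then show ?thesis using True v by (meson mult_left_mono less_imp_le order.trans)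
    next
      case False
      then have "g n \<omega> = 0" by (simp add: g_def)
      with Suc show ?thesis by (simp add: add_increasing2)
    qed
  qed (use \<delta> in auto)
  have bd: "\<bar>g k \<omega>\<bar> \<le> sqrt (\<delta> / v)" for k \<omega>
  proof -
    have "v * (g k \<omega>)\<^sup>2 \<le> v * (\<Sum>k<Suc k. (g k \<omega>)\<^sup>2)"
      using v by (intro mult_left_mono member_le_sum) auto
    also have "\<dots> \<le> \<delta>" using sum_g by blast
    finally have "(g k \<omega>)\<^sup>2 \<le> \<delta> / v" using v by (simp add: field_simps)
    then show ?thesis using real_le_rsqrt by fastforce
  qed
  let ?Z = "\<lambda>\<omega>. \<Sum>k<n. g k \<omega> * d k \<omega>"
  note Z2 = transform_isometry[OF g bd, of n]
  have Z: "integrable M ?Z"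
    by (rule square_integrable_imp_integrable[OF _ Z2(1)]) measurable
  have g2: "integrable M (\<lambda>\<omega>. (g k \<omega>)\<^sup>2)" for k
    using power_mono[OF bd[of k] abs_ge_zero, where n=2]
    by (intro integrable_const_bound[where B="(sqrt (\<delta> / v))\<^sup>2"] AE_I2) auto
  have "expectation (\<lambda>\<omega>. (?Z \<omega>)\<^sup>2) = expectation (\<lambda>\<omega>. v * (\<Sum>k<n. (g k \<omega>)\<^sup>2))"
    using g2 by (simp add: Z2(2) Bochner_Integration.integral_sum)
  also have "\<dots> \<le> expectation (\<lambda>\<omega>. \<delta>)"
    using g2 sum_g by (intro integral_mono_AE) auto
  finally have EZ: "expectation (\<lambda>\<omega>. (?Z \<omega>)\<^sup>2) \<le> \<delta>" by (simp add: prob_space)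
  \<comment> \<open>Young's inequality with weight \<open>sqrt \<delta>\<close>: both halves
    contribute \<open>sqrt \<delta> / 2\<close> once the second moment is at most
    \<open>\<delta>\<close>.\<close>
  have "expectation (\<lambda>\<omega>. \<bar>?Z \<omega>\<bar>) \<le> expectation (\<lambda>\<omega>. (?Z \<omega>)\<^sup>2 / (2 * sqrt \<delta>) + sqrt \<delta> / 2)"
  proof (intro integral_mono_AE AE_I2)
    fix \<omega>
    have "2 * \<bar>?Z \<omega>\<bar> * sqrt \<delta> \<le> (?Z \<omega>)\<^sup>2 + (sqrt \<delta>)\<^sup>2"
      using sum_squares_bound[of "\<bar>?Z \<omega>\<bar>" "sqrt \<delta>"] by simp
    then show "\<bar>?Z \<omega>\<bar> \<le> (?Z \<omega>)\<^sup>2 / (2 * sqrt \<delta>) + sqrt \<delta> / 2"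
      using \<delta> by (simp add: field_simps power2_eq_square)
  qed (use Z Z2 in auto)
  also have "\<dots> = expectation (\<lambda>\<omega>. (?Z \<omega>)\<^sup>2) / (2 * sqrt \<delta>) + sqrt \<delta> / 2"
    using Z2(1) by (simp add: prob_space)
  also have "\<dots> \<le> \<delta> / (2 * sqrt \<delta>) + sqrt \<delta> / 2"
    using EZ \<delta> by (intro add_right_mono divide_right_mono) auto
  also have "\<dots> = sqrt \<delta>"
    using \<delta> by (simp add: field_simps)
  finally have "psize ?Z \<le> sqrt \<delta>"
    using psize_le_expectation_abs[OF Z] by simp
  moreover have "psize (\<lambda>\<omega>. \<Sum>k<n. f k \<omega> * d k \<omega>)
    \<le> prob {\<omega> \<in> space M. \<delta> < v * (\<Sum>k<n. (f k \<omega>)\<^sup>2)} + psize ?Z"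
  proof (rule psize_le_except)
    show "AE \<omega> in M. \<omega> \<notin> {\<omega> \<in> space M. \<delta> < v * (\<Sum>k<n. (f k \<omega>)\<^sup>2)} \<longrightarrow>
        \<bar>\<Sum>k<n. f k \<omega> * d k \<omega>\<bar> \<le> \<bar>?Z \<omega>\<bar>"
    proof (rule AE_I2, rule impI)
      fix \<omega> assume "\<omega> \<in> space M" "\<omega> \<notin> {\<omega> \<in> space M. \<delta> < v * (\<Sum>k<n. (f k \<omega>)\<^sup>2)}"
      then have *: "v * (\<Sum>k<n. (f k \<omega>)\<^sup>2) \<le> \<delta>" by auto
      have "g k \<omega> = f k \<omega>" if "k < n" for k
      proof -
        have "v * (\<Sum>j<Suc k. (f j \<omega>)\<^sup>2) \<le> v * (\<Sum>k<n. (f k \<omega>)\<^sup>2)"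
          using that v by (intro mult_left_mono sum_mono2) auto
        with * show ?thesis by (simp add: g_def)
      qed
      then show "\<bar>\<Sum>k<n. f k \<omega> * d k \<omega>\<bar> \<le> \<bar>?Z \<omega>\<bar>" by simp
    qed
  qed measurable
  ultimately show ?thesis by simp
qed

end

section \<open>Brownian motion and its completed filtration\<close>

lemma sets_Collect_mem:
  "f \<in> borel_measurable M \<Longrightarrow> B \<in> sets borel \<Longrightarrow> {\<omega> \<in> space M. f \<omega> \<in> B} \<in> sets M"
  using measurable_sets[of f M borel B] by (simp add: vimage_def Int_def conj_commute)

text \<open>What \<open>wiener\<close> offers is independence of finitely many consecutive
  increments. Sorting the times together with 0 and \<open>s\<close> makes each past value a partial
  sum of increments before \<open>s\<close>, up to the initial value \<open>W 0\<close>, which is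
  almost surely 0.\<close>

lemma wiener_cylinder_indep:
  assumes W: "wiener M W" and st: "0 \<le> s" "s < t"
    and R: "finite R" "R \<subseteq> {0..s}" and B: "\<And>r. r \<in> R \<Longrightarrow> B r \<in> sets borel"
    and C: "C \<in> sets borel"
  shows "measure M ({\<omega> \<in> space M. \<forall>r\<in>R. W r \<omega> \<in> B r} \<inter> {\<omega> \<in> space M. W t \<omega> - W s \<omega> \<in> C})
    = measure M {\<omega> \<in> space M. \<forall>r\<in>R. W r \<omega> \<in> B r} * measure M {\<omega> \<in> space M. W t \<omega> - W s \<omega> \<in> C}"
proof -
  interpret prob_space M using W by (simp add: wiener_def)
  have Wm [measurable]: "W r \<in> borel_measurable M" for r using W by (simp add: wiener_def)
  define xs where "xs = sorted_list_of_set (insert 0 (insert s R))"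
  define k where "k = length xs"
  \<comment> \<open>Beyond the list the partition sits at \<open>t\<close>, so increment number
    \<open>k - 1\<close> is exactly the one from \<open>s\<close> to \<open>t\<close> and all lower
    ones lie before \<open>s\<close>.\<close>
  define ts where "ts i = (if i < k then xs ! i else t)" for i
  have xs: "sorted xs" "distinct xs" "set xs = insert 0 (insert s R)"
    unfolding xs_def
    by (rule sorted_sorted_list_of_set, rule distinct_sorted_list_of_set,
        rule set_sorted_list_of_set) (use R(1) in simp)
  have bounds: "0 \<le> x \<and> x \<le> s" if "x \<in> set xs" for x using that xs(3) R(2) st by auto
  have k: "0 < k" using xs(3) by (cases xs) (auto simp: k_def)
  have nth: "\<exists>i<k. xs ! i = x" if "x \<in> insert 0 (insert s R)" for x
    using that unfolding xs(3)[symmetric] by (auto simp: in_set_conv_nth k_def)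
  have ts_0: "ts 0 = 0"
  proof -
    obtain i where i: "i < k" "xs ! i = 0" using nth[of 0] by auto
    have "xs ! 0 \<le> xs ! i" using xs(1) i by (intro sorted_nth_mono) (auto simp: k_def)
    moreover have "0 \<le> xs ! 0" using bounds[of "xs ! 0"] k by (simp add: k_def)
    ultimately show ?thesis using i k by (simp add: ts_def)
  qed
  have ts_last: "ts (k - 1) = s"
  proof -
    obtain i where i: "i < k" "xs ! i = s" using nth[of s] by auto
    have "xs ! i \<le> xs ! (k - 1)" using xs(1) i by (intro sorted_nth_mono) (auto simp: k_def)
    moreover have "xs ! (k - 1) \<le> s" using bounds[of "xs ! (k - 1)"] k by (simp add: k_def)
    ultimately show ?thesis using i k by (simp add: ts_def)
  qed
  have mono: "ts i \<le> ts (Suc i)" if "i < k" for i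
  proof (cases "Suc i < k")
    case True
    then show ?thesis using xs(1) by (auto simp: ts_def k_def intro: sorted_nth_mono)
  next
    case False
    with that have "i = k - 1" "Suc i = k" by auto
    then show ?thesis using ts_last st(2) by (simp add: ts_def)
  qed
  define D where "D i \<omega> = W (ts (Suc i)) \<omega> - W (ts i) \<omega>" for i \<omega>
  have ind: "indep_vars (\<lambda>_. borel) D {..<k}"
    using W mono ts_0 unfolding wiener_def D_def by auto
  let ?P = "PiM {..<k-1} (\<lambda>_. borel :: real measure)" and ?Q = "PiM {k-1} (\<lambda>_. borel :: real measure)"
  have ind2: "indep_var ?P (\<lambda>\<omega>. restrict (\<lambda>i. D i \<omega>) {..<k-1}) ?Q (\<lambda>\<omega>. restrict (\<lambda>i. D i \<omega>) {k-1})"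
    using k by (intro indep_var_restrict[OF ind]) auto
  have "\<forall>r\<in>R. \<exists>i<k. xs ! i = r"
    using nth by auto
  then obtain idx where idx: "\<And>r. r \<in> R \<Longrightarrow> idx r < k \<and> xs ! idx r = r" by metis
  define E1 where "E1 = {x \<in> space ?P. \<forall>r\<in>R. (\<Sum>i<idx r. x i) \<in> B r}"
  define E2 where "E2 = {x \<in> space ?Q. x (k - 1) \<in> C}"
  have E1: "E1 \<in> sets ?P"
    unfolding E1_def
  proof (rule sets.sets_Collect_finite_All)
    fix r assume r: "r \<in> R"
    have "(\<lambda>x. \<Sum>i<idx r. x i) \<in> borel_measurable ?P"
      using idx[OF r] by (intro borel_measurable_sum measurable_component_singleton) auto
    then show "{x \<in> space ?P. (\<Sum>i<idx r. x i) \<in> B r} \<in> sets ?P"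
      using B[OF r] by measurable
  qed (fact R(1))
  have E2: "E2 \<in> sets ?Q"
  proof -
    have "(\<lambda>x. x (k - 1)) \<in> borel_measurable ?Q" by (intro measurable_component_singleton) auto
    then show ?thesis unfolding E2_def using C by measurable
  qed
  have eq1: "(\<lambda>\<omega>. restrict (\<lambda>i. D i \<omega>) {..<k-1}) -` E1 \<inter> space M
      = {\<omega> \<in> space M. \<forall>r\<in>R. W r \<omega> - W 0 \<omega> \<in> B r}" (is "?L = ?R")
  proof -
    have "(\<Sum>i<idx r. restrict (\<lambda>i. D i \<omega>) {..<k-1} i) = W r \<omega> - W 0 \<omega>" if "r \<in> R" for r \<omega>
    proof -
      have "(\<Sum>i<idx r. restrict (\<lambda>i. D i \<omega>) {..<k-1} i) = (\<Sum>i<idx r. D i \<omega>)"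
        using idx[OF that] by (intro sum.cong) auto
      also have "\<dots> = W (ts (idx r)) \<omega> - W (ts 0) \<omega>"
        unfolding D_def by (rule sum_lessThan_telescope[of "\<lambda>i. W (ts i) \<omega>"])
      also have "ts (idx r) = r" using idx[OF that] by (simp add: ts_def)
      finally show ?thesis by (simp add: ts_0)
    qed
    then show ?thesis by (auto simp: E1_def space_PiM)
  qed
  have eq2: "(\<lambda>\<omega>. restrict (\<lambda>i. D i \<omega>) {k-1}) -` E2 \<inter> space M = {\<omega> \<in> space M. W t \<omega> - W s \<omega> \<in> C}"
    using k ts_last by (auto simp: E2_def D_def space_PiM ts_def)
  have fin: "prob ({\<omega> \<in> space M. \<forall>r\<in>R. W r \<omega> - W 0 \<omega> \<in> B r} \<inter> {\<omega> \<in> space M. W t \<omega> - W s \<omega> \<in> C})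
    = prob {\<omega> \<in> space M. \<forall>r\<in>R. W r \<omega> - W 0 \<omega> \<in> B r} * prob {\<omega> \<in> space M. W t \<omega> - W s \<omega> \<in> C}"
  proof -
    have "(\<lambda>x. (\<lambda>i\<in>{..<k-1}. D i x, \<lambda>i\<in>{k-1}. D i x)) -` (E1 \<times> E2) \<inter> space M
      = ((\<lambda>\<omega>. restrict (\<lambda>i. D i \<omega>) {..<k-1}) -` E1 \<inter> space M) \<inter> ((\<lambda>\<omega>. restrict (\<lambda>i. D i \<omega>) {k-1}) -` E2 \<inter> space M)"
      by auto
    then show ?thesis
      using indep_varD[OF ind2 E1 E2] by (simp only: eq1 eq2)
  qed
  have W0: "AE \<omega> in M. W 0 \<omega> = 0" using W by (simp add: wiener_def)
  have meas [measurable]: "{\<omega> \<in> space M. W t \<omega> - W s \<omega> \<in> C} \<in> events"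
    using C by measurable
  have meas1 [measurable]: "{\<omega> \<in> space M. \<forall>r\<in>R. W r \<omega> - W 0 \<omega> \<in> B r} \<in> events"
    using B R(1) by (intro sets.sets_Collect_finite_All) (auto intro!: sets_Collect_mem)
  have meas2 [measurable]: "{\<omega> \<in> space M. \<forall>r\<in>R. W r \<omega> \<in> B r} \<in> events"
    using B R(1) by (intro sets.sets_Collect_finite_All) (auto intro!: sets_Collect_mem)
  have p1: "prob {\<omega> \<in> space M. \<forall>r\<in>R. W r \<omega> \<in> B r} = prob {\<omega> \<in> space M. \<forall>r\<in>R. W r \<omega> - W 0 \<omega> \<in> B r}"
    using W0 by (intro measure_eq_AE) auto
  have p2: "prob ({\<omega> \<in> space M. \<forall>r\<in>R. W r \<omega> \<in> B r} \<inter> {\<omega> \<in> space M. W t \<omega> - W s \<omega> \<in> C})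
    = prob ({\<omega> \<in> space M. \<forall>r\<in>R. W r \<omega> - W 0 \<omega> \<in> B r} \<inter> {\<omega> \<in> space M. W t \<omega> - W s \<omega> \<in> C})"
    using W0 by (intro measure_eq_AE) auto
  show ?thesis unfolding p1 p2 by (rule fin)
qed

lemma sets_nat_filt:
  "sets (nat_filt M W t) = sigma_sets (space M)
     (\<Union>s\<in>{0..t}. {W s -` B \<inter> space M | B. B \<in> sets borel})"
  unfolding nat_filt_def by (rule sets_measure_of) auto

lemma space_nat_filt: "space (nat_filt M W t) = space M"
  unfolding nat_filt_def by (rule space_measure_of) auto

text \<open>Finite-dimensional cylinders and increment events are both closed under intersection and
  generate the two sigma-algebras, so independence extends from the generators.\<close>

lemma wiener_nat_filt_indep:
  assumes W: "wiener M W" and st: "0 \<le> s" "s < t"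
    and A: "A \<in> sets (nat_filt M W s)" and C: "C \<in> sets borel"
  shows "measure M (A \<inter> {\<omega> \<in> space M. W t \<omega> - W s \<omega> \<in> C})
    = measure M A * measure M {\<omega> \<in> space M. W t \<omega> - W s \<omega> \<in> C}"
proof -
  interpret prob_space M using W by (simp add: wiener_def)
  have [measurable]: "W r \<in> borel_measurable M" for r using W by (simp add: wiener_def)
  let ?\<C> = "{{\<omega> \<in> space M. \<forall>r\<in>R. W r \<omega> \<in> B r} | R B. finite R \<and> R \<subseteq> {0..s} \<and> (\<forall>r\<in>R. B r \<in> sets borel)}"
  let ?\<D> = "{{\<omega> \<in> space M. W t \<omega> - W s \<omega> \<in> C} | C. C \<in> sets (borel :: real measure)}"
  have ev: "{\<omega> \<in> space M. \<forall>r\<in>R. W r \<omega> \<in> B r} \<in> events"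
    if "finite R" "\<forall>r\<in>R. B r \<in> sets borel" for R B
    using that by (intro sets.sets_Collect_finite_All) (simp_all add: sets_Collect_mem)
  have "indep_set ?\<C> ?\<D>"
  proof (rule indep_setI)
    show "?\<C> \<subseteq> events" using ev by auto
    show "?\<D> \<subseteq> events" by (auto intro!: sets_Collect_mem)
    fix a b assume "a \<in> ?\<C>" "b \<in> ?\<D>"
    then show "prob (a \<inter> b) = prob a * prob b"
      using wiener_cylinder_indep[OF W st] by auto
  qed
  moreover have "Int_stable ?\<C>"
  proof (rule Int_stableI)
    fix a b assume "a \<in> ?\<C>" "b \<in> ?\<C>"
    then obtain R B R' B' where
      a: "a = {\<omega> \<in> space M. \<forall>r\<in>R. W r \<omega> \<in> B r}" "finite R" "R \<subseteq> {0..s}" "\<forall>r\<in>R. B r \<in> sets borel"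
      and b: "b = {\<omega> \<in> space M. \<forall>r\<in>R'. W r \<omega> \<in> B' r}" "finite R'" "R' \<subseteq> {0..s}" "\<forall>r\<in>R'. B' r \<in> sets borel"
      by auto
    \<comment> \<open>Times missing from one cylinder are constrained by \<open>UNIV\<close>, which
      lets both cylinders be written over the same index set.\<close>
    define B'' where "B'' r = (if r \<in> R then B r else UNIV) \<inter> (if r \<in> R' then B' r else UNIV)" for r
    have "a \<inter> b = {\<omega> \<in> space M. \<forall>r\<in>R \<union> R'. W r \<omega> \<in> B'' r}"
      unfolding a(1) b(1) B''_def by auto
    moreover have "\<forall>r\<in>R \<union> R'. B'' r \<in> sets borel"
      using a(4) b(4) by (auto simp: B''_def)
    ultimately show "a \<inter> b \<in> ?\<C>"
      using a(2,3) b(2,3) by (intro CollectI exI[of _ "R \<union> R'"] exI[of _ B'']) auto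
  qed
  moreover have "Int_stable ?\<D>"
  proof (rule Int_stableI)
    fix a b assume "a \<in> ?\<D>" "b \<in> ?\<D>"
    then obtain C C' where "a = {\<omega> \<in> space M. W t \<omega> - W s \<omega> \<in> C}" "b = {\<omega> \<in> space M. W t \<omega> - W s \<omega> \<in> C'}"
      "C \<in> sets borel" "C' \<in> sets borel" by auto
    then show "a \<inter> b \<in> ?\<D>"
      by (intro CollectI exI[of _ "C \<inter> C'"]) auto
  qed
  ultimately have ind: "indep_set (sigma_sets (space M) ?\<C>) (sigma_sets (space M) ?\<D>)"
    by (rule indep_set_sigma_sets)
  have "sigma_sets (space M) (\<Union>s\<in>{0..s}. {W s -` B \<inter> space M | B. B \<in> sets borel})
      \<subseteq> sigma_sets (space M) ?\<C>"
  proof (rule sigma_sets_mono', safe)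
    fix r B assume "r \<in> {0..s}" "B \<in> sets (borel :: real measure)"
    then show "\<exists>R Ba. W r -` B \<inter> space M = {\<omega> \<in> space M. \<forall>r\<in>R. W r \<omega> \<in> Ba r} \<and> finite R \<and> R \<subseteq> {0..s} \<and> (\<forall>r\<in>R. Ba r \<in> sets borel)"
      by (intro exI[of _ "{r}"] exI[of _ "\<lambda>_. B"]) auto
  qed
  then have "A \<in> sigma_sets (space M) ?\<C>" using A by (auto simp: sets_nat_filt)
  moreover have "{\<omega> \<in> space M. W t \<omega> - W s \<omega> \<in> C} \<in> sigma_sets (space M) ?\<D>"
    using C by (intro sigma_sets.Basic) auto
  ultimately show ?thesis by (rule indep_setD[OF ind])
qed

text \<open>Augmentation by null sets within the measurable sets. It matches \<open>adapted\<close>,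
  which supplies at each time only an almost sure version, and it makes the filtration insensitive
  to changing paths on a null set. The family inside \<open>sigma\<close> is already a
  sigma-algebra, see \<open>sets_cfilt\<close>.\<close>

definition cfilt :: "'w measure \<Rightarrow> (real \<Rightarrow> 'w \<Rightarrow> real) \<Rightarrow> real \<Rightarrow> 'w measure" where
  "cfilt M W t = sigma (space M)
     {A \<in> sets M. \<exists>B \<in> sets (nat_filt M W t). AE \<omega> in M. \<omega> \<in> A \<longleftrightarrow> \<omega> \<in> B}"

lemma space_cfilt: "space (cfilt M W t) = space M"
  unfolding cfilt_def by (rule space_measure_of) (auto dest: sets.sets_into_space)

lemma sets_cfilt:
  "sets (cfilt M W t) = {A \<in> sets M. \<exists>B \<in> sets (nat_filt M W t). AE \<omega> in M. \<omega> \<in> A \<longleftrightarrow> \<omega> \<in> B}"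
proof -
  let ?A = "{A \<in> sets M. \<exists>B \<in> sets (nat_filt M W t). AE \<omega> in M. \<omega> \<in> A \<longleftrightarrow> \<omega> \<in> B}"
  have "sigma_algebra (space M) ?A"
    unfolding sigma_algebra_iff2
  proof (intro conjI ballI allI impI)
    show "?A \<subseteq> Pow (space M)" by (auto dest: sets.sets_into_space)
    show "{} \<in> ?A" by (auto intro!: bexI[of _ "{}"])
    fix A assume "A \<in> ?A"
    then obtain B where B: "A \<in> sets M" "B \<in> sets (nat_filt M W t)" "AE \<omega> in M. \<omega> \<in> A \<longleftrightarrow> \<omega> \<in> B" by auto
    have "space M - B \<in> sets (nat_filt M W t)"
      using sets.compl_sets[OF B(2)] by (simp add: space_nat_filt)
    with B show "space M - A \<in> ?A" by (auto intro!: bexI[of _ "space M - B"])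
  next
    fix A :: "nat \<Rightarrow> 'a set" assume A: "range A \<subseteq> ?A"
    then have "\<forall>i. \<exists>B. B \<in> sets (nat_filt M W t) \<and> (AE \<omega> in M. \<omega> \<in> A i \<longleftrightarrow> \<omega> \<in> B)" by auto
    then obtain B where B: "\<And>i. B i \<in> sets (nat_filt M W t)" "\<And>i. AE \<omega> in M. \<omega> \<in> A i \<longleftrightarrow> \<omega> \<in> B i" by metis
    have "AE \<omega> in M. \<forall>i. \<omega> \<in> A i \<longleftrightarrow> \<omega> \<in> B i" using B(2) by (simp add: AE_all_countable)
    then have "AE \<omega> in M. \<omega> \<in> (\<Union>i. A i) \<longleftrightarrow> \<omega> \<in> (\<Union>i. B i)" by eventually_elim auto
    moreover have "(\<Union>i. A i) \<in> sets M" using A by auto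
    moreover have "(\<Union>i. B i) \<in> sets (nat_filt M W t)" using B(1) by auto
    ultimately show "(\<Union>i. A i) \<in> ?A" by blast
  qed
  then show ?thesis unfolding cfilt_def by (rule sigma_algebra.sets_measure_of_eq)
qed

lemma measurable_cfilt_AE:
  assumes f: "f \<in> borel_measurable M" and g: "g \<in> borel_measurable (nat_filt M W t)"
    and AE: "AE \<omega> in M. f \<omega> = g \<omega>"
  shows "f \<in> borel_measurable (cfilt M W t)"
proof (rule measurableI)
  fix A :: "'b set" assume A: "A \<in> sets borel"
  have "g -` A \<inter> space M \<in> sets (nat_filt M W t)"
    using measurable_sets[OF g A] by (simp add: space_nat_filt)
  moreover have "f -` A \<inter> space M \<in> sets M"
    using f A by (rule measurable_sets)
  moreover have "AE \<omega> in M. \<omega> \<in> f -` A \<inter> space M \<longleftrightarrow> \<omega> \<in> g -` A \<inter> space M"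
    using AE by eventually_elim auto
  ultimately show "f -` A \<inter> space (cfilt M W t) \<in> sets (cfilt M W t)"
    unfolding sets_cfilt space_cfilt by blast
qed simp

lemma nat_filt_mono:
  assumes "s \<le> t"
  shows "sets (nat_filt M W s) \<subseteq> sets (nat_filt M W t)"
  unfolding sets_nat_filt using assms by (intro sigma_sets_mono' UN_mono) auto

lemma measurable_nat_filt:
  assumes "0 \<le> t"
  shows "W t \<in> borel_measurable (nat_filt M W t)"
proof (rule measurableI)
  fix A :: "real set" assume "A \<in> sets borel"
  then show "W t -` A \<inter> space (nat_filt M W t) \<in> sets (nat_filt M W t)"
    using assms unfolding sets_nat_filt space_nat_filt by (intro sigma_sets.Basic) (auto intro!: bexI[of _ t])
qed simp

text \<open>Paths are continuous everywhere on the real line rather than almost surely on the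
  half-line, so that pathwise arguments carry no exceptional set. The filtration is abstract, with
  independence of increments stated against all of it.\<close>

locale brownian = prob_space M for M :: "'w measure" +
  fixes F :: "real \<Rightarrow> 'w measure" and W :: "real \<Rightarrow> 'w \<Rightarrow> real"
  assumes F_subalg: "subalgebra M (F t)"
    and F_mono: "s \<le> t \<Longrightarrow> sets (F s) \<subseteq> sets (F t)"
    and W_adapted: "0 \<le> t \<Longrightarrow> W t \<in> borel_measurable (F t)"
    and W_continuous: "\<omega> \<in> space M \<Longrightarrow> continuous_on UNIV (\<lambda>t. W t \<omega>)"
    and W_normal: "0 \<le> s \<Longrightarrow> s < t \<Longrightarrow>
      distributed M lborel (\<lambda>\<omega>. W t \<omega> - W s \<omega>) (normal_density 0 (sqrt (t - s)))"
    and W_indep: "0 \<le> s \<Longrightarrow> s < t \<Longrightarrow> g \<in> borel_measurable (F s) \<Longrightarrow>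
      indep_var borel g borel (\<lambda>\<omega>. W t \<omega> - W s \<omega>)"

text \<open>Every event of the augmented past, and every event about an increment of
  \<open>V\<close>, differs by a null set from one about \<open>W\<close>, so the product rule
  carries over.\<close>

lemma wiener_brownian:
  assumes W: "wiener M W"
    and V: "\<And>t. V t \<in> borel_measurable M" "AE \<omega> in M. \<forall>t\<ge>0. V t \<omega> = W t \<omega>"
    and cont: "\<And>\<omega>. \<omega> \<in> space M \<Longrightarrow> continuous_on UNIV (\<lambda>t. V t \<omega>)"
  shows "brownian M (cfilt M W) V"
proof -
  interpret prob_space M using W by (simp add: wiener_def)
  have Wm [measurable]: "W r \<in> borel_measurable M" for r using W by (simp add: wiener_def)
  note V(1)[measurable]
  have subalg: "subalgebra M (cfilt M W t)" for t
    by (auto simp: subalgebra_def space_cfilt sets_cfilt)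
  show ?thesis
  proof unfold_locales
    show "subalgebra M (cfilt M W t)" for t by (rule subalg)
    show "sets (cfilt M W s) \<subseteq> sets (cfilt M W t)" if "s \<le> t" for s t
      using nat_filt_mono[OF that, of M W] by (auto simp: sets_cfilt)
    show "V t \<in> borel_measurable (cfilt M W t)" if "0 \<le> t" for t
      by (rule measurable_cfilt_AE[OF V(1) measurable_nat_filt[OF that]])
         (use V(2) that in \<open>auto elim!: eventually_mono\<close>)
    show "continuous_on UNIV (\<lambda>t. V t \<omega>)" if "\<omega> \<in> space M" for \<omega> using that by (rule cont)
    show "distributed M lborel (\<lambda>\<omega>. V t \<omega> - V s \<omega>) (normal_density 0 (sqrt (t - s)))"
      if "0 \<le> s" "s < t" for s t
    proof -
      have "distributed M lborel (\<lambda>\<omega>. W t \<omega> - W s \<omega>) (normal_density 0 (sqrt (t - s)))"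
        using W that by (simp add: wiener_def)
      moreover have "distr M lborel (\<lambda>\<omega>. V t \<omega> - V s \<omega>) = distr M lborel (\<lambda>\<omega>. W t \<omega> - W s \<omega>)"
        using V(2) that by (intro distr_cong_AE) (auto elim!: eventually_mono)
      ultimately show ?thesis by (simp add: distributed_def)
    qed
    show "indep_var borel g borel (\<lambda>\<omega>. V t \<omega> - V s \<omega>)"
      if st: "0 \<le> s" "s < t" and g: "g \<in> borel_measurable (cfilt M W s)" for g :: "'a \<Rightarrow> real" and s t
    proof -
      have gM [measurable]: "g \<in> borel_measurable M"
        using subalg g by (rule measurable_from_subalg)
      have "indep_set {g -` A \<inter> space M | A. A \<in> sets borel}
          {(\<lambda>\<omega>. V t \<omega> - V s \<omega>) -` C \<inter> space M | C. C \<in> sets borel}"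
      proof (rule indep_setI)
        show "{g -` A \<inter> space M | A. A \<in> sets borel} \<subseteq> events" by auto
        show "{(\<lambda>\<omega>. V t \<omega> - V s \<omega>) -` C \<inter> space M | C. C \<in> sets borel} \<subseteq> events" by auto
        fix a b assume "a \<in> {g -` A \<inter> space M | A. A \<in> sets borel}"
          and "b \<in> {(\<lambda>\<omega>. V t \<omega> - V s \<omega>) -` C \<inter> space M | C. C \<in> sets borel}"
        then obtain A C where A: "A \<in> sets borel" "a = g -` A \<inter> space M"
          and C [measurable]: "C \<in> sets borel" and b: "b = (\<lambda>\<omega>. V t \<omega> - V s \<omega>) -` C \<inter> space M" by auto
        have "a \<in> sets (cfilt M W s)"
          using measurable_sets[OF g A(1)] A(2) by (simp add: space_cfilt)
        then obtain B where B: "a \<in> events" "B \<in> sets (nat_filt M W s)" "AE \<omega> in M. \<omega> \<in> a \<longleftrightarrow> \<omega> \<in> B"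
          by (auto simp: sets_cfilt)
        have BM [measurable]: "B \<in> events"
        proof -
          have "sets (nat_filt M W s) \<subseteq> events"
            unfolding sets_nat_filt by (intro sets.sigma_sets_subset) auto
          with B show ?thesis by auto
        qed
        let ?b = "{\<omega> \<in> space M. W t \<omega> - W s \<omega> \<in> C}"
        have bM [measurable]: "b \<in> events" "?b \<in> events" unfolding b by auto
        have AEb: "AE \<omega> in M. \<omega> \<in> b \<longleftrightarrow> \<omega> \<in> ?b"
          using V(2) AE_space by eventually_elim (use st in \<open>auto simp: b\<close>)
        have "prob (a \<inter> b) = prob (B \<inter> ?b)"
          using B AEb by (intro measure_eq_AE) auto
        also have "\<dots> = prob B * prob ?b" by (rule wiener_nat_filt_indep[OF W st B(2) C])
        also have "prob B = prob a" using B by (intro measure_eq_AE) auto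
        also have "prob ?b = prob b" using AEb by (intro measure_eq_AE) auto
        finally show "prob (a \<inter> b) = prob a * prob b" .
      qed
      moreover have "Int_stable {X -` A \<inter> space M | A. A \<in> sets borel}" for X :: "'a \<Rightarrow> real"
      proof (rule Int_stableI)
        fix a b assume "a \<in> {X -` A \<inter> space M | A. A \<in> sets borel}" "b \<in> {X -` A \<inter> space M | A. A \<in> sets borel}"
        then obtain A B where "a = X -` A \<inter> space M" "b = X -` B \<inter> space M" "A \<in> sets borel" "B \<in> sets borel" by auto
        then show "a \<inter> b \<in> {X -` A \<inter> space M | A. A \<in> sets borel}"
          by (intro CollectI exI[of _ "A \<inter> B"]) auto
      qed
      ultimately show ?thesis
        unfolding indep_var_eq by (auto intro!: indep_set_sigma_sets)
    qed
  qed
qed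

section \<open>Riemann sums along dyadic grids\<close>

text \<open>The drift along a path need not be continuous, since the feedback can jump where the
  overlap vanishes. This class contains it, is closed under products and still yields integrability
  on bounded intervals.\<close>

definition locally_bounded_borel :: "(real \<Rightarrow> real) \<Rightarrow> bool" where
  "locally_bounded_borel f \<longleftrightarrow> f \<in> borel_measurable borel \<and> (\<forall>T. \<exists>C. \<forall>r\<in>{0..T}. \<bar>f r\<bar> \<le> C)"

lemma locally_bounded_borel_continuous:
  assumes "continuous_on UNIV f"
  shows "locally_bounded_borel f"
  unfolding locally_bounded_borel_def
proof (intro conjI allI)
  show "f \<in> borel_measurable borel" using assms by (rule borel_measurable_continuous_onI)
  fix T
  have "compact (f ` {0..T})"
    using assms by (intro compact_continuous_image) (auto intro: continuous_on_subset)
  then have "bounded (f ` {0..T})" by (rule compact_imp_bounded)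
  then show "\<exists>C. \<forall>r\<in>{0..T}. \<bar>f r\<bar> \<le> C" by (auto simp: bounded_iff)
qed

lemma locally_bounded_borel_mult:
  assumes "locally_bounded_borel f" "locally_bounded_borel g"
  shows "locally_bounded_borel (\<lambda>r. f r * g r)"
  unfolding locally_bounded_borel_def
proof (intro conjI allI)
  show "(\<lambda>r. f r * g r) \<in> borel_measurable borel"
    using assms by (auto simp: locally_bounded_borel_def)
  fix T
  obtain C D where "\<forall>r\<in>{0..T}. \<bar>f r\<bar> \<le> C" "\<forall>r\<in>{0..T}. \<bar>g r\<bar> \<le> D"
    using assms unfolding locally_bounded_borel_def by meson
  then have "\<bar>f r * g r\<bar> \<le> C * D" if "r \<in> {0..T}" for r
    unfolding abs_mult using that by (intro mult_mono) (auto intro: order_trans[OF abs_ge_zero[of "f r"]])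
  then show "\<exists>C. \<forall>r\<in>{0..T}. \<bar>f r * g r\<bar> \<le> C" by blast
qed

lemma locally_bounded_borel_set_integrable:
  assumes "locally_bounded_borel f" "0 \<le> a"
  shows "set_integrable lborel {a..b} f"
proof -
  obtain C where "\<forall>r\<in>{0..b}. \<bar>f r\<bar> \<le> C" using assms unfolding locally_bounded_borel_def by blast
  then show ?thesis
    unfolding set_integrable_def using assms
    by (intro integrableI_bounded_set_indicator[where B=C] AE_I2)
       (auto simp: locally_bounded_borel_def emeasure_lborel_Icc_eq)
qed

lemma locally_bounded_borel_integrable:
  "locally_bounded_borel f \<Longrightarrow> 0 \<le> a \<Longrightarrow> f integrable_on {a..b}"
  by (intro set_borel_integral_eq_integral locally_bounded_borel_set_integrable)

lemma integral_grid_sum: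
  fixes f :: "real \<Rightarrow> real"
  assumes "locally_bounded_borel f" "0 \<le> h"
  shows "integral {0..real n * h} f = (\<Sum>k<n. integral {real k * h..real (Suc k) * h} f)"
proof (induction n)
  case (Suc n)
  have "integral {0..real n * h} f + integral {real n * h..real (Suc n) * h} f
      = integral {0..real (Suc n) * h} f"
    using assms by (intro Henstock_Kurzweil_Integration.integral_combine
        locally_bounded_borel_integrable) (auto intro!: mult_right_mono)
  with Suc show ?case by simp
qed simp

lemma integral_abs_le:
  fixes f :: "real \<Rightarrow> real"
  assumes "f integrable_on {a..b}" "a \<le> b" "\<And>r. r \<in> {a..b} \<Longrightarrow> \<bar>f r\<bar> \<le> C"
  shows "\<bar>integral {a..b} f\<bar> \<le> C * (b - a)"
proof -
  have "norm (integral {a..b} f) \<le> integral {a..b} (\<lambda>_. C)"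
    using assms by (intro integral_norm_bound_integral) auto
  then show ?thesis using assms(2) by (simp add: mult.commute)
qed

lemma dyadic_mesh_small:
  fixes h :: real
  assumes "0 < e"
  shows "eventually (\<lambda>p. h / 2 ^ p < e) sequentially"
proof -
  have "(\<lambda>p. h * (1 / 2) ^ p) \<longlonglongrightarrow> h * 0"
    by (intro tendsto_mult tendsto_const LIMSEQ_realpow_zero) auto
  then show ?thesis using assms by (auto simp: power_divide dest: order_tendstoD(2))
qed

lemma dyadic_mesh_total: "real (a * 2 ^ p) * (h / 2 ^ p) = real a * h"
  by simp

lemma grid_mem:
  assumes "k < n" "0 \<le> h" "r \<in> {real k * h..real (Suc k) * h}" 
  shows "r \<in> {0..real n * h}"
proof -
  have "real (Suc k) * h \<le> real n * h" using assms by (intro mult_right_mono) auto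
  moreover have "0 \<le> real k * h" using assms by simp
  ultimately show ?thesis using assms(3) unfolding atLeastAtMost_iff by linarith
qed

lemma uniformly_continuous_grid:
  fixes f :: "real \<Rightarrow> real"
  assumes "continuous_on {0..T} f" "0 < e" "0 < h"
  shows "eventually (\<lambda>p. \<forall>x\<in>{0..T}. \<forall>y\<in>{0..T}. \<bar>x - y\<bar> \<le> h / 2 ^ p \<longrightarrow> \<bar>f x - f y\<bar> < e) sequentially"
proof -
  have "uniformly_continuous_on {0..T} f"
    using assms(1) by (intro compact_uniformly_continuous) auto
  then obtain d where d: "0 < d" "\<And>x y. x \<in> {0..T} \<Longrightarrow> y \<in> {0..T} \<Longrightarrow> dist y x < d \<Longrightarrow> dist (f y) (f x) < e"
    using assms(2) unfolding uniformly_continuous_on_def by meson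
  have "eventually (\<lambda>p. h / 2 ^ p < d) sequentially" using d(1) by (rule dyadic_mesh_small)
  then show ?thesis
  proof eventually_elim
    case (elim p)
    then show ?case using d(2) by (auto simp: dist_real_def)
  qed
qed

text \<open>Only the continuous factor is sampled; the rough one is integrated exactly on each cell.
  The error is at most the modulus of continuity of \<open>f\<close> times a bound for
  \<open>g\<close> times the total length.\<close>

lemma riemann_sum_weighted:
  assumes f: "continuous_on UNIV f" and g: "locally_bounded_borel g" and h: "0 < h"
  shows "(\<lambda>p. \<Sum>k<a * 2 ^ p. f (real k * (h / 2 ^ p)) *
      integral {real k * (h / 2 ^ p)..real (Suc k) * (h / 2 ^ p)} g)
    \<longlonglongrightarrow> integral {0..real a * h} (\<lambda>r. f r * g r)"
proof (rule tendstoI)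
  fix e :: real assume e: "0 < e"
  define T where "T = real a * h"
  obtain C where C: "\<forall>r\<in>{0..T}. \<bar>g r\<bar> \<le> C" using g unfolding locally_bounded_borel_def by blast
  define D where "D = max 0 C"
  have D: "0 \<le> D" "\<And>r. r \<in> {0..T} \<Longrightarrow> \<bar>g r\<bar> \<le> D" using C by (auto simp: D_def le_max_iff_disj)
  have T: "0 \<le> T" using h by (simp add: T_def)
  \<comment> \<open>Adding 1 keeps the denominator positive even when the bound or the length is
    zero.\<close>
  define e' where "e' = e / (2 * (D * T + 1))"
  have e': "0 < e'" using e D T by (auto simp: e'_def intro!: divide_pos_pos add_nonneg_pos)
  have e'D: "e' * D * T < e"
  proof -
    have "e' * D * T \<le> e' * (D * T + 1)" using e' by (simp add: algebra_simps)
    also have "\<dots> = e / 2"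
    proof -
      have "D * T + 1 \<noteq> 0" using D(1) T by (metis add_nonneg_pos less_numeral_extra(1,3) mult_nonneg_nonneg)
      then show ?thesis by (simp add: e'_def field_simps)
    qed
    finally show ?thesis using e by simp
  qed
  have fg: "locally_bounded_borel (\<lambda>r. f r * g r)"
    by (rule locally_bounded_borel_mult[OF locally_bounded_borel_continuous[OF f] g])
  show "eventually (\<lambda>p. dist (\<Sum>k<a * 2 ^ p. f (real k * (h / 2 ^ p)) *
      integral {real k * (h / 2 ^ p)..real (Suc k) * (h / 2 ^ p)} g)
      (integral {0..real a * h} (\<lambda>r. f r * g r)) < e) sequentially"
    using uniformly_continuous_grid[OF continuous_on_subset[OF f] e' h, of T, simplified]
  proof eventually_elim
    case (elim p)
    define \<eta> where "\<eta> = h / 2 ^ p"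
    define n where "n = a * 2 ^ p"
    have \<eta>: "0 < \<eta>" using h by (simp add: \<eta>_def)
    have n\<eta>: "real n * \<eta> = T" unfolding n_def \<eta>_def T_def by (rule dyadic_mesh_total)
    have cell: "\<bar>f (real k * \<eta>) * integral {real k * \<eta>..real (Suc k) * \<eta>} g
        - integral {real k * \<eta>..real (Suc k) * \<eta>} (\<lambda>r. f r * g r)\<bar> \<le> e' * D * \<eta>" if k: "k < n" for k
    proof -
      let ?I = "{real k * \<eta>..real (Suc k) * \<eta>}"
      have pos: "0 \<le> real k * \<eta>" using \<eta> by simp
      have le: "real k * \<eta> \<le> real (Suc k) * \<eta>" using \<eta> by (intro mult_right_mono) auto
      have ig: "g integrable_on ?I" "(\<lambda>r. f r * g r) integrable_on ?I"
        using g fg pos by (auto intro: locally_bounded_borel_integrable)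
      have "f (real k * \<eta>) * integral ?I g - integral ?I (\<lambda>r. f r * g r)
          = integral ?I (\<lambda>r. f (real k * \<eta>) * g r - f r * g r)"
        using ig by (subst Henstock_Kurzweil_Integration.integral_diff)
          (auto intro: integrable_on_mult_right)
      also have "\<bar>\<dots>\<bar> \<le> (e' * D) * (real (Suc k) * \<eta> - real k * \<eta>)"
      proof (rule integral_abs_le[OF _ le])
        show "(\<lambda>r. f (real k * \<eta>) * g r - f r * g r) integrable_on ?I"
          using ig by (intro integrable_diff integrable_on_mult_right)
        fix r assume r: "r \<in> ?I"
        have rT: "r \<in> {0..T}" "real k * \<eta> \<in> {0..T}"
          using grid_mem[OF k, of \<eta>] r \<eta> n\<eta> le by auto
        have "\<bar>real k * \<eta> - r\<bar> \<le> \<eta>" using r by (auto simp: algebra_simps)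
        then have "\<bar>f (real k * \<eta>) - f r\<bar> < e'" using elim rT by (auto simp: \<eta>_def)
        then have "\<bar>f (real k * \<eta>) - f r\<bar> * \<bar>g r\<bar> \<le> e' * D"
          using D rT by (intro mult_mono) auto
        then show "\<bar>f (real k * \<eta>) * g r - f r * g r\<bar> \<le> e' * D"
          by (simp add: abs_mult[symmetric] left_diff_distrib)
      qed
      also have "real (Suc k) * \<eta> - real k * \<eta> = \<eta>" by (simp add: algebra_simps)
      finally show ?thesis .
    qed
    have "\<bar>(\<Sum>k<n. f (real k * \<eta>) * integral {real k * \<eta>..real (Suc k) * \<eta>} g)
        - integral {0..T} (\<lambda>r. f r * g r)\<bar>
      = \<bar>\<Sum>k<n. f (real k * \<eta>) * integral {real k * \<eta>..real (Suc k) * \<eta>} g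
        - integral {real k * \<eta>..real (Suc k) * \<eta>} (\<lambda>r. f r * g r)\<bar>"
      using integral_grid_sum[OF fg, of \<eta> n] \<eta> n\<eta> by (simp add: sum_subtractf)
    also have "\<dots> \<le> (\<Sum>k<n. e' * D * \<eta>)"
      using cell by (intro order_trans[OF sum_abs] sum_mono) auto
    also have "\<dots> = e' * D * (real n * \<eta>)" by simp
    also have "\<dots> < e" using e'D n\<eta> by simp
    finally show ?case by (simp add: dist_real_def \<eta>_def n_def T_def)
  qed
qed

lemma riemann_sum:
  assumes f: "continuous_on UNIV f" and h: "0 < h"
  shows "(\<lambda>p. \<Sum>k<a * 2 ^ p. f (real k * (h / 2 ^ p)) * (h / 2 ^ p))
    \<longlonglongrightarrow> integral {0..real a * h} f"
proof -
  have eq: "integral {real k * (h / 2 ^ p)..real (Suc k) * (h / 2 ^ p)} (\<lambda>_. 1) = h / 2 ^ p" for k p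
    using h by (simp add: field_simps)
  have "locally_bounded_borel (\<lambda>_. 1)" by (rule locally_bounded_borel_continuous) simp
  from riemann_sum_weighted[OF f this h, of a] show ?thesis by (simp only: eq) simp
qed

section \<open>Measurability of path functionals\<close>

text \<open>By continuity the supremum over rational times dominates the whole interval, and being
  countable it stays measurable. Clamping the rationals to \<open>{0..T}\<close> covers the end
  point \<open>T\<close> even when it is irrational.\<close>

lemma path_norm_bound_measurable:
  fixes Y :: "real \<Rightarrow> 'w \<Rightarrow> 'b::{real_normed_vector, second_countable_topology}"
  assumes [measurable]: "\<And>t. Y t \<in> borel_measurable M"
    and cont: "\<And>\<omega>. \<omega> \<in> space M \<Longrightarrow> continuous_on UNIV (\<lambda>t. Y t \<omega>)"
  obtains C :: "'w \<Rightarrow> real" where "C \<in> borel_measurable M"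
    "\<And>\<omega> r. \<omega> \<in> space M \<Longrightarrow> r \<in> {0..T} \<Longrightarrow> norm (Y r \<omega>) \<le> C \<omega>"
proof
  define C where "C \<omega> = (SUP q\<in>\<rat>. norm (Y (max 0 (min T q)) \<omega>))" for \<omega>
  have bdd: "bdd_above ((\<lambda>q. norm (Y (max 0 (min T q)) \<omega>)) ` \<rat>)" if "\<omega> \<in> space M" for \<omega>
  proof -
    have "compact ((\<lambda>r. Y r \<omega>) ` {0..max 0 T})"
      using cont[OF that] by (intro compact_continuous_image) (auto intro: continuous_on_subset)
    then have "bounded ((\<lambda>r. Y r \<omega>) ` {0..max 0 T})" by (rule compact_imp_bounded)
    then obtain B where "\<forall>r\<in>{0..max 0 T}. norm (Y r \<omega>) \<le> B" by (auto simp: bounded_iff)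
    then show ?thesis by (intro bdd_aboveI[of _ B]) auto
  qed
  show "C \<in> borel_measurable M"
    unfolding C_def[abs_def] using bdd
    by (intro borel_measurable_cSUP) (auto simp: countable_rat)
  fix \<omega> r assume \<omega>: "\<omega> \<in> space M" and r: "r \<in> {0..T}"
  show "norm (Y r \<omega>) \<le> C \<omega>"
  proof -
    let ?f = "\<lambda>q. norm (Y (max 0 (min T q)) \<omega>)"
    have "continuous_on UNIV ?f"
      by (intro continuous_on_norm continuous_on_compose2[OF cont[OF \<omega>]] continuous_intros) auto
    then have "closed {q. ?f q \<le> C \<omega>}"
      by (intro closed_Collect_le continuous_on_const)
    moreover have "\<rat> \<subseteq> {q. ?f q \<le> C \<omega>}"
      using bdd[OF \<omega>] by (auto simp: C_def intro: cSUP_upper)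
    ultimately have "closure \<rat> \<subseteq> {q. ?f q \<le> C \<omega>}" by (rule closure_minimal[rotated])
    then have "r \<in> {q. ?f q \<le> C \<omega>}" using Rats_closure_real by auto
    then show ?thesis using r by simp
  qed
qed

text \<open>Progressive measurability: rounding the time down to a multiple of 1/(n+1) leaves
  countably many values, and continuity passes to the limit. Clamping to \<open>{0..t}\<close>
  ensures that only variables known at time \<open>t\<close> enter.\<close>

lemma joint_measurable_continuous_process:
  fixes Y :: "real \<Rightarrow> 'w \<Rightarrow> 'b::{second_countable_topology, metric_space}"
  assumes Y: "\<And>r. r \<in> {0..t} \<Longrightarrow> Y r \<in> borel_measurable N" and t: "0 \<le> t"
    and cont: "\<And>\<omega>. \<omega> \<in> space N \<Longrightarrow> continuous_on UNIV (\<lambda>r. Y r \<omega>)"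
  shows "(\<lambda>(\<omega>, r). Y (max 0 (min t r)) \<omega>) \<in> borel_measurable (N \<Otimes>\<^sub>M lborel)"
proof (rule borel_measurable_LIMSEQ_metric)
  fix n :: nat
  have "(\<lambda>x. (\<lambda>i x. Y (max 0 (min t (real_of_int i / real (Suc n)))) (fst x)) \<lfloor>snd x * real (Suc n)\<rfloor> x)
      \<in> borel_measurable (N \<Otimes>\<^sub>M lborel)"
  proof (rule measurable_compose_countable[where f="\<lambda>i x. Y (max 0 (min t (real_of_int i / real (Suc n)))) (fst x)"
        and g="\<lambda>x. \<lfloor>snd x * real (Suc n)\<rfloor>"])
    fix i :: int
    have "Y (max 0 (min t (real_of_int i / real (Suc n)))) \<in> borel_measurable N"
      using t by (intro Y) auto
    then show "(\<lambda>x. Y (max 0 (min t (real_of_int i / real (Suc n)))) (fst x)) \<in> borel_measurable (N \<Otimes>\<^sub>M lborel)"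
      by (rule measurable_compose[OF measurable_fst])
    show "(\<lambda>x. \<lfloor>snd x * real (Suc n)\<rfloor>) \<in> N \<Otimes>\<^sub>M lborel \<rightarrow>\<^sub>M count_space UNIV"
      by measurable
  qed
  then show "(\<lambda>(\<omega>, r). Y (max 0 (min t (real_of_int \<lfloor>r * real (Suc n)\<rfloor> / real (Suc n)))) \<omega>) \<in> borel_measurable (N \<Otimes>\<^sub>M lborel)"
    by (simp add: case_prod_unfold)
next
  fix x assume "x \<in> space (N \<Otimes>\<^sub>M (lborel :: real measure))"
  then obtain \<omega> r where x: "x = (\<omega>, r)" and \<omega>: "\<omega> \<in> space N" by (cases x) (auto simp: space_pair_measure)
  have "(\<lambda>n. real_of_int \<lfloor>r * real (Suc n)\<rfloor> / real (Suc n)) \<longlonglongrightarrow> r"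
  proof (rule Lim_null_comparison[THEN LIM_zero_cancel])
    show "eventually (\<lambda>n. norm (real_of_int \<lfloor>r * real (Suc n)\<rfloor> / real (Suc n) - r) \<le> inverse (real (Suc n))) sequentially"
    proof (intro always_eventually allI)
      fix n
      have "real_of_int \<lfloor>r * real (Suc n)\<rfloor> / real (Suc n) - r
          = (real_of_int \<lfloor>r * real (Suc n)\<rfloor> - r * real (Suc n)) / real (Suc n)"
        by (simp add: diff_divide_distrib)
      also have "norm \<dots> \<le> 1 / real (Suc n)"
      proof -
        have "\<bar>real_of_int \<lfloor>r * real (Suc n)\<rfloor> - r * real (Suc n)\<bar> \<le> 1" by linarith
        then show ?thesis by (simp add: divide_right_mono)
      qed
      finally show "norm (real_of_int \<lfloor>r * real (Suc n)\<rfloor> / real (Suc n) - r) \<le> inverse (real (Suc n))"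
        by (simp add: inverse_eq_divide)
    qed
    show "(\<lambda>n. inverse (real (Suc n))) \<longlonglongrightarrow> 0" by (rule LIMSEQ_inverse_real_of_nat)
  qed
  then have "(\<lambda>n. max 0 (min t (real_of_int \<lfloor>r * real (Suc n)\<rfloor> / real (Suc n)))) \<longlonglongrightarrow> max 0 (min t r)"
    by (intro tendsto_intros)
  then have "(\<lambda>n. Y (max 0 (min t (real_of_int \<lfloor>r * real (Suc n)\<rfloor> / real (Suc n)))) \<omega>) \<longlonglongrightarrow> Y (max 0 (min t r)) \<omega>"
    by (rule continuous_on_tendsto_compose[OF cont[OF \<omega>]]) auto
  then show "(\<lambda>n. case x of (\<omega>, r) \<Rightarrow> Y (max 0 (min t (real_of_int \<lfloor>r * real (Suc n)\<rfloor> / real (Suc n)))) \<omega>)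
      \<longlonglongrightarrow> (case x of (\<omega>, r) \<Rightarrow> Y (max 0 (min t r)) \<omega>)"
    by (simp add: x)
qed

text \<open>Joint measurability makes the Lebesgue integral over time measurable in the outcome; for
  locally bounded Borel integrands it agrees with the gauge integral of the statement. Taking
  \<open>N\<close> from the filtration gives adaptedness.\<close>

lemma path_integral_measurable:
  fixes Y :: "real \<Rightarrow> 'w \<Rightarrow> 'b::{second_countable_topology, metric_space}" and b :: "'b \<Rightarrow> real"
  assumes Y: "\<And>r. r \<in> {0..t} \<Longrightarrow> Y r \<in> borel_measurable N" and t: "0 \<le> t"
    and cont: "\<And>\<omega>. \<omega> \<in> space N \<Longrightarrow> continuous_on UNIV (\<lambda>r. Y r \<omega>)"
    and b [measurable]: "b \<in> borel_measurable borel"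
    and lb: "\<And>\<omega>. \<omega> \<in> space N \<Longrightarrow> locally_bounded_borel (\<lambda>r. b (Y r \<omega>))"
  shows "(\<lambda>\<omega>. integral {0..t} (\<lambda>r. b (Y r \<omega>))) \<in> borel_measurable N"
proof -
  note joint_measurable_continuous_process[OF Y t cont, measurable]
  have "(\<lambda>\<omega>. \<integral>r. indicator {0..t} r * b (Y (max 0 (min t r)) \<omega>) \<partial>lborel) \<in> borel_measurable N"
    by (intro lborel.borel_measurable_lebesgue_integral) measurable
  moreover have "(\<integral>r. indicator {0..t} r * b (Y (max 0 (min t r)) \<omega>) \<partial>lborel)
      = integral {0..t} (\<lambda>r. b (Y r \<omega>))" if "\<omega> \<in> space N" for \<omega>
  proof -
    have "(\<integral>r. indicator {0..t} r * b (Y (max 0 (min t r)) \<omega>) \<partial>lborel)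
        = (LINT r:{0..t}|lborel. b (Y r \<omega>))"
      unfolding set_lebesgue_integral_def
      by (intro Bochner_Integration.integral_cong) (auto simp: indicator_def)
    also have "\<dots> = integral {0..t} (\<lambda>r. b (Y r \<omega>))"
      by (intro set_borel_integral_eq_integral locally_bounded_borel_set_integrable lb that) auto
    finally show ?thesis .
  qed
  ultimately show ?thesis by (simp cong: measurable_cong)
qed

section \<open>Martingale transforms along a sequence of grids\<close>

context prob_space
begin

lemma vanishes_of_square:
  assumes [measurable]: "\<And>n. X n \<in> borel_measurable M" and "vanishes (\<lambda>n \<omega>. (X n \<omega>)\<^sup>2)"
  shows "vanishes X"
proof (rule vanishesI_prob_gt)
  fix d :: real assume d: "0 < d"
  have "{\<omega> \<in> space M. d < \<bar>X n \<omega>\<bar>} = {\<omega> \<in> space M. d\<^sup>2 < \<bar>(X n \<omega>)\<^sup>2\<bar>}" for n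
    using d abs_le_square_iff[of "X n _" d] by (auto simp: not_le[symmetric])
  then show "(\<lambda>n. prob {\<omega> \<in> space M. d < \<bar>X n \<omega>\<bar>}) \<longlonglongrightarrow> 0"
    using vanishes_prob_gt[OF assms(2), of "d\<^sup>2"] d by simp
qed measurable

lemma noise_transform_vanishes:
  assumes noise: "\<And>p. noise M (G p) (d p) (v p)" and v: "\<And>p. 0 < v p"
    and f: "\<And>p k. f p k \<in> borel_measurable (G p k)"
    and van: "vanishes (\<lambda>p \<omega>. v p * (\<Sum>k<n p. (f p k \<omega>)\<^sup>2))"
  shows "vanishes (\<lambda>p \<omega>. \<Sum>k<n p. f p k \<omega> * d p k \<omega>)"
proof (rule vanishesI_eventually)
  show "(\<lambda>\<omega>. \<Sum>k<n p. f p k \<omega> * d p k \<omega>) \<in> borel_measurable M" for p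
    by (rule noise.measurable_G_M[OF noise noise.transform_measurable[OF noise f]])
  fix e :: real assume e: "0 < e"
  \<comment> \<open>Chosen so that the term \<open>sqrt \<delta>\<close> in the domination bound
    equals \<open>e / 2\<close>.\<close>
  define \<delta> where "\<delta> = (e / 2)\<^sup>2"
  have \<delta>: "0 < \<delta>" using e by (simp add: \<delta>_def)
  have "eventually (\<lambda>p. prob {\<omega> \<in> space M. \<delta> < \<bar>v p * (\<Sum>k<n p. (f p k \<omega>)\<^sup>2)\<bar>} < e / 2) sequentially"
    using e by (intro order_tendstoD(2)[OF vanishes_prob_gt[OF van \<delta>]]) auto
  then show "eventually (\<lambda>p. psize (\<lambda>\<omega>. \<Sum>k<n p. f p k \<omega> * d p k \<omega>) \<le> e) sequentially"
  proof eventually_elim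
    case (elim p)
    have "\<bar>v p * (\<Sum>k<n p. (f p k \<omega>)\<^sup>2)\<bar> = v p * (\<Sum>k<n p. (f p k \<omega>)\<^sup>2)" for \<omega>
      using v[of p] by (simp add: sum_nonneg)
    then have "psize (\<lambda>\<omega>. \<Sum>k<n p. f p k \<omega> * d p k \<omega>) \<le> e / 2 + sqrt \<delta>"
      using noise.transform_psize_le[OF noise f v \<delta>, of p "n p"] elim by simp
    then show ?case using e by (simp add: \<delta>_def)
  qed
qed

end

section \<open>Ito integrals along dyadic grids\<close>

context brownian
begin

lemma F_measurable_mono:
  "f \<in> measurable (F s) N \<Longrightarrow> s \<le> t \<Longrightarrow> f \<in> measurable (F t) N"
  using F_subalg[of s] F_subalg[of t] F_mono[of s t]
  by (auto intro: measurable_from_subalg[rotated] simp: subalgebra_def)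

lemma F_measurable_M: "f \<in> measurable (F s) N \<Longrightarrow> f \<in> measurable M N"
  using F_subalg by (rule measurable_from_subalg)

lemma space_F: "space (F t) = space M"
  using F_subalg[of t] by (simp add: subalgebra_def)

lemma increment_moments:
  assumes st: "0 \<le> s" "s < t"
  shows "expectation (\<lambda>\<omega>. W t \<omega> - W s \<omega>) = 0"
    and "integrable M (\<lambda>\<omega>. (W t \<omega> - W s \<omega>) ^ 2)"
    and "expectation (\<lambda>\<omega>. (W t \<omega> - W s \<omega>) ^ 2) = t - s"
    and "integrable M (\<lambda>\<omega>. (W t \<omega> - W s \<omega>) ^ 4)"
    and "expectation (\<lambda>\<omega>. (W t \<omega> - W s \<omega>) ^ 4) = 3 * (t - s)\<^sup>2"
proof -
  let ?\<sigma> = "sqrt (t - s)"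
  have \<sigma>: "0 < ?\<sigma>" "?\<sigma>\<^sup>2 = t - s" using st by auto
  note D = W_normal[OF st]
  have eq: "(\<integral>x. normal_density 0 ?\<sigma> x * x ^ n \<partial>lborel) = expectation (\<lambda>\<omega>. (W t \<omega> - W s \<omega>) ^ n)" for n
    by (rule distributed_integral[OF D]) auto
  have int: "integrable M (\<lambda>\<omega>. (W t \<omega> - W s \<omega>) ^ n)" for n
    using distributed_integrable[OF D, of "\<lambda>x. x ^ n"] integrable_normal_moment[OF \<sigma>(1), of 0 n] by simp
  show "integrable M (\<lambda>\<omega>. (W t \<omega> - W s \<omega>) ^ 2)" "integrable M (\<lambda>\<omega>. (W t \<omega> - W s \<omega>) ^ 4)"
    by (rule int)+
  show "expectation (\<lambda>\<omega>. W t \<omega> - W s \<omega>) = 0"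
    using eq[of 1] integral_normal_moment_odd[OF \<sigma>(1), of 0 0] by simp
  show "expectation (\<lambda>\<omega>. (W t \<omega> - W s \<omega>) ^ 2) = t - s"
    using eq[of 2] integral_normal_moment_even[OF \<sigma>(1), of 0 1] \<sigma> by simp
  have "(\<integral>x. normal_density 0 ?\<sigma> x * x ^ 4 \<partial>lborel) = fact 4 / ((2 / (t - s))\<^sup>2 * 2)"
    using integral_normal_moment_even[OF \<sigma>(1), of 0 2] \<sigma> by simp
  also have "\<dots> = 3 * (t - s)\<^sup>2"
    using st by (simp add: fact_numeral power2_eq_square field_simps)
  finally show "expectation (\<lambda>\<omega>. (W t \<omega> - W s \<omega>) ^ 4) = 3 * (t - s)\<^sup>2"
    by (simp only: eq)
qed

lemma W_grid_adapted:
  assumes "0 < h"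
  shows "(\<lambda>\<omega>. W (real (Suc k) * h) \<omega> - W (real k * h) \<omega>) \<in> borel_measurable (F (real (Suc k) * h))"
proof -
  have "W (real (Suc k) * h) \<in> borel_measurable (F (real (Suc k) * h))"
    using assms by (intro W_adapted) auto
  moreover have "W (real k * h) \<in> borel_measurable (F (real (Suc k) * h))"
    using assms by (intro F_measurable_mono[OF W_adapted]) (auto intro!: mult_right_mono)
  ultimately show ?thesis by (rule borel_measurable_diff)
qed

lemma W_increment_measurable [measurable]:
  assumes "0 \<le> h"
  shows "(\<lambda>\<omega>. W (real (Suc k) * h) \<omega> - W (real k * h) \<omega>) \<in> borel_measurable M"
  using assms by (intro borel_measurable_diff F_measurable_M[OF W_adapted]) auto

lemma grid_filtration_mono:
  assumes "0 < h"
  shows "sets (F (real k * h)) \<subseteq> sets (F (real (Suc k) * h))"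
  using assms by (intro F_mono mult_right_mono) auto

lemma increment_noise:
  assumes h: "0 < h"
  shows "noise M (\<lambda>k. F (real k * h)) (\<lambda>k \<omega>. W (real (Suc k) * h) \<omega> - W (real k * h) \<omega>) h"
proof -
  have st: "0 \<le> real k * h" "real k * h < real (Suc k) * h" "real (Suc k) * h - real k * h = h" for k
    using h by (auto simp: algebra_simps)
  show ?thesis
    using grid_filtration_mono[OF h] W_grid_adapted[OF h] increment_moments(1-3)[OF st(1,2)]
    by unfold_locales (auto simp: F_subalg st(3) intro: W_indep[OF st(1,2)] simp del: of_nat_Suc)
qed

text \<open>The variance comes from the Gaussian fourth moment: 3 h^2 - 2 h h + h^2 = 2 h^2. Being
  of second order in the mesh, it makes the fluctuation of the quadratic variation
  negligible.\<close>

lemma increment_square_noise: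
  assumes h: "0 < h"
  shows "noise M (\<lambda>k. F (real k * h)) (\<lambda>k \<omega>. (W (real (Suc k) * h) \<omega> - W (real k * h) \<omega>)\<^sup>2 - h) (2 * h\<^sup>2)"
proof -
  have st: "0 \<le> real k * h" "real k * h < real (Suc k) * h" "real (Suc k) * h - real k * h = h" for k
    using h by (auto simp: algebra_simps)
  let ?D = "\<lambda>k \<omega>. W (real (Suc k) * h) \<omega> - W (real k * h) \<omega>"
  note mom = increment_moments[OF st(1,2), unfolded st(3)]
  have eq: "(\<lambda>\<omega>. ((?D k \<omega>)\<^sup>2 - h)\<^sup>2) = (\<lambda>\<omega>. (?D k \<omega>) ^ 4 - (2 * h) * (?D k \<omega>)\<^sup>2 + h\<^sup>2)" for k
    by (auto simp: power2_eq_square power4_eq_xxxx algebra_simps)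
  show ?thesis
  proof unfold_locales
    fix k
    show "subalgebra M (F (real k * h))" by (rule F_subalg)
    show "sets (F (real k * h)) \<subseteq> sets (F (real (Suc k) * h))" by (rule grid_filtration_mono[OF h])
    show "(\<lambda>\<omega>. (?D k \<omega>)\<^sup>2 - h) \<in> borel_measurable (F (real (Suc k) * h))"
      by (rule borel_measurable_diff[OF borel_measurable_power[OF W_grid_adapted[OF h]] borel_measurable_const])
    show "integrable M (\<lambda>\<omega>. ((?D k \<omega>)\<^sup>2 - h)\<^sup>2)"
      unfolding eq using mom(2,4)[of k] by (intro Bochner_Integration.integrable_add Bochner_Integration.integrable_diff integrable_mult_right) auto
    show "expectation (\<lambda>\<omega>. (?D k \<omega>)\<^sup>2 - h) = 0"
      by (subst Bochner_Integration.integral_diff[OF mom(2)[of k]]) (simp_all add: mom(3) prob_space del: of_nat_Suc)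
    have "expectation (\<lambda>\<omega>. ((?D k \<omega>)\<^sup>2 - h)\<^sup>2)
        = expectation (\<lambda>\<omega>. (?D k \<omega>) ^ 4 - (2 * h) * (?D k \<omega>)\<^sup>2) + h\<^sup>2"
      unfolding eq using mom(2,4)[of k]
      by (subst Bochner_Integration.integral_add) (auto simp: prob_space)
    also have "expectation (\<lambda>\<omega>. (?D k \<omega>) ^ 4 - (2 * h) * (?D k \<omega>)\<^sup>2) = 3 * h\<^sup>2 - (2 * h) * h"
      using mom(2,4)[of k]
      by (subst Bochner_Integration.integral_diff) (auto simp: mom(3,5) simp del: of_nat_Suc)
    finally show "expectation (\<lambda>\<omega>. ((?D k \<omega>)\<^sup>2 - h)\<^sup>2) = 2 * h\<^sup>2"
      by (simp add: power2_eq_square)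
    fix g :: "'w \<Rightarrow> real" assume g: "g \<in> borel_measurable (F (real k * h))"
    have "indep_var borel ((\<lambda>x. x) \<circ> g) borel ((\<lambda>x. x\<^sup>2 - h) \<circ> ?D k)"
      by (rule indep_var_compose[OF W_indep[OF st(1,2) g]]) auto
    then show "indep_var borel g borel (\<lambda>\<omega>. (?D k \<omega>)\<^sup>2 - h)" by (simp add: comp_def)
  qed
qed

definition rsum :: "real \<Rightarrow> (real \<Rightarrow> 'w \<Rightarrow> real) \<Rightarrow> nat \<Rightarrow> 'w \<Rightarrow> real" where
  "rsum h f n \<omega> = (\<Sum>k<n. f (real k * h) \<omega> * (W (real (Suc k) * h) \<omega> - W (real k * h) \<omega>))"

text \<open>The integral is required at all multiples of \<open>h\<close> for every \<open>h\<close>, so that partial sums of a fine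
  grid at coarse grid points are again covered.\<close>

definition ito :: "(real \<Rightarrow> 'w \<Rightarrow> real) \<Rightarrow> (real \<Rightarrow> 'w \<Rightarrow> real) \<Rightarrow> bool" where
  "ito f I \<longleftrightarrow> (\<forall>h>0. \<forall>a. vanishes (\<lambda>p \<omega>. rsum (h / 2 ^ p) f (a * 2 ^ p) \<omega> - I (real a * h) \<omega>))"

definition proc :: "(real \<Rightarrow> 'w \<Rightarrow> real) \<Rightarrow> bool" where
  "proc X \<longleftrightarrow> (\<forall>t\<ge>0. X t \<in> borel_measurable (F t)) \<and> (\<forall>t. X t \<in> borel_measurable M)
     \<and> (\<forall>\<omega>\<in>space M. continuous_on UNIV (\<lambda>t. X t \<omega>))"

lemma rsum_measurable:
  assumes "\<And>t. f t \<in> borel_measurable M" "0 \<le> h"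
  shows "rsum h f n \<in> borel_measurable M"
  unfolding rsum_def[abs_def] using assms
  by (intro borel_measurable_sum borel_measurable_times W_increment_measurable) auto

text \<open>Summing over the full range with the first \<open>k\<close> integrands switched off
  keeps the difference in the form to which the transform lemmas apply.\<close>

lemma rsum_diff:
  assumes "k \<le> n"
  shows "rsum h f n \<omega> - rsum h f k \<omega>
    = (\<Sum>j<n. (if j < k then 0 else f (real j * h) \<omega>) * (W (real (Suc j) * h) \<omega> - W (real j * h) \<omega>))"
proof -
  have "rsum h f k \<omega> = (\<Sum>j<n. if j < k then f (real j * h) \<omega> * (W (real (Suc j) * h) \<omega> - W (real j * h) \<omega>) else 0)"
    unfolding rsum_def using assms by (intro sum.mono_neutral_cong_left) auto
  then show ?thesis
    unfolding rsum_def by (simp add: sum_subtractf[symmetric]) (auto intro!: sum.cong)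
qed

lemma rsum_diff_square:
  assumes f: "\<And>t. 0 \<le> t \<Longrightarrow> f t \<in> borel_measurable (F t)" and bd: "\<And>t \<omega>. \<bar>f t \<omega>\<bar> \<le> K"
    and h: "0 < h" and kn: "k \<le> n"
  shows "integrable M (\<lambda>\<omega>. (rsum h f n \<omega> - rsum h f k \<omega>)\<^sup>2)"
    and "expectation (\<lambda>\<omega>. (rsum h f n \<omega> - rsum h f k \<omega>)\<^sup>2) \<le> K\<^sup>2 * (real (n - k) * h)"
proof -
  interpret noise M "\<lambda>k. F (real k * h)" "\<lambda>k \<omega>. W (real (Suc k) * h) \<omega> - W (real k * h) \<omega>" h
    by (rule increment_noise[OF h])
  let ?f = "\<lambda>j \<omega>. if j < k then 0 else f (real j * h) \<omega>"
  have K: "0 \<le> K" using bd[of 0 undefined] by linarith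
  have f': "?f j \<in> borel_measurable (F (real j * h))" for j
    using f[of "real j * h"] h by auto
  have bd': "\<bar>?f j \<omega>\<bar> \<le> K" for j \<omega> using bd K by auto
  note iso = transform_isometry[OF f' bd', of n, folded rsum_diff[OF kn]]
  show "integrable M (\<lambda>\<omega>. (rsum h f n \<omega> - rsum h f k \<omega>)\<^sup>2)" by (rule iso(1))
  have "expectation (\<lambda>\<omega>. (?f j \<omega>)\<^sup>2) \<le> (if j < k then 0 else K\<^sup>2)" for j
  proof (cases "j < k")
    case False
    have "expectation (\<lambda>\<omega>. (f (real j * h) \<omega>)\<^sup>2) \<le> expectation (\<lambda>\<omega>. K\<^sup>2)"
    proof (rule integral_mono_AE')
      show "AE \<omega> in M. (f (real j * h) \<omega>)\<^sup>2 \<le> K\<^sup>2"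
        using bd by (intro AE_I2) (metis abs_ge_zero power2_abs power_mono)
    qed auto
    with False show ?thesis by (simp add: prob_space)
  qed simp
  then have "(\<Sum>j<n. expectation (\<lambda>\<omega>. (?f j \<omega>)\<^sup>2)) \<le> (\<Sum>j<n. if j < k then 0 else K\<^sup>2)"
    by (rule sum_mono)
  also have "\<dots> = (\<Sum>j\<in>{k..<n}. K\<^sup>2)"
    by (intro sum.mono_neutral_cong_right) auto
  also have "\<dots> = real (n - k) * K\<^sup>2" by simp
  finally have "h * (\<Sum>j<n. expectation (\<lambda>\<omega>. (?f j \<omega>)\<^sup>2)) \<le> h * (real (n - k) * K\<^sup>2)"
    using h by (intro mult_left_mono) auto
  then show "expectation (\<lambda>\<omega>. (rsum h f n \<omega> - rsum h f k \<omega>)\<^sup>2) \<le> K\<^sup>2 * (real (n - k) * h)"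
    unfolding iso(2) by (simp add: mult_ac)
qed

end

lemma square_sum3_le: "(x + y + z :: real)\<^sup>2 \<le> 3 * x\<^sup>2 + 3 * y\<^sup>2 + 3 * z\<^sup>2"
proof -
  have "0 \<le> (x - y)\<^sup>2 + (y - z)\<^sup>2 + (x - z)\<^sup>2" by simp
  then show ?thesis by (simp add: power2_eq_square algebra_simps)
qed

lemma continuous_on_Icc_bound:
  fixes f :: "real \<Rightarrow> real"
  assumes "continuous_on {a..b} f"
  obtains B where "0 \<le> B" "\<And>x. x \<in> {a..b} \<Longrightarrow> \<bar>f x\<bar> \<le> B"
proof -
  have "compact (f ` {a..b})" using assms by (intro compact_continuous_image) auto
  then have "bounded (f ` {a..b})" by (rule compact_imp_bounded)
  then obtain B where "\<forall>x\<in>{a..b}. \<bar>f x\<bar> \<le> B" by (auto simp: bounded_iff)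
  then show ?thesis using that[of "max 0 B"] by (auto simp: le_max_iff_disj)
qed

section \<open>Time-averaged squared error of the Riemann-Ito sums\<close>

context brownian
begin

text \<open>Convergence at each fixed time gives no uniform control over a growing number of grid
  points. Two scales repair this: a fixed coarse grid with finitely many points, where the
  hypothesis applies, and inside each coarse block the oscillation of the fine sums (isometry) and
  of the limit \<open>I\<close> (continuity).\<close>

lemma ito_grid_error_vanishes:
  assumes \<sigma>: "proc \<sigma>"
    and IM: "\<And>t. 0 \<le> t \<Longrightarrow> I t \<in> borel_measurable M"
    and Ic: "\<And>\<omega> T. \<omega> \<in> space M \<Longrightarrow> continuous_on {0..T} (\<lambda>t. I t \<omega>)"
    and ito: "ito \<sigma> I" and h: "0 < h"
  shows "vanishes (\<lambda>p \<omega>. h / 2 ^ p * (\<Sum>k<a * 2 ^ p. (rsum (h / 2 ^ p) \<sigma> k \<omega> - I (real k * (h / 2 ^ p)) \<omega>)\<^sup>2))"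
proof -
  define T where "T = real a * h"
  have T: "0 \<le> T" using h by (simp add: T_def)
  have \<sigma>M [measurable]: "\<sigma> t \<in> borel_measurable M" for t using \<sigma> by (simp add: proc_def)
  have \<sigma>F: "\<sigma> t \<in> borel_measurable (F t)" if "0 \<le> t" for t using \<sigma> that by (simp add: proc_def)
  have \<sigma>c: "continuous_on UNIV (\<lambda>t. \<sigma> t \<omega>)" if "\<omega> \<in> space M" for \<omega> using \<sigma> that by (simp add: proc_def)
  have IM' [measurable]: "I (real k * (h / 2 ^ l)) \<in> borel_measurable M" for k l using h by (intro IM) auto
  have rM [measurable]: "rsum (h / 2 ^ p) \<sigma> k \<in> borel_measurable M" for p k
    using h by (intro rsum_measurable) auto
  obtain C where C [measurable]: "C \<in> borel_measurable M"
    and Cb: "\<And>\<omega> r. \<omega> \<in> space M \<Longrightarrow> r \<in> {0..T} \<Longrightarrow> \<bar>\<sigma> r \<omega>\<bar> \<le> C \<omega>"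
    using path_norm_bound_measurable[of \<sigma> M T] \<sigma>c by auto
  \<comment> \<open>Block \<open>i\<close> collects the \<open>2 ^ q\<close> fine indices from
    coarse point \<open>i\<close> up to, but not including, the next one.\<close>
  define blk where "blk i q = {i * 2 ^ q..<i * 2 ^ q + (2::nat) ^ q}" for i q
  have blk_sum: "(\<Sum>i<a * 2 ^ l. sum g (blk i q)) = sum g {..<a * 2 ^ (l + q)}" for g :: "nat \<Rightarrow> real" and l q
    unfolding blk_def by (simp add: sum.nat_group power_add mult.assoc)
  define E where "E p \<omega> = h / 2 ^ p * (\<Sum>k<a * 2 ^ p. (rsum (h / 2 ^ p) \<sigma> k \<omega> - I (real k * (h / 2 ^ p)) \<omega>)\<^sup>2)" for p \<omega>
  \<comment> \<open>The integrand is a parameter so that \<open>\<sigma>\<close> can later be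
    replaced by its truncation.\<close>
  define X1 where "X1 f l q \<omega> = 3 * (h / 2 ^ (l + q)) * (\<Sum>i<a * 2 ^ l. \<Sum>k\<in>blk i q.
      (rsum (h / 2 ^ (l + q)) f k \<omega> - rsum (h / 2 ^ (l + q)) f (i * 2 ^ q) \<omega>)\<^sup>2)" for f l q \<omega>
  \<comment> \<open>This error is constant on a block, so its \<open>2 ^ q\<close> fine weights add
    up to one coarse mesh width.\<close>
  define X2 where "X2 l q \<omega> = (\<Sum>i<a * 2 ^ l. 3 * (h / 2 ^ l) *
      (rsum (h / 2 ^ l / 2 ^ q) \<sigma> (i * 2 ^ q) \<omega> - I (real i * (h / 2 ^ l)) \<omega>)\<^sup>2)" for l q \<omega>
  define X3 where "X3 l q \<omega> = 3 * (h / 2 ^ (l + q)) * (\<Sum>i<a * 2 ^ l. \<Sum>k\<in>blk i q.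
      (I (real i * (h / 2 ^ l)) \<omega> - I (real k * (h / 2 ^ (l + q))) \<omega>)\<^sup>2)" for l q \<omega>
  have mesh: "h / 2 ^ l / 2 ^ q = h / 2 ^ (l + q)" for l q :: nat by (simp add: power_add)
  have grid_T: "real k * (h / 2 ^ p) \<in> {0..T}" if "k \<le> a * 2 ^ p" for k p
  proof -
    have "real k * (h / 2 ^ p) \<le> real (a * 2 ^ p) * (h / 2 ^ p)"
      using that h by (intro mult_right_mono) (auto simp del: of_nat_mult)
    then show ?thesis using h by (simp add: T_def)
  qed
  have blk_T: "k \<le> a * 2 ^ (l + q)" "i * 2 ^ q \<le> k" "k - i * 2 ^ q \<le> 2 ^ q" "i \<le> a * 2 ^ l"
    if "i < a * 2 ^ l" "k \<in> blk i q" for i k l q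
  proof -
    have "k < (i + 1) * 2 ^ q" using that by (simp add: blk_def)
    also have "\<dots> \<le> a * 2 ^ l * 2 ^ q" using that by (intro mult_right_mono) auto
    finally show "k \<le> a * 2 ^ (l + q)" by (simp add: power_add mult.assoc)
  qed (use that in \<open>auto simp: blk_def\<close>)
  have decomp: "\<bar>E (l + q) \<omega>\<bar> \<le> \<bar>X1 \<sigma> l q \<omega> + (X2 l q \<omega> + X3 l q \<omega>)\<bar>" for l q \<omega>
  proof -
    let ?\<eta> = "h / 2 ^ (l + q)"
    let ?S = "\<lambda>k. rsum ?\<eta> \<sigma> k \<omega>"
    have pos: "0 \<le> E (l + q) \<omega>" "0 \<le> X1 \<sigma> l q \<omega>" "0 \<le> X2 l q \<omega>" "0 \<le> X3 l q \<omega>"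
      unfolding E_def X1_def X2_def X3_def using h by (auto intro!: divide_nonneg_nonneg mult_nonneg_nonneg sum_nonneg)
    have "E (l + q) \<omega> = ?\<eta> * (\<Sum>i<a * 2 ^ l. \<Sum>k\<in>blk i q. (?S k - I (real k * ?\<eta>) \<omega>)\<^sup>2)"
      unfolding E_def blk_sum ..
    also have "\<dots> \<le> ?\<eta> * (\<Sum>i<a * 2 ^ l. \<Sum>k\<in>blk i q. 3 * (?S k - ?S (i * 2 ^ q))\<^sup>2
        + 3 * (?S (i * 2 ^ q) - I (real i * (h / 2 ^ l)) \<omega>)\<^sup>2
        + 3 * (I (real i * (h / 2 ^ l)) \<omega> - I (real k * ?\<eta>) \<omega>)\<^sup>2)"
    proof (intro mult_left_mono sum_mono)
      fix i k
      show "(?S k - I (real k * ?\<eta>) \<omega>)\<^sup>2 \<le> 3 * (?S k - ?S (i * 2 ^ q))\<^sup>2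
        + 3 * (?S (i * 2 ^ q) - I (real i * (h / 2 ^ l)) \<omega>)\<^sup>2
        + 3 * (I (real i * (h / 2 ^ l)) \<omega> - I (real k * ?\<eta>) \<omega>)\<^sup>2"
        using square_sum3_le[of "?S k - ?S (i * 2 ^ q)" "?S (i * 2 ^ q) - I (real i * (h / 2 ^ l)) \<omega>"
          "I (real i * (h / 2 ^ l)) \<omega> - I (real k * ?\<eta>) \<omega>"] by simp
    qed (use h in simp)
    also have "\<dots> = X1 \<sigma> l q \<omega> + ?\<eta> * (\<Sum>i<a * 2 ^ l. \<Sum>k\<in>blk i q. 3 * (?S (i * 2 ^ q) - I (real i * (h / 2 ^ l)) \<omega>)\<^sup>2)
        + X3 l q \<omega>"
      unfolding X1_def X3_def by (simp add: sum.distrib sum_distrib_left algebra_simps)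
    also have "?\<eta> * (\<Sum>i<a * 2 ^ l. \<Sum>k\<in>blk i q. 3 * (?S (i * 2 ^ q) - I (real i * (h / 2 ^ l)) \<omega>)\<^sup>2) = X2 l q \<omega>"
    proof -
      have "?\<eta> * (\<Sum>k\<in>blk i q. 3 * x) = 3 * (h / 2 ^ l) * x" for i x
        by (simp add: blk_def power_add)
      then show ?thesis unfolding X2_def sum_distrib_left[of ?\<eta>] mesh by simp
    qed
    finally show ?thesis using pos by simp
  qed
  have X1M [measurable]: "X1 f l q \<in> borel_measurable M" if "\<And>t. f t \<in> borel_measurable M" for f l q
    unfolding X1_def[abs_def] using that h
    by (intro borel_measurable_times borel_measurable_const borel_measurable_sum borel_measurable_power
        borel_measurable_diff rsum_measurable) auto
  have X2M [measurable]: "X2 l q \<in> borel_measurable M" for l q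
    unfolding X2_def[abs_def] mesh by measurable
  have X3M [measurable]: "X3 l q \<in> borel_measurable M" for l q
    unfolding X3_def[abs_def] by measurable
  have EM [measurable]: "E p \<in> borel_measurable M" for p
    unfolding E_def[abs_def] by measurable
  have X3_le: "X3 l q \<omega> \<le> 3 * T * c"
    if "\<And>x y. x \<in> {0..T} \<Longrightarrow> y \<in> {0..T} \<Longrightarrow> \<bar>x - y\<bar> \<le> h / 2 ^ l \<Longrightarrow> (I x \<omega> - I y \<omega>)\<^sup>2 \<le> c" for l q \<omega> c
  proof -
    have "X3 l q \<omega> \<le> 3 * (h / 2 ^ (l + q)) * (\<Sum>i<a * 2 ^ l. \<Sum>k\<in>blk i q. c)"
      unfolding X3_def
    proof (intro mult_left_mono sum_mono that)
      fix i k assume i: "i \<in> {..<a * 2 ^ l}" and k: "k \<in> blk i q"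
      show "real i * (h / 2 ^ l) \<in> {0..T}" using i by (intro grid_T) auto
      show "real k * (h / 2 ^ (l + q)) \<in> {0..T}" using i k by (intro grid_T blk_T(1)) auto
      have eq: "real i * (h / 2 ^ l) = real (i * 2 ^ q) * (h / 2 ^ (l + q))" by (simp add: power_add)
      have "real (i * 2 ^ q) \<le> real k" using blk_T(2)[of i l k q] i k by (intro of_nat_mono) auto
      then have "real (i * 2 ^ q) * (h / 2 ^ (l + q)) \<le> real k * (h / 2 ^ (l + q))"
        using h by (intro mult_right_mono) auto
      then have "\<bar>real i * (h / 2 ^ l) - real k * (h / 2 ^ (l + q))\<bar>
          = (real k - real (i * 2 ^ q)) * (h / 2 ^ (l + q))"
        unfolding eq left_diff_distrib by (subst abs_minus_commute) (rule abs_of_nonneg, simp only: diff_ge_0_iff_ge)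
      also have "\<dots> \<le> 2 ^ q * (h / 2 ^ (l + q))"
      proof (rule mult_right_mono)
        have "real k \<le> real (i * 2 ^ q + 2 ^ q)" using k by (intro of_nat_mono) (auto simp: blk_def)
        then show "real k - real (i * 2 ^ q) \<le> 2 ^ q" by simp
      qed (use h in simp)
      also have "\<dots> = h / 2 ^ l" by (simp add: power_add)
      finally show "\<bar>real i * (h / 2 ^ l) - real k * (h / 2 ^ (l + q))\<bar> \<le> h / 2 ^ l" .
    qed (use h in simp)
    also have "\<dots> = 3 * T * c"
      unfolding blk_sum by (simp add: T_def)
    finally show ?thesis .
  qed
  have X3_nonneg: "0 \<le> X3 l q \<omega>" for l q \<omega>
    unfolding X3_def using h by (auto intro!: divide_nonneg_nonneg mult_nonneg_nonneg sum_nonneg)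
  \<comment> \<open>The supremum over \<open>q\<close> makes the bound for \<open>X3\<close> uniform
    in the fine scale, so that the coarse level can be fixed before \<open>q\<close> grows.\<close>
  define w where "w l \<omega> = (SUP q. X3 l q \<omega>)" for l \<omega>
  have bdd: "bdd_above (range (\<lambda>q. X3 l q \<omega>))" if \<omega>: "\<omega> \<in> space M" for l \<omega>
  proof -
    obtain B where B: "0 \<le> B" "\<And>x. x \<in> {0..T} \<Longrightarrow> \<bar>I x \<omega>\<bar> \<le> B"
      using continuous_on_Icc_bound[OF Ic[OF \<omega>, of T]] by blast
    have "X3 l q \<omega> \<le> 3 * T * (2 * B)\<^sup>2" for q
    proof (rule X3_le)
      fix x y assume "x \<in> {0..T}" "y \<in> {0..T}"
      then have "\<bar>I x \<omega> - I y \<omega>\<bar> \<le> \<bar>2 * B\<bar>" using B(2)[of x] B(2)[of y] B(1) by linarith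
      then show "(I x \<omega> - I y \<omega>)\<^sup>2 \<le> (2 * B)\<^sup>2" by (simp only: abs_le_square_iff)
    qed
    then show ?thesis by (intro bdd_aboveI[of _ "3 * T * (2 * B)\<^sup>2"]) blast
  qed
  have w: "vanishes w"
  proof (rule vanishes_AE)
    show "w l \<in> borel_measurable M" for l
      unfolding w_def[abs_def] using bdd by (intro borel_measurable_cSUP) auto
    show "AE \<omega> in M. (\<lambda>l. w l \<omega>) \<longlonglongrightarrow> 0"
    proof (rule AE_I2, rule tendstoI)
      fix \<omega> and e :: real assume \<omega>: "\<omega> \<in> space M" and e: "0 < e"
      define c where "c = 3 * T + 1"
      define d where "d = sqrt (e / (2 * c))"
      have c: "0 < c" using T by (simp add: c_def)
      have d: "0 < d" "d\<^sup>2 = e / (2 * c)" using e c by (auto simp: d_def)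
      have Td: "3 * T * d\<^sup>2 < e"
      proof -
        have "3 * T * d\<^sup>2 \<le> c * d\<^sup>2" by (intro mult_right_mono) (auto simp: c_def)
        also have "\<dots> = e / 2" using c by (simp add: d(2))
        finally show ?thesis using e by simp
      qed
      show "eventually (\<lambda>l. dist (w l \<omega>) 0 < e) sequentially"
        using uniformly_continuous_grid[OF Ic[OF \<omega>, of T] d(1) h]
      proof eventually_elim
        case (elim l)
        have "X3 l q \<omega> \<le> 3 * T * d\<^sup>2" for q
        proof (rule X3_le)
          fix x y assume "x \<in> {0..T}" "y \<in> {0..T}" "\<bar>x - y\<bar> \<le> h / 2 ^ l"
          then have "\<bar>I x \<omega> - I y \<omega>\<bar> < d" using elim by blast
          then have "\<bar>I x \<omega> - I y \<omega>\<bar> \<le> \<bar>d\<bar>" by linarith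
          then show "(I x \<omega> - I y \<omega>)\<^sup>2 \<le> d\<^sup>2" by (simp only: abs_le_square_iff)
        qed
        then have "w l \<omega> \<le> 3 * T * d\<^sup>2" unfolding w_def by (intro cSUP_least) auto
        moreover have "0 \<le> w l \<omega>"
          unfolding w_def using X3_nonneg[of l 0 \<omega>] bdd[OF \<omega>, of l] by (intro cSUP_upper2[of _ _ 0]) auto
        ultimately show ?case using Td by (simp add: dist_real_def)
      qed
    qed
  qed
  have X3_w: "psize (X3 l q) \<le> psize (w l)" for l q
  proof (rule psize_mono)
    show "AE \<omega> in M. \<bar>X3 l q \<omega>\<bar> \<le> \<bar>w l \<omega>\<bar>"
    proof (rule AE_I2)
      fix \<omega> assume "\<omega> \<in> space M"
      then have "X3 l q \<omega> \<le> w l \<omega>" unfolding w_def using bdd[of \<omega> l] by (intro cSUP_upper) auto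
      then show "\<bar>X3 l q \<omega>\<bar> \<le> \<bar>w l \<omega>\<bar>" using X3_nonneg[of l q \<omega>] by simp
    qed
  qed (use vanishes_measurable[OF w] in auto)
  have X2: "vanishes (X2 l)" for l
    unfolding X2_def[abs_def]
  proof (intro vanishes_sum vanishes_cmult vanishes_square)
    fix i
    have "0 < h / 2 ^ l" using h by simp
    then show "vanishes (\<lambda>q \<omega>. rsum (h / 2 ^ l / 2 ^ q) \<sigma> (i * 2 ^ q) \<omega> - I (real i * (h / 2 ^ l)) \<omega>)"
      using ito unfolding ito_def by blast
  qed simp
  have X1_bound: "psize (X1 \<sigma> l q) \<le> prob {\<omega> \<in> space M. real K < \<bar>C \<omega>\<bar>} + 3 * T * (real K)\<^sup>2 * (h / 2 ^ l)" for K l q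
  proof -
    \<comment> \<open>Clipped at \<open>K\<close>, the integrand is accessible to the isometry; it
      agrees with \<open>\<sigma>\<close> on the whole interval unless the path bound
      \<open>C\<close> exceeds \<open>K\<close>.\<close>
    define f where "f t \<omega> = max (- real K) (min (real K) (\<sigma> t \<omega>))" for t \<omega>
    have fF: "f t \<in> borel_measurable (F t)" if "0 \<le> t" for t
      unfolding f_def[abs_def] using \<sigma>F[OF that] by measurable
    have fM: "f t \<in> borel_measurable M" for t unfolding f_def[abs_def] by measurable
    have fb: "\<bar>f t \<omega>\<bar> \<le> real K" for t \<omega> unfolding f_def by auto
    let ?\<eta> = "h / 2 ^ (l + q)"
    have \<eta>: "0 < ?\<eta>" using h by simp
    let ?D = "\<lambda>i k \<omega>. (rsum ?\<eta> f k \<omega> - rsum ?\<eta> f (i * 2 ^ q) \<omega>)\<^sup>2"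
    have int: "integrable M (?D i k)" if "i < a * 2 ^ l" "k \<in> blk i q" for i k
      by (rule rsum_diff_square(1)[OF fF fb \<eta> blk_T(2)[OF that]])
    have ex: "expectation (?D i k) \<le> (real K)\<^sup>2 * (h / 2 ^ l)" if "i < a * 2 ^ l" "k \<in> blk i q" for i k
    proof -
      have "expectation (?D i k) \<le> (real K)\<^sup>2 * (real (k - i * 2 ^ q) * ?\<eta>)"
        by (rule rsum_diff_square(2)[OF fF fb \<eta> blk_T(2)[OF that]])
      also have "real (k - i * 2 ^ q) * ?\<eta> \<le> real (2 ^ q) * ?\<eta>"
        using blk_T(3)[OF that] \<eta> by (intro mult_right_mono of_nat_mono) auto
      also have "real (2 ^ q) * ?\<eta> = h / 2 ^ l" by (simp add: power_add)
      finally show ?thesis by (simp add: mult_left_mono)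
    qed
    have intX: "integrable M (X1 f l q)"
      unfolding X1_def[abs_def] using int by (intro integrable_mult_right Bochner_Integration.integrable_sum) auto
    have "psize (X1 f l q) \<le> expectation (\<lambda>\<omega>. \<bar>X1 f l q \<omega>\<bar>)"
      by (rule psize_le_expectation_abs[OF intX])
    also have "(\<lambda>\<omega>. \<bar>X1 f l q \<omega>\<bar>) = X1 f l q"
      unfolding X1_def using h by (intro ext abs_of_nonneg mult_nonneg_nonneg sum_nonneg) auto
    also have "expectation (X1 f l q) = 3 * ?\<eta> * (\<Sum>i<a * 2 ^ l. \<Sum>k\<in>blk i q. expectation (?D i k))"
      unfolding X1_def[abs_def] using int by (simp add: Bochner_Integration.integral_sum)
    also have "\<dots> \<le> 3 * ?\<eta> * (\<Sum>i<a * 2 ^ l. \<Sum>k\<in>blk i q. (real K)\<^sup>2 * (h / 2 ^ l))"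
      using ex \<eta> by (intro mult_left_mono sum_mono) auto
    also have "\<dots> = 3 * T * (real K)\<^sup>2 * (h / 2 ^ l)"
      unfolding blk_sum by (simp add: T_def)
    finally have A: "psize (X1 f l q) \<le> 3 * T * (real K)\<^sup>2 * (h / 2 ^ l)" .
    have "psize (X1 \<sigma> l q) \<le> prob {\<omega> \<in> space M. real K < \<bar>C \<omega>\<bar>} + psize (X1 f l q)"
    proof (rule psize_le_except)
      show "AE \<omega> in M. \<omega> \<notin> {\<omega> \<in> space M. real K < \<bar>C \<omega>\<bar>} \<longrightarrow> \<bar>X1 \<sigma> l q \<omega>\<bar> \<le> \<bar>X1 f l q \<omega>\<bar>"
      proof (rule AE_I2, rule impI)
        fix \<omega> assume \<omega>: "\<omega> \<in> space M" "\<omega> \<notin> {\<omega> \<in> space M. real K < \<bar>C \<omega>\<bar>}"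
        have eq: "\<sigma> t \<omega> = f t \<omega>" if "t \<in> {0..T}" for t
          using Cb[OF \<omega>(1) that] \<omega> by (auto simp: f_def abs_le_iff)
        have req: "rsum ?\<eta> \<sigma> k \<omega> = rsum ?\<eta> f k \<omega>" if "k \<le> a * 2 ^ (l + q)" for k
          unfolding rsum_def using that by (intro sum.cong refl arg_cong2[where f="(*)"] eq grid_T) auto
        have "X1 \<sigma> l q \<omega> = X1 f l q \<omega>"
          unfolding X1_def
        proof (intro arg_cong2[where f="(*)"] sum.cong refl)
          fix i k assume i: "i \<in> {..<a * 2 ^ l}" and k: "k \<in> blk i q"
          have "k \<le> a * 2 ^ (l + q)" "i * 2 ^ q \<le> a * 2 ^ (l + q)"
            using blk_T(1,2)[of i l k q] i k by auto
          then show "(rsum ?\<eta> \<sigma> k \<omega> - rsum ?\<eta> \<sigma> (i * 2 ^ q) \<omega>)\<^sup>2 = ?D i k \<omega>"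
            by (simp add: req)
        qed
        then show "\<bar>X1 \<sigma> l q \<omega>\<bar> \<le> \<bar>X1 f l q \<omega>\<bar>" by simp
      qed
    qed (use fM in auto)
    with A show ?thesis by simp
  qed
  have "vanishes E"
  proof (rule vanishesI_eventually)
    fix e :: real assume e: "0 < e"
    \<comment> \<open>The order of choices matters: \<open>K\<close> for the truncation, then
      \<open>l\<close> for both oscillations uniformly in \<open>q\<close>, then \<open>q\<close>
      for the coarse points. Each of the four errors receives \<open>e / 4\<close>.\<close>
    obtain K :: nat where K: "prob {\<omega> \<in> space M. real K < \<bar>C \<omega>\<bar>} < e / 4"
      using prob_gt_small[OF C, of "e / 4"] e by auto
    have "eventually (\<lambda>l. psize (w l) < e / 4 \<and> 3 * T * (real K)\<^sup>2 * h / 2 ^ l < e / 4) sequentially"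
      using e by (intro eventually_conj vanishesD_eventually[OF w] dyadic_mesh_small) auto
    then obtain l where l: "psize (w l) < e / 4" "3 * T * (real K)\<^sup>2 * (h / 2 ^ l) < e / 4"
      by (auto simp: eventually_sequentially)
    have "eventually (\<lambda>q. psize (X2 l q) < e / 4) sequentially"
      using e by (intro vanishesD_eventually[OF X2]) auto
    then have "eventually (\<lambda>q. psize (E (q + l)) \<le> e) sequentially"
    proof eventually_elim
      case (elim q)
      have "psize (E (l + q)) \<le> psize (\<lambda>\<omega>. X1 \<sigma> l q \<omega> + (X2 l q \<omega> + X3 l q \<omega>))"
        using decomp by (intro psize_mono) auto
      also have "\<dots> \<le> psize (X1 \<sigma> l q) + (psize (X2 l q) + psize (X3 l q))"
        by (intro order_trans[OF psize_add_le] add_left_mono psize_add_le) auto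
      also have "\<dots> \<le> e"
        using X1_bound[of l q K] K l X3_w[of l q] elim by linarith
      finally show ?case by (simp add: add.commute)
    qed
    then show "eventually (\<lambda>p. psize (E p) \<le> e) sequentially"
      by (subst (asm) eventually_sequentially_seg[of "\<lambda>p. psize (E p) \<le> e"])
  qed auto
  then show ?thesis by (simp add: E_def[abs_def])
qed

end

text \<open>Cauchy-Schwarz, arranged so that the mesh-weighted sum of the squares of
  \<open>x\<close> splits off with the total length as a factor: this is the quantity known to
  vanish for the error of the Riemann-Ito sums.\<close>

lemma abs_sum_square_le:
  fixes x y :: "nat \<Rightarrow> real"
  assumes "\<And>k. k < n \<Longrightarrow> \<bar>y k\<bar> \<le> C * \<eta>" "0 \<le> \<eta>"
  shows "(\<Sum>k<n. x k * y k)\<^sup>2 \<le> C\<^sup>2 * (real n * \<eta>) * (\<eta> * (\<Sum>k<n. (x k)\<^sup>2))"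
proof -
  have "(\<Sum>k<n. x k * y k)\<^sup>2 \<le> (\<Sum>k<n. (x k)\<^sup>2) * (\<Sum>k<n. (y k)\<^sup>2)"
    by (rule Cauchy_Schwarz_ineq_sum)
  also have "(\<Sum>k<n. (y k)\<^sup>2) \<le> (\<Sum>k<n. (C * \<eta>)\<^sup>2)"
  proof (rule sum_mono)
    fix k assume "k \<in> {..<n}"
    then have "\<bar>y k\<bar> \<le> \<bar>C * \<eta>\<bar>" using assms(1)[of k] by auto
    then show "(y k)\<^sup>2 \<le> (C * \<eta>)\<^sup>2" by (simp only: abs_le_square_iff)
  qed
  also have "(\<Sum>k<n. (x k)\<^sup>2) * (\<Sum>k<n. (C * \<eta>)\<^sup>2) = C\<^sup>2 * (real n * \<eta>) * (\<eta> * (\<Sum>k<n. (x k)\<^sup>2))"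
    by (simp add: power2_eq_square algebra_simps)
  finally show ?thesis by (simp add: mult_left_mono sum_nonneg)
qed

section \<open>Ito's formula for the square of a real process\<close>

context brownian
begin

text \<open>The target sum samples the true process \<open>\<xi>\<close>, whereas the exact
  recursion holds for \<open>y = \<xi> + e\<close>, with \<open>e\<close> the error of the
  Riemann-Ito sum. Every term carrying \<open>e\<close> is reduced to the time-averaged squared
  error, which vanishes.\<close>

lemma ito_square:
  assumes \<xi>: "proc \<xi>" and \<sigma>: "proc \<sigma>"
    and \<beta>_lb: "\<And>\<omega>. \<omega> \<in> space M \<Longrightarrow> locally_bounded_borel (\<lambda>r. \<beta> r \<omega>)"
    and \<beta>_bd: "\<And>T. \<exists>C\<in>borel_measurable M. \<forall>\<omega>\<in>space M. \<forall>r\<in>{0..T}. \<bar>\<beta> r \<omega>\<bar> \<le> C \<omega>"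
    and AF: "\<And>t. 0 \<le> t \<Longrightarrow> (\<lambda>\<omega>. integral {0..t} (\<lambda>r. \<beta> r \<omega>)) \<in> borel_measurable (F t)"
    and A'M: "\<And>t. 0 \<le> t \<Longrightarrow>
      (\<lambda>\<omega>. integral {0..t} (\<lambda>r. 2 * \<xi> r \<omega> * \<beta> r \<omega> + (\<sigma> r \<omega>)\<^sup>2)) \<in> borel_measurable M"
    and ito: "ito \<sigma> (\<lambda>t \<omega>. \<xi> t \<omega> - \<xi> 0 \<omega> - integral {0..t} (\<lambda>r. \<beta> r \<omega>))"
  shows "ito (\<lambda>t \<omega>. 2 * \<xi> t \<omega> * \<sigma> t \<omega>)
    (\<lambda>t \<omega>. (\<xi> t \<omega>)\<^sup>2 - (\<xi> 0 \<omega>)\<^sup>2 - integral {0..t} (\<lambda>r. 2 * \<xi> r \<omega> * \<beta> r \<omega> + (\<sigma> r \<omega>)\<^sup>2))"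
  unfolding ito_def
proof (intro allI impI)
  fix h :: real and a :: nat assume h: "0 < h"
  define T where "T = real a * h"
  have T: "0 \<le> T" using h by (simp add: T_def)
  define \<eta> where "\<eta> p = h / 2 ^ p" for p :: nat
  define n where "n p = a * 2 ^ p" for p :: nat
  have \<eta>: "0 < \<eta> p" for p using h by (simp add: \<eta>_def)
  have n\<eta>: "real (n p) * \<eta> p = T" for p unfolding n_def \<eta>_def T_def by (rule dyadic_mesh_total)
  have grid: "0 \<le> real k * \<eta> p" for k p using \<eta>[of p] by simp
  have grid_T: "r \<in> {0..T}" if "k < n p" "r \<in> {real k * \<eta> p..real (Suc k) * \<eta> p}" for k p r
    using grid_mem[of k "n p" "\<eta> p" r] that \<eta>[of p] n\<eta>[of p] by simp
  have cell: "real k * \<eta> p \<le> real (Suc k) * \<eta> p" for k p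
    using \<eta>[of p] by (intro mult_right_mono) auto
  have \<eta>_lim: "\<eta> \<longlonglongrightarrow> 0"
  proof -
    have "(\<lambda>p. h * (1 / 2) ^ p) \<longlonglongrightarrow> h * 0"
      by (intro tendsto_mult tendsto_const LIMSEQ_realpow_zero) auto
    then show ?thesis by (simp add: \<eta>_def[abs_def] power_divide)
  qed
  define A where "A t \<omega> = integral {0..t} (\<lambda>r. \<beta> r \<omega>)" for t \<omega>
  define I where "I t \<omega> = \<xi> t \<omega> - \<xi> 0 \<omega> - A t \<omega>" for t \<omega>
  have \<xi>M [measurable]: "\<xi> t \<in> borel_measurable M" for t using \<xi> by (simp add: proc_def)
  have \<sigma>M [measurable]: "\<sigma> t \<in> borel_measurable M" for t using \<sigma> by (simp add: proc_def)
  have \<xi>c: "continuous_on UNIV (\<lambda>t. \<xi> t \<omega>)" if "\<omega> \<in> space M" for \<omega> using \<xi> that by (simp add: proc_def)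
  have \<sigma>c: "continuous_on UNIV (\<lambda>t. \<sigma> t \<omega>)" if "\<omega> \<in> space M" for \<omega> using \<sigma> that by (simp add: proc_def)
  have AF': "A t \<in> borel_measurable (F t)" if "0 \<le> t" for t
    unfolding A_def[abs_def] using that by (rule AF)
  have AM: "A t \<in> borel_measurable M" if "0 \<le> t" for t
    using AF'[OF that] by (rule F_measurable_M)
  have \<xi>F: "\<xi> t \<in> borel_measurable (F t)" if "0 \<le> t" for t using \<xi> that by (simp add: proc_def)
  have \<sigma>F: "\<sigma> t \<in> borel_measurable (F t)" if "0 \<le> t" for t using \<sigma> that by (simp add: proc_def)
  have IF: "I t \<in> borel_measurable (F t)" if "0 \<le> t" for t
    unfolding I_def[abs_def]
    by (intro borel_measurable_diff \<xi>F AF' that F_measurable_mono[OF \<xi>F]) (use that in auto)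
  have IM: "I t \<in> borel_measurable M" if "0 \<le> t" for t
    using IF[OF that] by (rule F_measurable_M)
  have Ic: "continuous_on {0..S} (\<lambda>t. I t \<omega>)" if "\<omega> \<in> space M" for \<omega> S
    unfolding I_def A_def
    by (intro continuous_intros continuous_on_subset[OF \<xi>c] that indefinite_integral_continuous_1
        locally_bounded_borel_integrable \<beta>_lb) auto
  obtain B where BM [measurable]: "B \<in> borel_measurable M"
    and B: "\<And>\<omega> r. \<omega> \<in> space M \<Longrightarrow> r \<in> {0..T} \<Longrightarrow> \<bar>\<beta> r \<omega>\<bar> \<le> B \<omega>"
    using \<beta>_bd[of T] by blast
  obtain C where CM [measurable]: "C \<in> borel_measurable M"
    and C: "\<And>\<omega> r. \<omega> \<in> space M \<Longrightarrow> r \<in> {0..T} \<Longrightarrow> \<bar>\<sigma> r \<omega>\<bar> \<le> C \<omega>"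
    using path_norm_bound_measurable[of \<sigma> M T] \<sigma>c by auto
  have B0: "0 \<le> B \<omega>" and C0: "0 \<le> C \<omega>" if "\<omega> \<in> space M" for \<omega>
    using B[OF that, of 0] C[OF that, of 0] T by auto
  define x where "x p k \<omega> = \<xi> (real k * \<eta> p) \<omega>" for p k \<omega>
  define s where "s p k \<omega> = \<sigma> (real k * \<eta> p) \<omega>" for p k \<omega>
  define d where "d p k \<omega> = W (real (Suc k) * \<eta> p) \<omega> - W (real k * \<eta> p) \<omega>" for p k \<omega>
  define dA where "dA p k \<omega> = A (real (Suc k) * \<eta> p) \<omega> - A (real k * \<eta> p) \<omega>" for p k \<omega>
  define e where "e p k \<omega> = rsum (\<eta> p) \<sigma> k \<omega> - I (real k * \<eta> p) \<omega>" for p k \<omega>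
  define y where "y p k \<omega> = x p k \<omega> + e p k \<omega>" for p k \<omega>
  have [measurable]: "x p k \<in> borel_measurable M" "s p k \<in> borel_measurable M" for p k
    unfolding x_def[abs_def] s_def[abs_def] by measurable
  have dM [measurable]: "d p k \<in> borel_measurable M" for p k
    unfolding d_def[abs_def] using less_imp_le[OF \<eta>] by (rule W_increment_measurable)
  have dAM [measurable]: "dA p k \<in> borel_measurable M" for p k
    unfolding dA_def[abs_def] by (intro borel_measurable_diff AM grid)
  have eM [measurable]: "e p k \<in> borel_measurable M" for p k
    unfolding e_def[abs_def] using less_imp_le[OF \<eta>]
    by (intro borel_measurable_diff IM grid rsum_measurable) auto
  have sF: "s p k \<in> borel_measurable (F (real k * \<eta> p))" for p k
    unfolding s_def[abs_def] using grid by (rule \<sigma>F)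
  \<comment> \<open>Adaptedness of the error is what later allows it inside the integrand of a
    martingale transform.\<close>
  have eF: "e p k \<in> borel_measurable (F (real k * \<eta> p))" for p k
  proof -
    interpret noise M "\<lambda>k. F (real k * \<eta> p)" "\<lambda>k \<omega>. W (real (Suc k) * \<eta> p) \<omega> - W (real k * \<eta> p) \<omega>" "\<eta> p"
      by (rule increment_noise[OF \<eta>])
    have "rsum (\<eta> p) \<sigma> k \<in> borel_measurable (F (real k * \<eta> p))"
      unfolding rsum_def[abs_def] by (rule transform_measurable) (rule \<sigma>F[OF grid])
    then show ?thesis unfolding e_def[abs_def] by (intro borel_measurable_diff IF grid)
  qed
  have dA_int: "dA p k \<omega> = integral {real k * \<eta> p..real (Suc k) * \<eta> p} (\<lambda>r. \<beta> r \<omega>)"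
    if "\<omega> \<in> space M" for p k \<omega>
    using Henstock_Kurzweil_Integration.integral_combine[of 0 "real k * \<eta> p" "real (Suc k) * \<eta> p" "\<lambda>r. \<beta> r \<omega>"]
      locally_bounded_borel_integrable[OF \<beta>_lb[OF that], of 0] grid[of k p] cell[of k p]
    by (simp add: dA_def A_def)
  have dA_le: "\<bar>dA p k \<omega>\<bar> \<le> B \<omega> * \<eta> p" if \<omega>: "\<omega> \<in> space M" and k: "k < n p" for p k \<omega>
  proof -
    have "\<bar>dA p k \<omega>\<bar> \<le> B \<omega> * (real (Suc k) * \<eta> p - real k * \<eta> p)"
      unfolding dA_int[OF \<omega>]
      by (intro integral_abs_le locally_bounded_borel_integrable[OF \<beta>_lb[OF \<omega>]] grid cell B[OF \<omega>] grid_T[OF k])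
    then show ?thesis by (simp add: algebra_simps)
  qed
  have s_le: "\<bar>s p k \<omega>\<bar> \<le> C \<omega>" if \<omega>: "\<omega> \<in> space M" and k: "k < n p" for p k \<omega>
    unfolding s_def using cell[of k p] by (intro C[OF \<omega>] grid_T[OF k]) auto
  \<comment> \<open>The \<open>\<xi>\<close> in \<open>x\<close> cancels against the one in
    \<open>I\<close>, so \<open>y\<close> is the initial value plus the drift integral plus the
    Riemann-Ito sum.\<close>
  have y_Suc: "y p (Suc k) \<omega> = y p k \<omega> + (dA p k \<omega> + s p k \<omega> * d p k \<omega>)" for p k \<omega>
    by (simp add: y_def x_def e_def I_def dA_def s_def d_def rsum_def)
  have y_0: "y p 0 \<omega> = \<xi> 0 \<omega>" for p \<omega>
    by (simp add: y_def x_def e_def I_def A_def rsum_def)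
  \<comment> \<open>The telescoped square of \<open>y\<close>, solved for the wanted sum; the
    squared increment of the noise is split into its mean \<open>\<eta> p\<close> and a centred
    remainder.\<close>
  have expand: "(\<Sum>k<m. 2 * x p k \<omega> * s p k \<omega> * d p k \<omega>) = (y p m \<omega>)\<^sup>2 - (\<xi> 0 \<omega>)\<^sup>2
      - (\<Sum>k<m. 2 * x p k \<omega> * dA p k \<omega>) - (\<Sum>k<m. (s p k \<omega>)\<^sup>2 * \<eta> p)
      - 2 * (\<Sum>k<m. e p k \<omega> * dA p k \<omega>) - (\<Sum>k<m. (2 * e p k \<omega> * s p k \<omega>) * d p k \<omega>)
      - (\<Sum>k<m. (dA p k \<omega>)\<^sup>2) - 2 * (\<Sum>k<m. dA p k \<omega> * s p k \<omega> * d p k \<omega>)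
      - (\<Sum>k<m. (s p k \<omega>)\<^sup>2 * ((d p k \<omega>)\<^sup>2 - \<eta> p))" for p m \<omega>
  proof (induction m)
    case 0
    show ?case by (simp add: y_0)
  next
    case (Suc m)
    have "(y p (Suc m) \<omega>)\<^sup>2 = (y p m \<omega>)\<^sup>2 + 2 * (x p m \<omega> + e p m \<omega>) * (dA p m \<omega> + s p m \<omega> * d p m \<omega>)
        + (dA p m \<omega> + s p m \<omega> * d p m \<omega>)\<^sup>2"
      unfolding y_Suc by (simp add: y_def power2_eq_square algebra_simps)
    then show ?case unfolding sum.lessThan_Suc Suc
      by (simp add: power2_eq_square algebra_simps)
  qed
  have IT: "y p (n p) \<omega> - \<xi> T \<omega> = rsum (\<eta> p) \<sigma> (n p) \<omega> - I T \<omega>" for p \<omega>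
    unfolding y_def x_def e_def n\<eta> by simp
  have err: "vanishes (\<lambda>p \<omega>. \<eta> p * (\<Sum>k<n p. (e p k \<omega>)\<^sup>2))"
    unfolding \<eta>_def n_def e_def using ito[folded A_def, folded I_def]
    by (intro ito_grid_error_vanishes[OF \<sigma> IM Ic _ h]) auto
  have V1: "vanishes (\<lambda>p \<omega>. (y p (n p) \<omega>)\<^sup>2 - (\<xi> T \<omega>)\<^sup>2)"
  proof (rule vanishes_diff_squares)
    show "vanishes (\<lambda>p \<omega>. y p (n p) \<omega> - \<xi> T \<omega>)"
      using ito[folded A_def, folded I_def] h unfolding IT unfolding ito_def \<eta>_def n_def T_def by auto
  qed measurable
  have int1: "(\<lambda>\<omega>. integral {0..T} (\<lambda>r. (2 * \<xi> r \<omega>) * \<beta> r \<omega>)) \<in> borel_measurable M \<and>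
      vanishes (\<lambda>p \<omega>. (\<Sum>k<n p. 2 * x p k \<omega> * dA p k \<omega>) - integral {0..T} (\<lambda>r. (2 * \<xi> r \<omega>) * \<beta> r \<omega>))"
  proof -
    have lim: "(\<lambda>p. \<Sum>k<n p. 2 * x p k \<omega> * dA p k \<omega>) \<longlonglongrightarrow> integral {0..T} (\<lambda>r. (2 * \<xi> r \<omega>) * \<beta> r \<omega>)"
      if \<omega>: "\<omega> \<in> space M" for \<omega>
      unfolding dA_int[OF \<omega>] x_def n_def \<eta>_def T_def
      by (rule riemann_sum_weighted[OF _ \<beta>_lb[OF \<omega>] h, of "\<lambda>r. 2 * \<xi> r \<omega>" a])
         (intro continuous_intros \<xi>c[OF \<omega>])
    have m: "(\<lambda>\<omega>. integral {0..T} (\<lambda>r. (2 * \<xi> r \<omega>) * \<beta> r \<omega>)) \<in> borel_measurable M"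
      by (rule borel_measurable_LIMSEQ_real[OF lim]) measurable
    moreover have "vanishes (\<lambda>p \<omega>. (\<Sum>k<n p. 2 * x p k \<omega> * dA p k \<omega>) - integral {0..T} (\<lambda>r. (2 * \<xi> r \<omega>) * \<beta> r \<omega>))"
      using m lim by (intro vanishes_AE AE_I2) (auto intro: LIM_zero)
    ultimately show ?thesis by simp
  qed
  have V3: "vanishes (\<lambda>p \<omega>. (\<Sum>k<n p. (s p k \<omega>)\<^sup>2 * \<eta> p) - integral {0..T} (\<lambda>r. (\<sigma> r \<omega>)\<^sup>2))"
  proof -
    have lim: "(\<lambda>p. \<Sum>k<n p. (s p k \<omega>)\<^sup>2 * \<eta> p) \<longlonglongrightarrow> integral {0..T} (\<lambda>r. (\<sigma> r \<omega>)\<^sup>2)"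
      if \<omega>: "\<omega> \<in> space M" for \<omega>
      unfolding s_def n_def \<eta>_def T_def
      by (rule riemann_sum[OF _ h, of "\<lambda>r. (\<sigma> r \<omega>)\<^sup>2" a]) (intro continuous_intros \<sigma>c[OF \<omega>])
    have m: "(\<lambda>\<omega>. integral {0..T} (\<lambda>r. (\<sigma> r \<omega>)\<^sup>2)) \<in> borel_measurable M"
      by (rule borel_measurable_LIMSEQ_real[OF lim]) measurable
    show ?thesis
      using m lim by (intro vanishes_AE AE_I2) (auto intro: LIM_zero)
  qed
  have V4: "vanishes (\<lambda>p \<omega>. \<Sum>k<n p. e p k \<omega> * dA p k \<omega>)"
  proof (rule vanishes_of_square)
    have "vanishes (\<lambda>p \<omega>. ((B \<omega>)\<^sup>2 * T) * (\<eta> p * (\<Sum>k<n p. (e p k \<omega>)\<^sup>2)))"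
      by (intro vanishes_mult err) measurable
    then show "vanishes (\<lambda>p \<omega>. (\<Sum>k<n p. e p k \<omega> * dA p k \<omega>)\<^sup>2)"
    proof (rule vanishes_mono)
      show "AE \<omega> in M. \<bar>(\<Sum>k<n p. e p k \<omega> * dA p k \<omega>)\<^sup>2\<bar> \<le> \<bar>(B \<omega>)\<^sup>2 * T * (\<eta> p * (\<Sum>k<n p. (e p k \<omega>)\<^sup>2))\<bar>" for p
      proof (rule AE_I2)
        fix \<omega> assume "\<omega> \<in> space M"
        from abs_sum_square_le[of "n p" "\<lambda>k. dA p k \<omega>", OF dA_le[OF this] less_imp_le[OF \<eta>], of "\<lambda>k. e p k \<omega>"]
        show "\<bar>(\<Sum>k<n p. e p k \<omega> * dA p k \<omega>)\<^sup>2\<bar> \<le> \<bar>(B \<omega>)\<^sup>2 * T * (\<eta> p * (\<Sum>k<n p. (e p k \<omega>)\<^sup>2))\<bar>"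
          unfolding n\<eta> by simp
      qed
    qed measurable
  qed measurable
  \<comment> \<open>Cauchy-Schwarz is too weak here, since the squared noise increments sum to order
    1 while the unweighted squares of \<open>e\<close> need not be small. Domination by the
    quadratic variation supplies the missing mesh weight.\<close>
  have V5: "vanishes (\<lambda>p \<omega>. \<Sum>k<n p. (2 * e p k \<omega> * s p k \<omega>) * d p k \<omega>)"
    unfolding d_def
  proof (rule noise_transform_vanishes[OF increment_noise[OF \<eta>] \<eta>])
    show "(\<lambda>\<omega>. 2 * e p k \<omega> * s p k \<omega>) \<in> borel_measurable (F (real k * \<eta> p))" for p k
      using eF[of p k] sF[of p k] by measurable
    have "vanishes (\<lambda>p \<omega>. (4 * (C \<omega>)\<^sup>2) * (\<eta> p * (\<Sum>k<n p. (e p k \<omega>)\<^sup>2)))"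
      by (intro vanishes_mult err) measurable
    then show "vanishes (\<lambda>p \<omega>. \<eta> p * (\<Sum>k<n p. (2 * e p k \<omega> * s p k \<omega>)\<^sup>2))"
    proof (rule vanishes_mono)
      show "AE \<omega> in M. \<bar>\<eta> p * (\<Sum>k<n p. (2 * e p k \<omega> * s p k \<omega>)\<^sup>2)\<bar>
          \<le> \<bar>4 * (C \<omega>)\<^sup>2 * (\<eta> p * (\<Sum>k<n p. (e p k \<omega>)\<^sup>2))\<bar>" for p
      proof (rule AE_I2)
        fix \<omega> assume \<omega>: "\<omega> \<in> space M"
        have "(\<Sum>k<n p. (2 * e p k \<omega> * s p k \<omega>)\<^sup>2) \<le> (\<Sum>k<n p. 4 * (C \<omega>)\<^sup>2 * (e p k \<omega>)\<^sup>2)"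
        proof (rule sum_mono)
          fix k assume "k \<in> {..<n p}"
          then have "(s p k \<omega>)\<^sup>2 \<le> (C \<omega>)\<^sup>2"
            using s_le[OF \<omega>, of k p] C0[OF \<omega>] by (auto simp: abs_le_square_iff[symmetric])
          then have "(2 * e p k \<omega>)\<^sup>2 * (s p k \<omega>)\<^sup>2 \<le> (2 * e p k \<omega>)\<^sup>2 * (C \<omega>)\<^sup>2"
            by (intro mult_left_mono) auto
          then show "(2 * e p k \<omega> * s p k \<omega>)\<^sup>2 \<le> 4 * (C \<omega>)\<^sup>2 * (e p k \<omega>)\<^sup>2"
            by (simp add: power_mult_distrib mult_ac)
        qed
        then have "\<eta> p * (\<Sum>k<n p. (2 * e p k \<omega> * s p k \<omega>)\<^sup>2) \<le> \<eta> p * (4 * (C \<omega>)\<^sup>2 * (\<Sum>k<n p. (e p k \<omega>)\<^sup>2))"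
          using \<eta>[of p] by (intro mult_left_mono) (auto simp: sum_distrib_left)
        moreover have "0 \<le> \<eta> p * (\<Sum>k<n p. (2 * e p k \<omega> * s p k \<omega>)\<^sup>2)"
          using \<eta>[of p] by (intro mult_nonneg_nonneg sum_nonneg) auto
        ultimately show "\<bar>\<eta> p * (\<Sum>k<n p. (2 * e p k \<omega> * s p k \<omega>)\<^sup>2)\<bar>
          \<le> \<bar>4 * (C \<omega>)\<^sup>2 * (\<eta> p * (\<Sum>k<n p. (e p k \<omega>)\<^sup>2))\<bar>"
          by (simp add: mult_ac)
      qed
    qed measurable
  qed
  have V6: "vanishes (\<lambda>p \<omega>. \<Sum>k<n p. (dA p k \<omega>)\<^sup>2)"
  proof (rule vanishes_AE)
    show "AE \<omega> in M. (\<lambda>p. \<Sum>k<n p. (dA p k \<omega>)\<^sup>2) \<longlonglongrightarrow> 0"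
    proof (rule AE_I2)
      fix \<omega> assume \<omega>: "\<omega> \<in> space M"
      have "(\<lambda>p. (B \<omega>)\<^sup>2 * T * \<eta> p) \<longlonglongrightarrow> (B \<omega>)\<^sup>2 * T * 0" by (intro tendsto_intros \<eta>_lim)
      then have lim: "(\<lambda>p. (B \<omega>)\<^sup>2 * T * \<eta> p) \<longlonglongrightarrow> 0" by simp
      show "(\<lambda>p. \<Sum>k<n p. (dA p k \<omega>)\<^sup>2) \<longlonglongrightarrow> 0"
      proof (rule tendsto_sandwich[OF _ _ tendsto_const lim]; intro always_eventually allI)
        fix p
        show "0 \<le> (\<Sum>k<n p. (dA p k \<omega>)\<^sup>2)" by (intro sum_nonneg) auto
        have "(\<Sum>k<n p. (dA p k \<omega>)\<^sup>2) \<le> (\<Sum>k<n p. (B \<omega> * \<eta> p)\<^sup>2)"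
          using dA_le[OF \<omega>] B0[OF \<omega>] less_imp_le[OF \<eta>]
          by (intro sum_mono) (auto simp: abs_le_square_iff[symmetric])
        also have "\<dots> = (B \<omega>)\<^sup>2 * (real (n p) * \<eta> p) * \<eta> p" by (simp add: power2_eq_square)
        finally show "(\<Sum>k<n p. (dA p k \<omega>)\<^sup>2) \<le> (B \<omega>)\<^sup>2 * T * \<eta> p" by (simp only: n\<eta>)
      qed
    qed
  qed measurable
  \<comment> \<open>Each term is of order mesh times the oscillation of the Brownian path over one
    cell, and the number of cells is inversely proportional to the mesh, so uniform continuity of
    the path suffices.\<close>
  have V7: "vanishes (\<lambda>p \<omega>. \<Sum>k<n p. dA p k \<omega> * s p k \<omega> * d p k \<omega>)"
  proof (rule vanishes_AE)
    show "AE \<omega> in M. (\<lambda>p. \<Sum>k<n p. dA p k \<omega> * s p k \<omega> * d p k \<omega>) \<longlonglongrightarrow> 0"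
    proof (rule AE_I2, rule tendstoI)
      fix \<omega> and r :: real assume \<omega>: "\<omega> \<in> space M" and r: "0 < r"
      define c where "c = B \<omega> * C \<omega> * T + 1"
      have c: "0 < c" unfolding c_def using B0[OF \<omega>] C0[OF \<omega>] T by (intro add_nonneg_pos mult_nonneg_nonneg) auto
      have rc: "0 < r / (2 * c)" using r c by simp
      show "eventually (\<lambda>p. dist (\<Sum>k<n p. dA p k \<omega> * s p k \<omega> * d p k \<omega>) 0 < r) sequentially"
        using uniformly_continuous_grid[OF continuous_on_subset[OF W_continuous[OF \<omega>] subset_UNIV] rc h, of T]
      proof eventually_elim
        case (elim p)
        have "\<bar>dA p k \<omega> * s p k \<omega> * d p k \<omega>\<bar> \<le> (B \<omega> * \<eta> p) * C \<omega> * (r / (2 * c))" if k: "k < n p" for k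
        proof -
          have "\<bar>real (Suc k) * \<eta> p - real k * \<eta> p\<bar> \<le> h / 2 ^ p"
            unfolding \<eta>_def[symmetric] using \<eta>[of p] by (simp add: algebra_simps)
          then have "\<bar>d p k \<omega>\<bar> < r / (2 * c)"
            unfolding d_def using elim grid_T[OF k] cell[of k p] by auto
          then show ?thesis
            unfolding abs_mult using dA_le[OF \<omega> k] s_le[OF \<omega> k] B0[OF \<omega>] C0[OF \<omega>] \<eta>[of p]
            by (intro mult_mono mult_nonneg_nonneg) auto
        qed
        then have "\<bar>\<Sum>k<n p. dA p k \<omega> * s p k \<omega> * d p k \<omega>\<bar> \<le> (\<Sum>k<n p. (B \<omega> * \<eta> p) * C \<omega> * (r / (2 * c)))"
          by (intro order_trans[OF sum_abs] sum_mono) auto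
        also have "\<dots> = B \<omega> * C \<omega> * (real (n p) * \<eta> p) * (r / (2 * c))" by simp
        also have "\<dots> \<le> c * (r / (2 * c))"
          unfolding n\<eta> using rc by (intro mult_right_mono) (auto simp: c_def)
        also have "\<dots> < r" using c r by simp
        finally show ?case by (simp add: dist_real_def)
      qed
    qed
  qed measurable
  \<comment> \<open>The centred squares have variance of order \<open>\<eta>^2\<close> on a number
    of cells of order \<open>1 / \<eta>\<close>, so the quadratic variation of this sum is of order
    \<open>\<eta>\<close>.\<close>
  have V8: "vanishes (\<lambda>p \<omega>. \<Sum>k<n p. (s p k \<omega>)\<^sup>2 * ((d p k \<omega>)\<^sup>2 - \<eta> p))"
    unfolding d_def
  proof (rule noise_transform_vanishes[OF increment_square_noise[OF \<eta>]])
    show "0 < 2 * (\<eta> p)\<^sup>2" for p using \<eta>[of p] by simp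
    show "(\<lambda>\<omega>. (s p k \<omega>)\<^sup>2) \<in> borel_measurable (F (real k * \<eta> p))" for p k
      using sF[of p k] by measurable
    show "vanishes (\<lambda>p \<omega>. 2 * (\<eta> p)\<^sup>2 * (\<Sum>k<n p. ((s p k \<omega>)\<^sup>2)\<^sup>2))"
    proof (rule vanishes_AE)
      show "AE \<omega> in M. (\<lambda>p. 2 * (\<eta> p)\<^sup>2 * (\<Sum>k<n p. ((s p k \<omega>)\<^sup>2)\<^sup>2)) \<longlonglongrightarrow> 0"
      proof (rule AE_I2)
        fix \<omega> assume \<omega>: "\<omega> \<in> space M"
        have "(\<lambda>p. 2 * ((C \<omega>)\<^sup>2)\<^sup>2 * T * \<eta> p) \<longlonglongrightarrow> 2 * ((C \<omega>)\<^sup>2)\<^sup>2 * T * 0" by (intro tendsto_intros \<eta>_lim)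
        then have lim: "(\<lambda>p. 2 * ((C \<omega>)\<^sup>2)\<^sup>2 * T * \<eta> p) \<longlonglongrightarrow> 0" by simp
        show "(\<lambda>p. 2 * (\<eta> p)\<^sup>2 * (\<Sum>k<n p. ((s p k \<omega>)\<^sup>2)\<^sup>2)) \<longlonglongrightarrow> 0"
        proof (rule tendsto_sandwich[OF _ _ tendsto_const lim]; intro always_eventually allI)
          fix p
          show "0 \<le> 2 * (\<eta> p)\<^sup>2 * (\<Sum>k<n p. ((s p k \<omega>)\<^sup>2)\<^sup>2)" by (intro mult_nonneg_nonneg sum_nonneg) auto
          have "(\<Sum>k<n p. ((s p k \<omega>)\<^sup>2)\<^sup>2) \<le> (\<Sum>k<n p. ((C \<omega>)\<^sup>2)\<^sup>2)"
          proof (rule sum_mono)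
            fix k assume "k \<in> {..<n p}"
            then have "(s p k \<omega>)\<^sup>2 \<le> (C \<omega>)\<^sup>2"
              using s_le[OF \<omega>, of k p] C0[OF \<omega>] by (auto simp: abs_le_square_iff[symmetric])
            then show "((s p k \<omega>)\<^sup>2)\<^sup>2 \<le> ((C \<omega>)\<^sup>2)\<^sup>2" by (rule power_mono) simp
          qed
          then have "2 * (\<eta> p)\<^sup>2 * (\<Sum>k<n p. ((s p k \<omega>)\<^sup>2)\<^sup>2) \<le> 2 * (\<eta> p)\<^sup>2 * (\<Sum>k<n p. ((C \<omega>)\<^sup>2)\<^sup>2)"
            by (intro mult_left_mono) auto
          also have "\<dots> = 2 * ((C \<omega>)\<^sup>2)\<^sup>2 * (real (n p) * \<eta> p) * \<eta> p" by (simp add: power2_eq_square)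
          finally show "2 * (\<eta> p)\<^sup>2 * (\<Sum>k<n p. ((s p k \<omega>)\<^sup>2)\<^sup>2) \<le> 2 * ((C \<omega>)\<^sup>2)\<^sup>2 * T * \<eta> p"
            by (simp only: n\<eta>)
        qed
      qed
    qed measurable
  qed
  have split: "integral {0..T} (\<lambda>r. 2 * \<xi> r \<omega> * \<beta> r \<omega> + (\<sigma> r \<omega>)\<^sup>2)
      = integral {0..T} (\<lambda>r. (2 * \<xi> r \<omega>) * \<beta> r \<omega>) + integral {0..T} (\<lambda>r. (\<sigma> r \<omega>)\<^sup>2)"
    if \<omega>: "\<omega> \<in> space M" for \<omega>
  proof (rule Henstock_Kurzweil_Integration.integral_add)
    have lb: "locally_bounded_borel (\<lambda>r. 2 * \<xi> r \<omega>)"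
      by (intro locally_bounded_borel_continuous continuous_intros \<xi>c[OF \<omega>])
    show "(\<lambda>r. (2 * \<xi> r \<omega>) * \<beta> r \<omega>) integrable_on {0..T}"
      by (rule locally_bounded_borel_integrable[OF locally_bounded_borel_mult[OF lb \<beta>_lb[OF \<omega>]]]) simp
    show "(\<lambda>r. (\<sigma> r \<omega>)\<^sup>2) integrable_on {0..T}"
      by (intro locally_bounded_borel_integrable locally_bounded_borel_continuous continuous_intros \<sigma>c[OF \<omega>]) auto
  qed
  have sum_van: "vanishes (\<lambda>p \<omega>. ((y p (n p) \<omega>)\<^sup>2 - (\<xi> T \<omega>)\<^sup>2)
      - ((\<Sum>k<n p. 2 * x p k \<omega> * dA p k \<omega>) - integral {0..T} (\<lambda>r. (2 * \<xi> r \<omega>) * \<beta> r \<omega>))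
      - ((\<Sum>k<n p. (s p k \<omega>)\<^sup>2 * \<eta> p) - integral {0..T} (\<lambda>r. (\<sigma> r \<omega>)\<^sup>2))
      - 2 * (\<Sum>k<n p. e p k \<omega> * dA p k \<omega>) - (\<Sum>k<n p. (2 * e p k \<omega> * s p k \<omega>) * d p k \<omega>)
      - (\<Sum>k<n p. (dA p k \<omega>)\<^sup>2) - 2 * (\<Sum>k<n p. dA p k \<omega> * s p k \<omega> * d p k \<omega>)
      - (\<Sum>k<n p. (s p k \<omega>)\<^sup>2 * ((d p k \<omega>)\<^sup>2 - \<eta> p)))"
    by (intro vanishes_diff vanishes_cmult V1 conjunct2[OF int1] V3 V4 V5 V6 V7 V8)
  have "vanishes (\<lambda>p \<omega>. rsum (\<eta> p) (\<lambda>t \<omega>. 2 * \<xi> t \<omega> * \<sigma> t \<omega>) (n p) \<omega>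
      - ((\<xi> T \<omega>)\<^sup>2 - (\<xi> 0 \<omega>)\<^sup>2 - integral {0..T} (\<lambda>r. 2 * \<xi> r \<omega> * \<beta> r \<omega> + (\<sigma> r \<omega>)\<^sup>2)))"
  proof (rule vanishes_cong_AE[OF sum_van])
    show "(\<lambda>\<omega>. rsum (\<eta> p) (\<lambda>t \<omega>. 2 * \<xi> t \<omega> * \<sigma> t \<omega>) (n p) \<omega>
      - ((\<xi> T \<omega>)\<^sup>2 - (\<xi> 0 \<omega>)\<^sup>2 - integral {0..T} (\<lambda>r. 2 * \<xi> r \<omega> * \<beta> r \<omega> + (\<sigma> r \<omega>)\<^sup>2))) \<in> borel_measurable M" for p
      using less_imp_le[OF \<eta>] T
      by (intro borel_measurable_diff rsum_measurable A'M borel_measurable_power) auto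
    have r: "rsum (\<eta> p) (\<lambda>t \<omega>. 2 * \<xi> t \<omega> * \<sigma> t \<omega>) (n p) \<omega> = (\<Sum>k<n p. 2 * x p k \<omega> * s p k \<omega> * d p k \<omega>)" for p \<omega>
      by (simp add: rsum_def x_def s_def d_def)
    show "AE \<omega> in M. rsum (\<eta> p) (\<lambda>t \<omega>. 2 * \<xi> t \<omega> * \<sigma> t \<omega>) (n p) \<omega>
      - ((\<xi> T \<omega>)\<^sup>2 - (\<xi> 0 \<omega>)\<^sup>2 - integral {0..T} (\<lambda>r. 2 * \<xi> r \<omega> * \<beta> r \<omega> + (\<sigma> r \<omega>)\<^sup>2)) =
      ((y p (n p) \<omega>)\<^sup>2 - (\<xi> T \<omega>)\<^sup>2)
      - ((\<Sum>k<n p. 2 * x p k \<omega> * dA p k \<omega>) - integral {0..T} (\<lambda>r. (2 * \<xi> r \<omega>) * \<beta> r \<omega>))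
      - ((\<Sum>k<n p. (s p k \<omega>)\<^sup>2 * \<eta> p) - integral {0..T} (\<lambda>r. (\<sigma> r \<omega>)\<^sup>2))
      - 2 * (\<Sum>k<n p. e p k \<omega> * dA p k \<omega>) - (\<Sum>k<n p. (2 * e p k \<omega> * s p k \<omega>) * d p k \<omega>)
      - (\<Sum>k<n p. (dA p k \<omega>)\<^sup>2) - 2 * (\<Sum>k<n p. dA p k \<omega> * s p k \<omega> * d p k \<omega>)
      - (\<Sum>k<n p. (s p k \<omega>)\<^sup>2 * ((d p k \<omega>)\<^sup>2 - \<eta> p))" for p
    proof (rule AE_I2, goal_cases)
      case (1 \<omega>)
      show ?case unfolding split[OF 1] r expand by simp
    qed
  qed
  then show "vanishes (\<lambda>p \<omega>. rsum (h / 2 ^ p) (\<lambda>t \<omega>. 2 * \<xi> t \<omega> * \<sigma> t \<omega>) (a * 2 ^ p) \<omega>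
      - ((\<xi> (real a * h) \<omega>)\<^sup>2 - (\<xi> 0 \<omega>)\<^sup>2 - integral {0..real a * h} (\<lambda>r. 2 * \<xi> r \<omega> * \<beta> r \<omega> + (\<sigma> r \<omega>)\<^sup>2)))"
    unfolding \<eta>_def n_def T_def .
qed

end

section \<open>Uniqueness for linear equations and the maximal inequality\<close>

text \<open>Left sums of a nondecreasing power stay below its integral, cell by cell through the
  factorisation of \<open>(x + h)^(m+1) - x^(m+1)\<close>. This drives the iteration that stands in
  for Gronwall's inequality.\<close>

lemma power_left_riemann_sum_le:
  fixes h :: real
  assumes "0 \<le> h"
  shows "h * (\<Sum>k<n. (real k * h) ^ m) \<le> (real n * h) ^ Suc m / real (Suc m)"
proof (induction n)
  case (Suc n)
  define x where "x = real n * h"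
  have x: "0 \<le> x" using assms by (simp add: x_def)
  have "real (Suc m) * (h * x ^ m) \<le> (x + h) ^ Suc m - x ^ Suc m"
  proof -
    have "(x + h) ^ Suc m - x ^ Suc m = h * (\<Sum>p<Suc m. x ^ (m - p) * (x + h) ^ p)"
      using power_diff_sumr2[of "x + h" "Suc m" x] by simp
    also have "(\<Sum>p<Suc m. x ^ (m - p) * (x + h) ^ p) \<ge> (\<Sum>p<Suc m. x ^ m)"
    proof (rule sum_mono)
      fix p assume "p \<in> {..<Suc m}"
      then have "x ^ m = x ^ (m - p) * x ^ p" by (simp add: power_add[symmetric])
      also have "\<dots> \<le> x ^ (m - p) * (x + h) ^ p"
        using x assms by (intro mult_left_mono power_mono) auto
      finally show "x ^ m \<le> x ^ (m - p) * (x + h) ^ p" .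
    qed
    then have "h * (\<Sum>p<Suc m. x ^ (m - p) * (x + h) ^ p) \<ge> h * (\<Sum>p<Suc m. x ^ m)"
      using assms by (rule mult_left_mono)
    finally show ?thesis by (simp add: algebra_simps)
  qed
  then have "h * x ^ m \<le> ((x + h) ^ Suc m - x ^ Suc m) / real (Suc m)"
    by (simp add: field_simps del: power_Suc)
  with Suc have "h * (\<Sum>k<Suc n. (real k * h) ^ m) \<le> (x + h) ^ Suc m / real (Suc m)"
    by (simp add: x_def distrib_left diff_divide_distrib del: power_Suc)
  then show ?case by (simp add: x_def algebra_simps del: power_Suc)
qed simp

text \<open>Lets a limit in probability act on second moments of a bounded variable. Near
  \<open>x\<close> the inequality (a + b)^2 \<le> 2 a^2 + 2 b^2 applies, far away the bound
  \<open>K\<close>; the factor \<open>max 2 (K\<^sup>2)\<close> serves both cases.\<close>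

lemma square_le_of_close:
  fixes x z K :: real
  assumes "\<bar>x\<bar> \<le> K"
  shows "x\<^sup>2 \<le> 2 * z\<^sup>2 + max 2 (K\<^sup>2) * min 1 \<bar>z - x\<bar>"
proof (cases "\<bar>z - x\<bar> \<le> 1")
  case True
  have "0 \<le> (x - 2 * z)\<^sup>2" by simp
  then have "x\<^sup>2 \<le> 2 * z\<^sup>2 + 2 * (z - x)\<^sup>2" by (simp add: power2_eq_square algebra_simps)
  also have "2 * (z - x)\<^sup>2 \<le> 2 * \<bar>z - x\<bar>"
    using True mult_left_le_one_le[of "\<bar>z - x\<bar>" "\<bar>z - x\<bar>"] by (simp add: power2_eq_square)
  also have "2 * \<bar>z - x\<bar> \<le> max 2 (K\<^sup>2) * \<bar>z - x\<bar>" by (intro mult_right_mono) auto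
  finally show ?thesis using True by simp
next
  case False
  have "\<bar>x\<bar> \<le> \<bar>K\<bar>" using assms by linarith
  then have "x\<^sup>2 \<le> K\<^sup>2" by (simp only: abs_le_square_iff)
  also have "K\<^sup>2 \<le> 2 * z\<^sup>2 + max 2 (K\<^sup>2)" by (simp add: add_increasing)
  finally show ?thesis using False by simp
qed

context brownian
begin

text \<open>A second-moment Gronwall argument, localised by \<open>Q\<close> instead of a stopping
  time: \<open>Q\<close> decreases, so on \<open>Q t\<close> all earlier indicators equal 1 and the
  stopped transform is the true Riemann sum, while its integrands remain bounded.\<close>

lemma ito_linear_unique:
  assumes gF: "\<And>t. 0 \<le> t \<Longrightarrow> g t \<in> borel_measurable (F t)" and gM: "\<And>t. g t \<in> borel_measurable M"
    and DM: "\<And>t. D t \<in> borel_measurable M"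
    and ito: "ito g D"
    and Q: "\<And>t. 0 \<le> t \<Longrightarrow> Q t \<in> sets (F t)" and anti: "\<And>s t. 0 \<le> s \<Longrightarrow> s \<le> t \<Longrightarrow> Q t \<subseteq> Q s"
    and gD: "\<And>t \<omega>. 0 \<le> t \<Longrightarrow> \<omega> \<in> Q t \<Longrightarrow> \<bar>g t \<omega>\<bar> \<le> C * \<bar>D t \<omega>\<bar>"
    and DK: "\<And>t \<omega>. 0 \<le> t \<Longrightarrow> \<omega> \<in> Q t \<Longrightarrow> \<bar>D t \<omega>\<bar> \<le> K" and CK: "0 \<le> C" "0 \<le> K"
    and t: "0 \<le> t"
  shows "AE \<omega> in M. \<omega> \<in> Q t \<longrightarrow> D t \<omega> = 0"
proof -
  note gM [measurable] DM [measurable]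
  define u where "u t = expectation (\<lambda>\<omega>. indicator (Q t) \<omega> * (D t \<omega>)\<^sup>2)" for t
  have QM: "Q t \<in> events" if "0 \<le> t" for t
    using Q[OF that] F_subalg[of t] by (auto simp: subalgebra_def)
  have D2: "indicator (Q t) \<omega> * (D t \<omega>)\<^sup>2 \<le> K\<^sup>2" if "0 \<le> t" for t \<omega>
    using DK[OF that, of \<omega>] CK by (auto simp: indicator_def abs_le_square_iff[symmetric])
  have int_u: "integrable M (\<lambda>\<omega>. indicator (Q t) \<omega> * (D t \<omega>)\<^sup>2)" if "0 \<le> t" for t
    using D2[OF that] QM[OF that] by (intro integrable_const_bound[where B="K\<^sup>2"]) auto
  have u_le: "u t \<le> K\<^sup>2" if "0 \<le> t" for t
  proof -
    have "u t \<le> expectation (\<lambda>_. K\<^sup>2)"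
      unfolding u_def using int_u[OF that] D2[OF that] by (intro integral_mono) auto
    then show ?thesis by (simp add: prob_space)
  qed
  \<comment> \<open>The isometry bounds the second moment of the stopped sum by a left Riemann sum
    of \<open>u\<close>; the last term measures how far the Riemann-Ito sum is from its limit
    \<open>D\<close>.\<close>
  have step: "u (real a * h) \<le> 2 * C\<^sup>2 * (h / 2 ^ p * (\<Sum>k<a * 2 ^ p. u (real k * (h / 2 ^ p))))
      + max 2 (K\<^sup>2) * psize (\<lambda>\<omega>. rsum (h / 2 ^ p) g (a * 2 ^ p) \<omega> - D (real a * h) \<omega>)" if h: "0 < h" for a h p
  proof -
    define T where "T = real a * h"
    define \<eta> where "\<eta> = h / 2 ^ p"
    define n where "n = a * 2 ^ p"
    have \<eta>: "0 < \<eta>" using h by (simp add: \<eta>_def)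
    have n\<eta>: "real n * \<eta> = T" unfolding n_def \<eta>_def T_def by (rule dyadic_mesh_total)
    have T: "0 \<le> T" using h by (simp add: T_def)
    have grid: "0 \<le> real k * \<eta>" for k using \<eta> by simp
    define f where "f k \<omega> = indicator (Q (real k * \<eta>)) \<omega> * g (real k * \<eta>) \<omega>" for k \<omega>
    interpret noise M "\<lambda>k. F (real k * \<eta>)" "\<lambda>k \<omega>. W (real (Suc k) * \<eta>) \<omega> - W (real k * \<eta>) \<omega>" \<eta>
      by (rule increment_noise[OF \<eta>])
    have fF: "f k \<in> borel_measurable (F (real k * \<eta>))" for k
      unfolding f_def[abs_def] using Q[OF grid[of k]] gF[OF grid[of k]] by measurable
    have fD: "\<bar>f k \<omega>\<bar> \<le> C * (indicator (Q (real k * \<eta>)) \<omega> * \<bar>D (real k * \<eta>) \<omega>\<bar>)" for k \<omega>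
      using gD[OF grid[of k], of \<omega>] by (auto simp: f_def indicator_def)
    have fb: "\<bar>f k \<omega>\<bar> \<le> C * K" for k \<omega>
    proof -
      have "indicator (Q (real k * \<eta>)) \<omega> * \<bar>D (real k * \<eta>) \<omega>\<bar> \<le> K"
        using DK[OF grid[of k], of \<omega>] CK by (auto simp: indicator_def)
      then show ?thesis using fD[of k \<omega>] CK(1) by (meson mult_left_mono order_trans)
    qed
    define Z where "Z \<omega> = (\<Sum>k<n. f k \<omega> * (W (real (Suc k) * \<eta>) \<omega> - W (real k * \<eta>) \<omega>))" for \<omega>
    note iso = transform_isometry[OF fF fb, of n, folded Z_def]
    have "expectation (\<lambda>\<omega>. (f k \<omega>)\<^sup>2) \<le> C\<^sup>2 * u (real k * \<eta>)" for k
    proof -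
      have "expectation (\<lambda>\<omega>. (f k \<omega>)\<^sup>2) \<le> expectation (\<lambda>\<omega>. C\<^sup>2 * (indicator (Q (real k * \<eta>)) \<omega> * (D (real k * \<eta>) \<omega>)\<^sup>2))"
      proof (rule integral_mono_AE')
        show "AE \<omega> in M. (f k \<omega>)\<^sup>2 \<le> C\<^sup>2 * (indicator (Q (real k * \<eta>)) \<omega> * (D (real k * \<eta>) \<omega>)\<^sup>2)"
        proof (rule AE_I2)
          fix \<omega>
          have "\<bar>f k \<omega>\<bar>\<^sup>2 \<le> (C * (indicator (Q (real k * \<eta>)) \<omega> * \<bar>D (real k * \<eta>) \<omega>\<bar>))\<^sup>2"
            using fD by (rule power_mono) simp
          then show "(f k \<omega>)\<^sup>2 \<le> C\<^sup>2 * (indicator (Q (real k * \<eta>)) \<omega> * (D (real k * \<eta>) \<omega>)\<^sup>2)"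
            by (auto simp: power_mult_distrib indicator_def split: if_splits)
        qed
      qed (use int_u[OF grid] in auto)
      then show ?thesis by (simp add: u_def)
    qed
    then have EZ: "expectation (\<lambda>\<omega>. (Z \<omega>)\<^sup>2) \<le> \<eta> * (\<Sum>k<n. C\<^sup>2 * u (real k * \<eta>))"
      unfolding iso(2) using \<eta> by (intro mult_left_mono sum_mono) auto
    let ?R = "\<lambda>\<omega>. rsum \<eta> g n \<omega> - D T \<omega>"
    have RM: "?R \<in> borel_measurable M"
      using \<eta> by (intro borel_measurable_diff rsum_measurable) auto
    have "u T \<le> expectation (\<lambda>\<omega>. 2 * (Z \<omega>)\<^sup>2 + max 2 (K\<^sup>2) * min 1 \<bar>?R \<omega>\<bar>)"
      unfolding u_def
    proof (intro integral_mono int_u T Bochner_Integration.integrable_add integrable_mult_right iso(1) integrable_min_abs RM)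
      fix \<omega>
      show "indicator (Q T) \<omega> * (D T \<omega>)\<^sup>2 \<le> 2 * (Z \<omega>)\<^sup>2 + max 2 (K\<^sup>2) * min 1 \<bar>?R \<omega>\<bar>"
      proof (cases "\<omega> \<in> Q T")
        case True
        have "f k \<omega> = g (real k * \<eta>) \<omega>" if "k < n" for k
        proof -
          have "real k * \<eta> \<le> T" unfolding n\<eta>[symmetric] using that \<eta> by (intro mult_right_mono) auto
          then have "\<omega> \<in> Q (real k * \<eta>)" using anti[OF grid] True by blast
          then show ?thesis by (simp add: f_def)
        qed
        then have "Z \<omega> = rsum \<eta> g n \<omega>" unfolding Z_def rsum_def by simp
        then show ?thesis using square_le_of_close[OF DK[OF T True], of "Z \<omega>"] True by simp
      next
        case False
        have "0 \<le> max 2 (K\<^sup>2) * min 1 \<bar>?R \<omega>\<bar>" by (intro mult_nonneg_nonneg) auto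
        then show ?thesis using False by simp
      qed
    qed
    also have "\<dots> = 2 * expectation (\<lambda>\<omega>. (Z \<omega>)\<^sup>2) + max 2 (K\<^sup>2) * psize ?R"
      unfolding psize_def using iso(1) integrable_min_abs[OF RM]
      by (subst Bochner_Integration.integral_add) auto
    also have "\<dots> \<le> 2 * C\<^sup>2 * (\<eta> * (\<Sum>k<n. u (real k * \<eta>))) + max 2 (K\<^sup>2) * psize ?R"
      using EZ by (simp add: sum_distrib_left[symmetric] mult_ac)
    finally show ?thesis by (simp add: T_def \<eta>_def n_def)
  qed
  \<comment> \<open>Feeding the bound into itself \<open>m\<close> times yields the terms of an
    exponential series, which tend to 0. Left sums take the place of an integral of
    \<open>u\<close>, whose continuity in time is not at hand.\<close>
  have "u t \<le> K\<^sup>2 * (2 * C\<^sup>2 * t) ^ m / fact m" if "0 \<le> t" for t m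
    using that
  proof (induction m arbitrary: t)
    case 0
    then show ?case using u_le by simp
  next
    case (Suc m)
    \<comment> \<open>Every time is a multiple of a positive mesh: \<open>a = 1\<close> in general,
      but \<open>a = 0\<close> at time 0, where the time itself cannot serve as the mesh.\<close>
    obtain h a where h: "0 < h" and ta: "t = real a * h"
    proof (cases "t = 0")
      case True
      then show ?thesis using that[of 1 0] by simp
    next
      case False
      then show ?thesis using that[of t 1] Suc.prems by simp
    qed
    let ?c = "2 * C\<^sup>2 * (K\<^sup>2 * (2 * C\<^sup>2) ^ m / fact m)"
    have c: "0 \<le> ?c" by simp
    have bound: "u t \<le> ?c * (t ^ Suc m / real (Suc m))
        + max 2 (K\<^sup>2) * psize (\<lambda>\<omega>. rsum (h / 2 ^ p) g (a * 2 ^ p) \<omega> - D (real a * h) \<omega>)" for p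
    proof -
      let ?\<eta> = "h / 2 ^ p"
      have \<eta>: "0 \<le> ?\<eta>" using h by simp
      have eq: "K\<^sup>2 * (2 * C\<^sup>2 * r) ^ m / fact m = K\<^sup>2 * (2 * C\<^sup>2) ^ m / fact m * r ^ m" for r
        by (simp add: power_mult_distrib)
      have "(\<Sum>k<a * 2 ^ p. u (real k * ?\<eta>)) \<le> (\<Sum>k<a * 2 ^ p. K\<^sup>2 * (2 * C\<^sup>2) ^ m / fact m * (real k * ?\<eta>) ^ m)"
      proof (rule sum_mono)
        fix k
        have "u (real k * ?\<eta>) \<le> K\<^sup>2 * (2 * C\<^sup>2 * (real k * ?\<eta>)) ^ m / fact m"
          using \<eta> by (intro Suc.IH mult_nonneg_nonneg) auto
        then show "u (real k * ?\<eta>) \<le> K\<^sup>2 * (2 * C\<^sup>2) ^ m / fact m * (real k * ?\<eta>) ^ m"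
          by (simp only: eq)
      qed
      then have "2 * C\<^sup>2 * (?\<eta> * (\<Sum>k<a * 2 ^ p. u (real k * ?\<eta>)))
          \<le> 2 * C\<^sup>2 * (?\<eta> * (\<Sum>k<a * 2 ^ p. K\<^sup>2 * (2 * C\<^sup>2) ^ m / fact m * (real k * ?\<eta>) ^ m))"
        using \<eta> by (intro mult_left_mono) auto
      also have "\<dots> = ?c * (?\<eta> * (\<Sum>k<a * 2 ^ p. (real k * ?\<eta>) ^ m))"
        unfolding sum_distrib_left[symmetric] by (simp only: mult_ac)
      also have "\<dots> \<le> ?c * ((real (a * 2 ^ p) * ?\<eta>) ^ Suc m / real (Suc m))"
        by (intro mult_left_mono power_left_riemann_sum_le \<eta> c)
      also have "real (a * 2 ^ p) * ?\<eta> = t" unfolding ta by (rule dyadic_mesh_total)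
      finally show ?thesis using step[OF h, of a p] by (simp add: ta)
    qed
    have "(\<lambda>p. psize (\<lambda>\<omega>. rsum (h / 2 ^ p) g (a * 2 ^ p) \<omega> - D (real a * h) \<omega>)) \<longlonglongrightarrow> 0"
      using ito h by (simp add: ito_def vanishes_def)
    then have "(\<lambda>p. ?c * (t ^ Suc m / real (Suc m))
        + max 2 (K\<^sup>2) * psize (\<lambda>\<omega>. rsum (h / 2 ^ p) g (a * 2 ^ p) \<omega> - D (real a * h) \<omega>))
      \<longlonglongrightarrow> ?c * (t ^ Suc m / real (Suc m)) + max 2 (K\<^sup>2) * 0"
      by (intro tendsto_intros)
    then have "u t \<le> ?c * (t ^ Suc m / real (Suc m)) + max 2 (K\<^sup>2) * 0"
      by (rule LIMSEQ_le_const) (use bound in auto)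
    then show ?case by (simp add: power_mult_distrib mult_ac)
  qed
  then have "u t \<le> K\<^sup>2 * (inverse (fact m) * (2 * C\<^sup>2 * t) ^ m)" for m
    using t by (simp add: divide_inverse mult_ac)
  moreover have "(\<lambda>m. K\<^sup>2 * (inverse (fact m) * (2 * C\<^sup>2 * t) ^ m)) \<longlonglongrightarrow> K\<^sup>2 * 0"
    by (intro tendsto_mult tendsto_const summable_LIMSEQ_zero summable_exp)
  ultimately have "u t \<le> 0" by (auto intro: LIMSEQ_le_const)
  moreover have "0 \<le> u t" unfolding u_def by (intro integral_nonneg_AE) auto
  ultimately have "expectation (\<lambda>\<omega>. indicator (Q t) \<omega> * (D t \<omega>)\<^sup>2) = 0"
    unfolding u_def by (rule antisym)
  then have "AE \<omega> in M. indicator (Q t) \<omega> * (D t \<omega>)\<^sup>2 = 0"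
    by (subst (asm) integral_nonneg_eq_0_iff_AE[OF int_u[OF t]]) auto
  then show ?thesis by eventually_elim auto
qed

text \<open>The increments of \<open>P\<close> are limits in probability of centred transforms,
  which by itself says nothing about expectations. Subtracting \<open>\<gamma>\<close> times the
  squared transform gives a one-sided bound that survives the limit; its cost is controlled by the
  isometry, and \<open>\<gamma>\<close> then tends to 0.\<close>

lemma ito_dominated_submartingale:
  assumes gF: "\<And>t. 0 \<le> t \<Longrightarrow> g t \<in> borel_measurable (F t)"
    and gC: "\<And>t \<omega>. \<bar>g t \<omega>\<bar> \<le> C" and ito: "ito g P"
    and LM: "\<And>t. L t \<in> borel_measurable M"
    and h: "0 < h" and ab: "a \<le> b" and A: "A \<in> sets (F (real a * h))"
    and bd: "AE \<omega> in M. \<bar>L (real b * h) \<omega> - L (real a * h) \<omega>\<bar> \<le> 1"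
    and dom: "AE \<omega> in M. P (real b * h) \<omega> - P (real a * h) \<omega> \<le> L (real b * h) \<omega> - L (real a * h) \<omega>"
  shows "0 \<le> expectation (\<lambda>\<omega>. indicator A \<omega> * (L (real b * h) \<omega> - L (real a * h) \<omega>))"
proof -
  note LM [measurable]
  let ?\<Delta> = "\<lambda>\<omega>. L (real b * h) \<omega> - L (real a * h) \<omega>"
  define N where "N \<omega> = P (real b * h) \<omega> - P (real a * h) \<omega>" for \<omega>
  define Z where "Z p \<omega> = rsum (h / 2 ^ p) g (b * 2 ^ p) \<omega> - rsum (h / 2 ^ p) g (a * 2 ^ p) \<omega>" for p \<omega>
  have AM [measurable]: "A \<in> events" using A F_subalg by (auto simp: subalgebra_def)
  have van: "vanishes (\<lambda>p \<omega>. Z p \<omega> - N \<omega>)"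
  proof -
    have "vanishes (\<lambda>p \<omega>. (rsum (h / 2 ^ p) g (b * 2 ^ p) \<omega> - P (real b * h) \<omega>)
        - (rsum (h / 2 ^ p) g (a * 2 ^ p) \<omega> - P (real a * h) \<omega>))"
      using ito h unfolding ito_def by - (rule vanishes_diff, auto)
    then show ?thesis by (simp add: Z_def N_def algebra_simps)
  qed
  have intD: "integrable M (\<lambda>\<omega>. indicator A \<omega> * ?\<Delta> \<omega>)"
  proof (rule integrable_const_bound[where B=1])
    show "AE \<omega> in M. norm (indicator A \<omega> * ?\<Delta> \<omega>) \<le> 1"
      using bd by eventually_elim (auto simp: indicator_def)
  qed measurable
  have key: "- \<gamma> * (C\<^sup>2 * (real (b - a) * h)) \<le> expectation (\<lambda>\<omega>. indicator A \<omega> * ?\<Delta> \<omega>)" if \<gamma>: "0 < \<gamma>" for \<gamma>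
  proof -
    \<comment> \<open>\<open>1 / (4 * \<gamma>)\<close> is the maximum of
      \<open>z - \<gamma> z^2\<close>. When sum and limit are more than 1 apart, subtracting
      \<open>c\<close> therefore leaves at most -2, which is below \<open>?\<Delta>\<close>; when
      they are close, a factor of at least 1 suffices.\<close>
    define c where "c = 2 + 1 / (4 * \<gamma>)"
    have c: "2 \<le> c" "0 \<le> 1 / (4 * \<gamma>)" using \<gamma> by (auto simp: c_def)
    have bound: "- \<gamma> * (C\<^sup>2 * (real (b - a) * h)) - c * psize (\<lambda>\<omega>. Z p \<omega> - N \<omega>)
        \<le> expectation (\<lambda>\<omega>. indicator A \<omega> * ?\<Delta> \<omega>)" for p
    proof -
      let ?\<eta> = "h / 2 ^ p"
      have \<eta>: "0 < ?\<eta>" using h by simp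
      have ab': "a * 2 ^ p \<le> b * 2 ^ p" using ab by simp
      interpret noise M "\<lambda>k. F (real k * ?\<eta>)" "\<lambda>k \<omega>. W (real (Suc k) * ?\<eta>) \<omega> - W (real k * ?\<eta>) \<omega>" ?\<eta>
        by (rule increment_noise[OF \<eta>])
      note Z2 = rsum_diff_square[OF gF gC \<eta> ab', folded Z_def]
      have "real (b * 2 ^ p - a * 2 ^ p) * ?\<eta> = real (b - a) * h"
        by (simp add: left_diff_distrib'[symmetric])
      with Z2(2) have EZ2: "expectation (\<lambda>\<omega>. (Z p \<omega>)\<^sup>2) \<le> C\<^sup>2 * (real (b - a) * h)" by (simp only:)
      have ZM: "Z p \<in> borel_measurable M"
      proof -
        have *: "rsum ?\<eta> g n \<in> borel_measurable M" for n
          unfolding rsum_def[abs_def]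
          by (rule measurable_G_M[OF transform_measurable]) (use h in \<open>auto intro!: gF\<close>)
        show ?thesis unfolding Z_def[abs_def] by (intro borel_measurable_diff *)
      qed
      have intZ: "integrable M (Z p)"
        by (rule square_integrable_imp_integrable[OF ZM Z2(1)])
      have intAZ: "integrable M (\<lambda>\<omega>. indicator A \<omega> * Z p \<omega>)"
        using integrable_real_mult_indicator[OF AM intZ] by (simp add: mult.commute)
      let ?f = "\<lambda>j \<omega>. if j < a * 2 ^ p then 0 else indicator A \<omega> * g (real j * ?\<eta>) \<omega>"
      have fF: "?f j \<in> borel_measurable (F (real j * ?\<eta>))" for j
      proof (cases "j < a * 2 ^ p")
        case False
        have "real a * h = real (a * 2 ^ p) * ?\<eta>" by simp
        also have "\<dots> \<le> real j * ?\<eta>" using False \<eta> by (intro mult_right_mono of_nat_mono) auto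
        finally have "A \<in> sets (F (real j * ?\<eta>))" using A F_mono by blast
        moreover have "g (real j * ?\<eta>) \<in> borel_measurable (F (real j * ?\<eta>))" using h by (intro gF) auto
        ultimately show ?thesis using False by simp
      qed simp
      have fb: "\<bar>?f j \<omega>\<bar> \<le> \<bar>C\<bar>" for j \<omega>
        using gC[of "real j * ?\<eta>" \<omega>] by (auto simp: indicator_def)
      have "indicator A \<omega> * Z p \<omega> = (\<Sum>j<b * 2 ^ p. ?f j \<omega> * (W (real (Suc j) * ?\<eta>) \<omega> - W (real j * ?\<eta>) \<omega>))" for \<omega>
        unfolding Z_def rsum_diff[OF ab'] sum_distrib_left by (intro sum.cong) auto
      then have EAZ: "expectation (\<lambda>\<omega>. indicator A \<omega> * Z p \<omega>) = 0"
        using transform_mean_zero[OF fF fb, of "b * 2 ^ p"] by simp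
      let ?m = "\<lambda>\<omega>. min 1 \<bar>Z p \<omega> - N \<omega>\<bar>"
      have intm: "integrable M ?m" using vanishes_measurable[OF van] by (rule integrable_min_abs)
      have "expectation (\<lambda>\<omega>. indicator A \<omega> * Z p \<omega> - c * ?m \<omega> - \<gamma> * (Z p \<omega>)\<^sup>2)
          \<le> expectation (\<lambda>\<omega>. indicator A \<omega> * ?\<Delta> \<omega>)"
      proof (intro integral_mono_AE Bochner_Integration.integrable_diff integrable_mult_right intAZ intm Z2(1) intD)
        show "AE \<omega> in M. indicator A \<omega> * Z p \<omega> - c * ?m \<omega> - \<gamma> * (Z p \<omega>)\<^sup>2 \<le> indicator A \<omega> * ?\<Delta> \<omega>"
          using bd dom
        proof eventually_elim
          case (elim \<omega>)
          have m: "0 \<le> c * ?m \<omega>" using c by (intro mult_nonneg_nonneg) auto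
          have z: "0 \<le> \<gamma> * (Z p \<omega>)\<^sup>2" using \<gamma> by simp
          have "Z p \<omega> - c * ?m \<omega> - \<gamma> * (Z p \<omega>)\<^sup>2 \<le> ?\<Delta> \<omega>"
          proof (cases "\<bar>Z p \<omega> - N \<omega>\<bar> \<le> 1")
            case True
            have "\<bar>Z p \<omega> - N \<omega>\<bar> \<le> c * \<bar>Z p \<omega> - N \<omega>\<bar>"
              using c(1) mult_right_mono[of 1 c "\<bar>Z p \<omega> - N \<omega>\<bar>"] by simp
            then have "Z p \<omega> - N \<omega> \<le> c * ?m \<omega>" using True by simp
            then show ?thesis using z elim(2) by (simp add: N_def)
          next
            case False
            have "0 \<le> (2 * \<gamma> * Z p \<omega> - 1)\<^sup>2 / (4 * \<gamma>)" using \<gamma> by simp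
            also have "\<dots> = \<gamma> * (Z p \<omega>)\<^sup>2 - Z p \<omega> + 1 / (4 * \<gamma>)"
              using \<gamma> by (simp add: field_simps power2_eq_square)
            finally have "Z p \<omega> - \<gamma> * (Z p \<omega>)\<^sup>2 \<le> c - 2" by (simp add: c_def)
            then show ?thesis using False elim(1) by simp
          qed
          then show ?case using m z by (cases "\<omega> \<in> A") auto
        qed
      qed
      also have "expectation (\<lambda>\<omega>. indicator A \<omega> * Z p \<omega> - c * ?m \<omega> - \<gamma> * (Z p \<omega>)\<^sup>2)
          = 0 - c * psize (\<lambda>\<omega>. Z p \<omega> - N \<omega>) - \<gamma> * expectation (\<lambda>\<omega>. (Z p \<omega>)\<^sup>2)"
        using intAZ intm Z2(1) EAZ
        by (simp add: Bochner_Integration.integral_diff psize_def)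
      finally show ?thesis using mult_left_mono[OF EZ2 less_imp_le[OF \<gamma>]] by simp
    qed
    have "(\<lambda>p. - \<gamma> * (C\<^sup>2 * (real (b - a) * h)) - c * psize (\<lambda>\<omega>. Z p \<omega> - N \<omega>))
        \<longlonglongrightarrow> - \<gamma> * (C\<^sup>2 * (real (b - a) * h)) - c * 0"
      using van by (intro tendsto_intros) (auto simp: vanishes_def)
    then have "- \<gamma> * (C\<^sup>2 * (real (b - a) * h)) - c * 0 \<le> expectation (\<lambda>\<omega>. indicator A \<omega> * ?\<Delta> \<omega>)"
      by (rule LIMSEQ_le_const2) (use bound in auto)
    then show ?thesis by simp
  qed
  have "0 \<le> expectation (\<lambda>\<omega>. indicator A \<omega> * ?\<Delta> \<omega>) + e" if e: "0 < e" for e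
  proof -
    define q where "q = C\<^sup>2 * (real (b - a) * h) + 1"
    have q: "0 < q" using h by (auto simp: q_def intro!: add_nonneg_pos)
    have "e / q * (C\<^sup>2 * (real (b - a) * h)) \<le> e / q * q"
      using e q by (intro mult_left_mono) (auto simp: q_def)
    also have "\<dots> = e" using q by simp
    finally show ?thesis using key[of "e / q"] e q by simp
  qed
  then show ?thesis by (rule field_le_epsilon)
qed

text \<open>Invariant of the induction behind Doob's inequality: \<open>\<delta>\<close> times the
  probability of having reached the level, plus the expectation of \<open>V\<close> on the
  survivors, never exceeds \<open>v\<close>. A path that crosses now has \<open>V\<close> at least
  \<open>\<delta>\<close>, so it only lowers this sum, and survival up to \<open>n\<close> is known
  at time \<open>n\<close>.\<close>

lemma supermartingale_grid_maximal:
  assumes V: "\<And>t. 0 \<le> t \<Longrightarrow> V t \<in> borel_measurable (F t)"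
    and bd: "\<And>t. 0 \<le> t \<Longrightarrow> AE \<omega> in M. 0 \<le> V t \<omega> \<and> V t \<omega> \<le> 1"
    and V0: "AE \<omega> in M. V 0 \<omega> = v"
    and super: "\<And>k A. A \<in> sets (F (real k * h)) \<Longrightarrow>
      expectation (\<lambda>\<omega>. indicator A \<omega> * (V (real (Suc k) * h) \<omega> - V (real k * h) \<omega>)) \<le> 0"
    and h: "0 < h" and \<delta>: "0 < \<delta>"
  shows "\<delta> * prob {\<omega> \<in> space M. \<exists>k\<le>n. \<delta> \<le> V (real k * h) \<omega>} \<le> v"
proof -
  have grid: "0 \<le> real k * h" for k using h by simp
  have VM [measurable]: "V (real k * h) \<in> borel_measurable M" for k
    by (rule F_measurable_M[OF V[OF grid]])
  define A where "A n = {\<omega> \<in> space M. \<forall>k\<le>n. V (real k * h) \<omega> < \<delta>}" for n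
  have AF: "A n \<in> sets (F (real n * h))" for n
  proof -
    have "{\<omega> \<in> space (F (real n * h)). \<forall>k\<in>{..n}. V (real k * h) \<omega> < \<delta>} \<in> sets (F (real n * h))"
    proof (rule sets.sets_Collect_finite_All)
      fix k assume "k \<in> {..n}"
      then have "V (real k * h) \<in> borel_measurable (F (real n * h))"
        using h by (intro F_measurable_mono[OF V[OF grid]] mult_right_mono) auto
      then show "{\<omega> \<in> space (F (real n * h)). V (real k * h) \<omega> < \<delta>} \<in> sets (F (real n * h))"
        by (simp add: borel_measurable_iff_less)
    qed simp
    then show ?thesis unfolding A_def space_F Ball_def atMost_iff .
  qed
  have AM [measurable]: "A n \<in> events" for n using AF[of n] F_subalg by (auto simp: subalgebra_def)
  have int: "integrable M (\<lambda>\<omega>. indicator (A m) \<omega> * V (real k * h) \<omega>)" for m k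
  proof (rule integrable_const_bound[where B=1])
    show "AE \<omega> in M. norm (indicator (A m) \<omega> * V (real k * h) \<omega>) \<le> 1"
      using bd[OF grid[of k]] by eventually_elim (auto simp: indicator_def)
  qed measurable
  have main: "\<delta> * prob (space M - A n) + expectation (\<lambda>\<omega>. indicator (A n) \<omega> * V (real n * h) \<omega>) \<le> v"
  proof (induction n)
    case 0
    have "\<delta> * prob (space M - A 0) + expectation (\<lambda>\<omega>. indicator (A 0) \<omega> * V 0 \<omega>)
        = expectation (\<lambda>\<omega>. \<delta> * indicator (space M - A 0) \<omega> + indicator (A 0) \<omega> * V 0 \<omega>)"
      using int[of 0 0] by (subst Bochner_Integration.integral_add) (auto simp: emeasure_eq_measure)
    also have "\<dots> \<le> expectation (\<lambda>\<omega>. v)"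
    proof (rule integral_mono_AE)
      show "AE \<omega> in M. \<delta> * indicator (space M - A 0) \<omega> + indicator (A 0) \<omega> * V 0 \<omega> \<le> v"
        using V0 AE_space by eventually_elim (auto simp: A_def indicator_def)
    qed (use int[of 0 0] in \<open>auto simp: emeasure_eq_measure\<close>)
    finally show ?case by (simp add: prob_space)
  next
    case (Suc n)
    let ?V = "V (real (Suc n) * h)"
    have "\<delta> * prob (space M - A (Suc n)) + expectation (\<lambda>\<omega>. indicator (A (Suc n)) \<omega> * ?V \<omega>)
        = expectation (\<lambda>\<omega>. \<delta> * indicator (space M - A (Suc n)) \<omega> + indicator (A (Suc n)) \<omega> * ?V \<omega>)"
      using int[of "Suc n" "Suc n"] by (subst Bochner_Integration.integral_add) (auto simp: emeasure_eq_measure)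
    also have "\<dots> \<le> expectation (\<lambda>\<omega>. \<delta> * indicator (space M - A n) \<omega> + indicator (A n) \<omega> * ?V \<omega>)"
    proof (intro integral_mono_AE Bochner_Integration.integrable_add int integrable_mult_right)
      show "AE \<omega> in M. \<delta> * indicator (space M - A (Suc n)) \<omega> + indicator (A (Suc n)) \<omega> * ?V \<omega>
        \<le> \<delta> * indicator (space M - A n) \<omega> + indicator (A n) \<omega> * ?V \<omega>"
      proof (rule AE_I2)
        fix \<omega> assume "\<omega> \<in> space M"
        then show "\<delta> * indicator (space M - A (Suc n)) \<omega> + indicator (A (Suc n)) \<omega> * ?V \<omega>
          \<le> \<delta> * indicator (space M - A n) \<omega> + indicator (A n) \<omega> * ?V \<omega>"
          by (auto simp: A_def indicator_def le_Suc_eq not_less simp del: of_nat_Suc)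
      qed
    qed (auto simp: emeasure_eq_measure)
    also have "\<dots> = \<delta> * prob (space M - A n) + expectation (\<lambda>\<omega>. indicator (A n) \<omega> * ?V \<omega>)"
      using int[of n "Suc n"] by (subst Bochner_Integration.integral_add) (auto simp: emeasure_eq_measure)
    also have "expectation (\<lambda>\<omega>. indicator (A n) \<omega> * ?V \<omega>)
        \<le> expectation (\<lambda>\<omega>. indicator (A n) \<omega> * V (real n * h) \<omega>)"
    proof -
      have "expectation (\<lambda>\<omega>. indicator (A n) \<omega> * ?V \<omega>) - expectation (\<lambda>\<omega>. indicator (A n) \<omega> * V (real n * h) \<omega>)
          = expectation (\<lambda>\<omega>. indicator (A n) \<omega> * (?V \<omega> - V (real n * h) \<omega>))"
        unfolding right_diff_distrib by (rule Bochner_Integration.integral_diff[OF int int, symmetric])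
      with super[OF AF[of n]] show ?thesis by simp
    qed
    finally show ?case using Suc by simp
  qed
  have "0 \<le> expectation (\<lambda>\<omega>. indicator (A n) \<omega> * V (real n * h) \<omega>)"
  proof (rule integral_nonneg_AE)
    show "AE \<omega> in M. 0 \<le> indicator (A n) \<omega> * V (real n * h) \<omega>"
      using bd[OF grid[of n]] by eventually_elim auto
  qed
  moreover have "{\<omega> \<in> space M. \<exists>k\<le>n. \<delta> \<le> V (real k * h) \<omega>} = space M - A n"
    by (auto simp: A_def not_less)
  ultimately show ?thesis using main by simp
qed

text \<open>Delivers a measurable set containing every exceedance rather than a statement about a
  supremum. Continuity and the strict inequality transfer an exceedance at \<open>t\<close> to
  nearby dyadic times.\<close>

lemma supermartingale_maximal:
  assumes V: "\<And>t. 0 \<le> t \<Longrightarrow> V t \<in> borel_measurable (F t)"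
    and cont: "\<And>\<omega>. \<omega> \<in> space M \<Longrightarrow> continuous_on UNIV (\<lambda>t. V t \<omega>)"
    and bd: "\<And>t. 0 \<le> t \<Longrightarrow> AE \<omega> in M. 0 \<le> V t \<omega> \<and> V t \<omega> \<le> 1"
    and V0: "AE \<omega> in M. V 0 \<omega> = v"
    and super: "\<And>h k A. 0 < h \<Longrightarrow> A \<in> sets (F (real k * h)) \<Longrightarrow>
      expectation (\<lambda>\<omega>. indicator A \<omega> * (V (real (Suc k) * h) \<omega> - V (real k * h) \<omega>)) \<le> 0"
    and \<delta>: "0 < \<delta>"
  obtains E where "E \<in> events" "prob E \<le> v / \<delta>"
    "\<And>\<omega> t. \<omega> \<in> space M \<Longrightarrow> 0 \<le> t \<Longrightarrow> \<delta> < V t \<omega> \<Longrightarrow> \<omega> \<in> E"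
proof
  \<comment> \<open>Mesh \<open>1 / 2 ^ n\<close> up to time \<open>2 ^ n\<close>, hence
    \<open>4 ^ n\<close> cells: resolution and horizon grow together, and the sets are nested
    because index \<open>k\<close> becomes \<open>2 * k\<close>.\<close>
  define E where "E n = {\<omega> \<in> space M. \<exists>k\<le>4 ^ n. \<delta> \<le> V (real k * (1 / 2 ^ n)) \<omega>}" for n :: nat
  have VM [measurable]: "V (real k * (1 / 2 ^ n)) \<in> borel_measurable M" for k n :: nat
    by (rule F_measurable_M[OF V]) simp
  have EM: "E n \<in> events" for n unfolding E_def by measurable
  then show "(\<Union>n. E n) \<in> events" by auto
  have "incseq E"
  proof (rule incseq_SucI, rule subsetI)
    fix n \<omega> assume "\<omega> \<in> E n"
    then obtain k where k: "\<omega> \<in> space M" "k \<le> 4 ^ n" "\<delta> \<le> V (real k * (1 / 2 ^ n)) \<omega>" by (auto simp: E_def)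
    moreover have "2 * k \<le> 4 ^ Suc n" using k(2) by simp
    moreover have "real (2 * k) * (1 / 2 ^ Suc n) = real k * (1 / 2 ^ n)" by simp
    ultimately show "\<omega> \<in> E (Suc n)"
      unfolding E_def by (intro CollectI conjI exI[of _ "2 * k"]) (auto simp del: of_nat_mult power_Suc)
  qed
  then have "(\<lambda>n. prob (E n)) \<longlonglongrightarrow> prob (\<Union>n. E n)"
    using EM by (intro finite_Lim_measure_incseq) auto
  moreover have "prob (E n) \<le> v / \<delta>" for n
  proof -
    have "\<delta> * prob (E n) \<le> v"
      unfolding E_def by (rule supermartingale_grid_maximal[OF V bd V0 super _ \<delta>]) auto
    then show ?thesis using \<delta> by (simp add: field_simps)
  qed
  ultimately show "prob (\<Union>n. E n) \<le> v / \<delta>" by (auto intro: LIMSEQ_le_const2)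
  fix \<omega> t assume \<omega>: "\<omega> \<in> space M" and t: "0 \<le> t" and gt: "\<delta> < V t \<omega>"
  define s where "s n = real (nat \<lfloor>t * 2 ^ n\<rfloor>) * (1 / 2 ^ n)" for n :: nat
  have s_bd: "\<bar>s n - t\<bar> \<le> 1 / 2 ^ n" for n
  proof -
    have "real (nat \<lfloor>t * 2 ^ n\<rfloor>) = of_int \<lfloor>t * 2 ^ n\<rfloor>" using t by simp
    then have "\<bar>real (nat \<lfloor>t * 2 ^ n\<rfloor>) - t * 2 ^ n\<bar> \<le> 1" by linarith
    moreover have "s n - t = (real (nat \<lfloor>t * 2 ^ n\<rfloor>) - t * 2 ^ n) / 2 ^ n"
      by (simp add: s_def diff_divide_distrib)
    ultimately show ?thesis by (simp add: abs_divide divide_right_mono)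
  qed
  have "s \<longlonglongrightarrow> t"
  proof (rule Lim_null_comparison[THEN LIM_zero_cancel])
    show "eventually (\<lambda>n. norm (s n - t) \<le> (1 / 2) ^ n) sequentially"
      using s_bd by (simp add: power_divide)
    show "(\<lambda>n. (1 / 2 :: real) ^ n) \<longlonglongrightarrow> 0" by (intro LIMSEQ_realpow_zero) auto
  qed
  then have "(\<lambda>n. V (s n) \<omega>) \<longlonglongrightarrow> V t \<omega>"
    by (rule continuous_on_tendsto_compose[OF cont[OF \<omega>]]) auto
  then have ev1: "eventually (\<lambda>n. \<delta> < V (s n) \<omega>) sequentially" using gt by (rule order_tendstoD(1))
  obtain N :: nat where N: "t \<le> real N" using real_arch_simple by blast
  have "eventually (\<lambda>n. N \<le> n) sequentially" by (rule eventually_ge_at_top)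
  with ev1 have "eventually (\<lambda>n. \<delta> < V (s n) \<omega> \<and> N \<le> n) sequentially" by (rule eventually_conj)
  then obtain n where n: "\<delta> < V (s n) \<omega>" "N \<le> n" by (auto simp: eventually_sequentially)
  have "real (nat \<lfloor>t * 2 ^ n\<rfloor>) \<le> t * 2 ^ n" using t by simp
  also have "\<dots> \<le> 2 ^ n * 2 ^ n"
  proof (rule mult_right_mono)
    have "t \<le> real n" using N n(2) by linarith
    also have "real n \<le> real (2 ^ n)" by (intro of_nat_mono) (simp add: less_imp_le)
    finally show "t \<le> 2 ^ n" by simp
  qed simp
  also have "\<dots> = real (4 ^ n)" by (simp add: power_mult_distrib[symmetric])
  finally have "nat \<lfloor>t * 2 ^ n\<rfloor> \<le> 4 ^ n" by (simp only: of_nat_le_iff)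
  then show "\<omega> \<in> (\<Union>n. E n)"
    using n(1) \<omega> unfolding E_def s_def by (intro UN_I[of n] CollectI conjI exI[of _ "nat \<lfloor>t * 2 ^ n\<rfloor>"]) auto
qed

end

section \<open>Hermitian matrices and the closed-loop coefficients\<close>

text \<open>Bridge between two structures: the stochastic calculus treats the state as a real
  Euclidean vector, the quantum identities use the Hermitian form.\<close>

lemma inner_eq_Re_braket: "x \<bullet> y = Re (braket x y)"
  by (simp add: inner_vec_def braket_def inner_complex_def Re_sum)

lemma braket_add_right: "braket x (y + z) = braket x y + braket x z"
  by (simp add: braket_def distrib_left sum.distrib)

lemma braket_diff_right: "braket x (y - z) = braket x y - braket x z"
  by (simp add: braket_def right_diff_distrib sum_subtractf)

lemma braket_scale_right: "braket x (c *s y) = c * braket x y"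
  by (simp add: braket_def sum_distrib_left mult_ac)

lemma braket_scale_left: "braket (c *s x) y = cnj c * braket x y"
  by (simp add: braket_def sum_distrib_left mult_ac)

lemma braket_scaleR_right: "braket x (r *\<^sub>R y) = r *\<^sub>R braket x y"
  by (simp add: braket_def scaleR_sum_right)

lemma braket_sum_right: "braket x (\<Sum>j\<in>J. f j) = (\<Sum>j\<in>J. braket x (f j))"
  unfolding braket_def sum_component sum_distrib_left by (rule sum.swap)

lemma cnj_braket: "cnj (braket x y) = braket y x"
  by (simp add: braket_def cnj_sum mult.commute)

lemma braket_self: "braket x x = complex_of_real ((norm x)\<^sup>2)"
proof (rule complex_eqI)
  show "Re (braket x x) = Re (complex_of_real ((norm x)\<^sup>2))"
    by (simp add: inner_eq_Re_braket[symmetric] power2_norm_eq_inner)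
  have "cnj (braket x x) = braket x x" by (rule cnj_braket)
  then show "Im (braket x x) = Im (complex_of_real ((norm x)\<^sup>2))"
    by (metis Im_complex_of_real Reals_cnj_iff complex_is_Real_iff)
qed

lemma hermitian_braket:
  assumes "hermitian A"
  shows "braket x (A *v y) = braket (A *v x) y"
proof -
  have A: "cnj (A $ j $ i) = A $ i $ j" for i j using assms unfolding hermitian_def by metis
  have "braket x (A *v y) = (\<Sum>i\<in>UNIV. \<Sum>j\<in>UNIV. cnj (x $ i) * (A $ i $ j * y $ j))"
    by (simp add: braket_def matrix_vector_mult_def sum_distrib_left)
  also have "\<dots> = (\<Sum>j\<in>UNIV. \<Sum>i\<in>UNIV. cnj (x $ i) * (A $ i $ j * y $ j))" by (rule sum.swap)
  also have "\<dots> = braket (A *v x) y"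
    unfolding braket_def matrix_vector_mult_def
    by (simp add: cnj_sum A sum_distrib_right sum_distrib_left mult_ac)
  finally show ?thesis .
qed

lemma hermitian_braket_real:
  assumes "hermitian A"
  shows "Im (braket x (A *v x)) = 0"
proof -
  have "cnj (braket x (A *v x)) = braket x (A *v x)"
    unfolding cnj_braket by (rule hermitian_braket[OF assms, symmetric])
  then show ?thesis by (metis Reals_cnj_iff complex_is_Real_iff)
qed

lemma hermitian_eigenvalue_real:
  assumes "hermitian A" "A *v x = c *s x" "norm x = 1"
  shows "Im c = 0"
  using hermitian_braket_real[OF assms(1), of x] assms(2,3)
  by (simp add: braket_scale_right braket_self)

lemma matrix_vector_mult_Xc:
  fixes y :: "'n::finite cvec"
  shows "Xc X \<psi> *v y = X *v y - braket \<psi> (X *v \<psi>) *s y"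
proof -
  have "(mat c *v y :: complex^'n) = c *s y" for c
    by (simp add: vec_eq_iff matrix_vector_mult_def mat_def if_distrib[of "\<lambda>x. x * _"] cong: if_cong)
  then show ?thesis by (simp add: Xc_def matrix_vector_mult_diff_rdistrib)
qed

lemma hermitian_Xc:
  assumes "hermitian X"
  shows "hermitian (Xc X \<psi>)"
proof -
  have "cnj (braket \<psi> (X *v \<psi>)) = braket \<psi> (X *v \<psi>)"
    using hermitian_braket_real[OF assms, of \<psi>] by (simp add: complex_eq_iff)
  moreover have "cnj (X $ j $ i) = X $ i $ j" for i j using assms unfolding hermitian_def by metis
  ultimately show ?thesis by (auto simp: hermitian_def Xc_def mat_def)
qed

lemma matrix_vector_mult_ham:
  "ham m \<alpha> H \<psi>f \<psi> *v y = H 0 *v y + (\<Sum>j\<in>{1..m}. ctrl (\<alpha> j) (H j) \<psi>f \<psi> *\<^sub>R (H j *v y))"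
proof -
  have sc: "(r *\<^sub>R A) *v y = r *\<^sub>R (A *v y)" for r A
    by (simp add: vec_eq_iff matrix_vector_mult_def scaleR_sum_right)
  have "(\<Sum>j\<in>J. c j *\<^sub>R H j) *v y = (\<Sum>j\<in>J. c j *\<^sub>R (H j *v y))" if "finite J" for J and c :: "nat \<Rightarrow> real"
    using that by (induction J rule: finite_induct) (auto simp: matrix_vector_mult_add_rdistrib sc)
  then show ?thesis by (simp add: ham_def matrix_vector_mult_add_rdistrib)
qed

lemma hermitian_ham:
  assumes "\<forall>j\<in>{0..m}. hermitian (H j)"
  shows "hermitian (ham m \<alpha> H \<psi>f \<psi>)"
proof -
  have c: "cnj (H k $ j $ i) = H k $ i $ j" if "k \<in> {0..m}" for k i j
    using assms that unfolding hermitian_def by metis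
  show ?thesis
    unfolding hermitian_def
  proof (intro allI)
    fix i j
    have "cnj ((\<Sum>k\<in>{1..m}. ctrl (\<alpha> k) (H k) \<psi>f \<psi> *\<^sub>R H k) $ j $ i)
        = (\<Sum>k\<in>{1..m}. ctrl (\<alpha> k) (H k) \<psi>f \<psi> *\<^sub>R H k) $ i $ j"
      unfolding sum_component cnj_sum by (intro sum.cong) (auto simp: c)
    then show "ham m \<alpha> H \<psi>f \<psi> $ i $ j = cnj (ham m \<alpha> H \<psi>f \<psi> $ j $ i)"
      by (simp add: ham_def c)
  qed
qed

text \<open>The Hamiltonian part only rotates and drops out. With \<open>y\<close> the centred
  observable applied to \<open>\<psi>\<close>, the measurement drift contributes -2 \<kappa> |y|^2
  and the squared diffusion the opposite. The identity holds off the sphere too, as required before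
  invariance is known.\<close>

lemma drift_diffusion_norm_balance:
  assumes "hermitian X" "\<forall>j\<in>{0..m}. hermitian (H j)" "0 < \<kappa>"
  shows "2 * (\<psi> \<bullet> drift hbar \<kappa> X m \<alpha> H \<psi>f \<psi>) + diffusion \<kappa> X \<psi> \<bullet> diffusion \<kappa> X \<psi> = 0"
proof -
  let ?y = "Xc X \<psi> *v \<psi>"
  have "braket \<psi> (Xc X \<psi> *v ?y) = complex_of_real ((norm ?y)\<^sup>2)"
    using hermitian_braket[OF hermitian_Xc[OF assms(1)], where x=\<psi> and y="?y"] by (simp only: braket_self)
  moreover have "Im (braket \<psi> (ham m \<alpha> H \<psi>f \<psi> *v \<psi>)) = 0"
    by (rule hermitian_braket_real[OF hermitian_ham[OF assms(2)]])
  ultimately have "\<psi> \<bullet> drift hbar \<kappa> X m \<alpha> H \<psi>f \<psi> = - \<kappa> * (norm ?y)\<^sup>2"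
    unfolding inner_eq_Re_braket drift_def braket_diff_right braket_scale_right
    by (simp add: Re_divide_of_real)
  moreover have "diffusion \<kappa> X \<psi> \<bullet> diffusion \<kappa> X \<psi> = 2 * \<kappa> * (norm ?y)\<^sup>2"
    using assms(3) by (simp add: diffusion_def power2_norm_eq_inner)
  ultimately show ?thesis by simp
qed

lemma inner_diffusion:
  "\<psi> \<bullet> diffusion \<kappa> X \<psi> = sqrt (2 * \<kappa>) * Re (braket \<psi> (X *v \<psi>)) * (1 - (norm \<psi>)\<^sup>2)"
  unfolding diffusion_def inner_scaleR_right inner_eq_Re_braket matrix_vector_mult_Xc
  by (simp add: braket_scaleR_right braket_diff_right braket_scale_right braket_self right_diff_distrib)

section \<open>Overlap with the target state\<close>

lemma inner_imaginary: "x \<bullet> (\<i> *s y) = Im (braket y x)"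
proof -
  have "x \<bullet> (\<i> *s y) = Re (\<i> * braket x y)" by (simp add: inner_eq_Re_braket braket_scale_right)
  also have "\<dots> = - Im (braket x y)" by simp
  also have "\<dots> = Im (cnj (braket x y))" by simp
  finally show ?thesis by (simp only: cnj_braket)
qed

lemma inner_real: "x \<bullet> y = Re (braket y x)"
  by (subst inner_commute) (rule inner_eq_Re_braket)

text \<open>A complex overlap is a pair of real coordinates, along \<open>y\<close> and along
  \<open>\<i> *s y\<close>; this makes its squared modulus a real quadratic form, within reach of
  the real Ito formula.\<close>

lemma overlap_square: "(x \<bullet> y)\<^sup>2 + (x \<bullet> (\<i> *s y))\<^sup>2 = (cmod (braket y x))\<^sup>2"
  by (simp add: inner_imaginary inner_real[of x y] cmod_power2)

text \<open>The polarised companion, which turns the two drift terms of the quadratic Ito formula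
  into one complex expression.\<close>

lemma overlap_polar:
  "(x \<bullet> e) * (z \<bullet> e) + (x \<bullet> (\<i> *s e)) * (z \<bullet> (\<i> *s e)) = Re (cnj (braket e x) * braket e z)"
  by (simp add: inner_imaginary inner_real[of _ e])

lemma cmod_cis_Arg: "complex_of_real (cmod z) * cis (Arg z) = z"
  by (cases "z = 0") (simp_all add: cis_Arg sgn_div_norm scaleR_conv_of_real)

text \<open>The phase in the control is that of \<open>braket \<psi> \<psi>f\<close>, the conjugate
  of the overlap. Hence the second factor is the modulus of the overlap times the very imaginary
  part occurring in \<open>ctrl\<close>, and the product is a nonnegative multiple of a
  square.\<close>

lemma feedback_drift_nonneg:
  assumes "\<alpha> > 0"
  shows "0 \<le> ctrl \<alpha> Hj \<psi>f \<psi> * Im (cnj (braket \<psi>f \<psi>) * braket \<psi>f (Hj *v \<psi>))"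
proof -
  let ?z = "braket \<psi> \<psi>f" and ?B = "braket \<psi>f (Hj *v \<psi>)"
  have "cnj (braket \<psi>f \<psi>) * ?B = complex_of_real (cmod ?z) * (cis (Arg ?z) * ?B)"
    unfolding cnj_braket mult.assoc[symmetric] cmod_cis_Arg ..
  moreover have "Im (complex_of_real r * w) = r * Im w" for r w by simp
  ultimately have "Im (cnj (braket \<psi>f \<psi>) * ?B) = cmod ?z * Im (cis (Arg ?z) * ?B)" by (simp only:)
  then have "ctrl \<alpha> Hj \<psi>f \<psi> * Im (cnj (braket \<psi>f \<psi>) * ?B) = \<alpha> * cmod ?z * (Im (cis (Arg ?z) * ?B))\<^sup>2"
    unfolding ctrl_def by (simp only: power2_eq_square mult_ac)
  then show ?thesis using assms by simp
qed

text \<open>Self-adjointness moves the operators onto the eigenvector \<open>\<psi>f\<close>, so the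
  centred observable acts on the overlap \<open>q\<close> as multiplication by \<open>c\<close>. The
  Hamiltonian contributes 2 Im (cnj q * h) / hbar, in which only the feedback terms survive.\<close>

lemma overlap_drift_nonneg:
  fixes \<psi> \<psi>f :: "'n::finite cvec"
  assumes X: "hermitian X" and H: "\<forall>j\<in>{0..m}. hermitian (H j)" and pos: "0 < hbar" "0 < \<kappa>"
    and \<alpha>: "\<forall>j\<in>{1..m}. 0 < \<alpha> j" and unit: "norm \<psi>f = 1"
    and H0: "H 0 *v \<psi>f = lamH *s \<psi>f" and Xf: "X *v \<psi>f = lamX *s \<psi>f"
  defines "b \<equiv> drift hbar \<kappa> X m \<alpha> H \<psi>f \<psi>" and "s \<equiv> diffusion \<kappa> X \<psi>"
  shows "0 \<le> (2 * (\<psi> \<bullet> \<psi>f) * (b \<bullet> \<psi>f) + (s \<bullet> \<psi>f)\<^sup>2)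
    + (2 * (\<psi> \<bullet> (\<i> *s \<psi>f)) * (b \<bullet> (\<i> *s \<psi>f)) + (s \<bullet> (\<i> *s \<psi>f))\<^sup>2)"
proof -
  define q where "q = braket \<psi>f \<psi>"
  define c where "c = cnj lamX - braket \<psi> (X *v \<psi>)"
  define h where "h = braket \<psi>f (ham m \<alpha> H \<psi>f \<psi> *v \<psi>)"
  have Xc: "braket \<psi>f (Xc X \<psi> *v y) = c * braket \<psi>f y" for y
    unfolding matrix_vector_mult_Xc braket_diff_right braket_scale_right
    using hermitian_braket[OF X, of \<psi>f y] by (simp add: Xf braket_scale_left c_def left_diff_distrib)
  have s: "braket \<psi>f s = sqrt (2 * \<kappa>) *\<^sub>R (c * q)"
    unfolding s_def diffusion_def braket_scaleR_right Xc q_def ..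
  have b: "braket \<psi>f b = (- \<i> / complex_of_real hbar) * h - complex_of_real \<kappa> * (c * (c * q))"
    unfolding b_def drift_def braket_diff_right braket_scale_right Xc h_def q_def ..
  have hq: "0 \<le> Im (cnj q * h)"
  proof -
    have "Im lamH = 0" using hermitian_eigenvalue_real[OF _ H0 unit] H by simp
    have "braket \<psi>f (H 0 *v \<psi>) = cnj lamH * q"
      using H by (simp add: hermitian_braket H0 braket_scale_left q_def)
    then have "cnj q * braket \<psi>f (H 0 *v \<psi>) = cnj lamH * complex_of_real ((cmod q)\<^sup>2)"
      by (simp only: complex_norm_square mult_ac)
    then have 0: "Im (cnj q * braket \<psi>f (H 0 *v \<psi>)) = 0"
      using \<open>Im lamH = 0\<close> by simp
    have "h = braket \<psi>f (H 0 *v \<psi>) + (\<Sum>j\<in>{1..m}. ctrl (\<alpha> j) (H j) \<psi>f \<psi> *\<^sub>R braket \<psi>f (H j *v \<psi>))"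
      by (simp add: h_def matrix_vector_mult_ham braket_add_right braket_sum_right braket_scaleR_right)
    then have "cnj q * h = cnj q * braket \<psi>f (H 0 *v \<psi>)
        + (\<Sum>j\<in>{1..m}. ctrl (\<alpha> j) (H j) \<psi>f \<psi> *\<^sub>R (cnj q * braket \<psi>f (H j *v \<psi>)))"
      by (simp add: distrib_left sum_distrib_left)
    then have "Im (cnj q * h) = (\<Sum>j\<in>{1..m}. ctrl (\<alpha> j) (H j) \<psi>f \<psi> * Im (cnj q * braket \<psi>f (H j *v \<psi>)))"
      using 0 by (simp only: plus_complex.sel Im_sum scaleR_complex.sel add_0_left)
    also have "\<dots> \<ge> 0"
      using \<alpha> unfolding q_def by (intro sum_nonneg feedback_drift_nonneg) auto
    finally show ?thesis .
  qed
  have "cnj q * ((- \<i> / complex_of_real hbar) * h) = (- \<i> / complex_of_real hbar) * (cnj q * h)"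
    by (simp only: mult_ac)
  then have "Re (cnj q * ((- \<i> / complex_of_real hbar) * h)) = Im (cnj q * h) / hbar"
    by (simp only:) (use pos in \<open>simp add: Re_divide_of_real field_simps\<close>)
  moreover have "cnj q * (complex_of_real \<kappa> * (c * (c * q))) = complex_of_real (\<kappa> * (cmod q)\<^sup>2) * c\<^sup>2"
    by (simp only: of_real_mult complex_norm_square power2_eq_square[of c] mult_ac)
  then have "Re (cnj q * (complex_of_real \<kappa> * (c * (c * q)))) = \<kappa> * (cmod q)\<^sup>2 * Re (c\<^sup>2)"
    by (simp only: Re_complex_of_real times_complex.sel Im_complex_of_real)
  ultimately have Re1: "Re (cnj q * braket \<psi>f b) = Im (cnj q * h) / hbar - \<kappa> * (cmod q)\<^sup>2 * Re (c\<^sup>2)"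
    unfolding b right_diff_distrib by simp
  have "(cmod (braket \<psi>f s))\<^sup>2 = 2 * \<kappa> * (cmod c)\<^sup>2 * (cmod q)\<^sup>2"
    using pos unfolding s by (simp add: norm_mult power_mult_distrib)
  moreover have "(2 * (\<psi> \<bullet> \<psi>f) * (b \<bullet> \<psi>f) + (s \<bullet> \<psi>f)\<^sup>2)
      + (2 * (\<psi> \<bullet> (\<i> *s \<psi>f)) * (b \<bullet> (\<i> *s \<psi>f)) + (s \<bullet> (\<i> *s \<psi>f))\<^sup>2)
    = 2 * Re (cnj q * braket \<psi>f b) + (cmod (braket \<psi>f s))\<^sup>2"
    using overlap_polar[of \<psi> \<psi>f b] overlap_square[of s \<psi>f] by (simp add: q_def)
  ultimately have "(2 * (\<psi> \<bullet> \<psi>f) * (b \<bullet> \<psi>f) + (s \<bullet> \<psi>f)\<^sup>2)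
      + (2 * (\<psi> \<bullet> (\<i> *s \<psi>f)) * (b \<bullet> (\<i> *s \<psi>f)) + (s \<bullet> (\<i> *s \<psi>f))\<^sup>2)
    = 2 * (Im (cnj q * h) / hbar) + 2 * \<kappa> * (cmod q)\<^sup>2 * ((cmod c)\<^sup>2 - Re (c\<^sup>2))"
    unfolding Re1 by (simp add: algebra_simps)
  \<comment> \<open>The measurement drift gives -2 \<kappa> |q|^2 Re (c^2) and the diffusion 2
    \<kappa> |q|^2 |c|^2: together nonnegative for any complex \<open>c\<close>, and zero for real
    \<open>c\<close>.\<close>
  also have "\<dots> \<ge> 0"
  proof -
    have "Re (c\<^sup>2) \<le> cmod (c\<^sup>2)" by (rule complex_Re_le_cmod)
    then have "0 \<le> (cmod c)\<^sup>2 - Re (c\<^sup>2)" by (simp add: norm_power)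
    then show ?thesis using hq pos by (intro add_nonneg_nonneg mult_nonneg_nonneg) auto
  qed
  finally show ?thesis .
qed

text \<open>Cauchy-Schwarz for the Hermitian form, read off from the squared length of the component
  of \<open>\<psi>\<close> orthogonal to \<open>\<psi>f\<close>.\<close>

lemma overlap_le_norm:
  assumes "norm \<psi>f = 1"
  shows "(cmod (braket \<psi>f \<psi>))\<^sup>2 \<le> (norm \<psi>)\<^sup>2"
proof -
  let ?q = "braket \<psi>f \<psi>"
  have "0 \<le> (\<psi> - ?q *s \<psi>f) \<bullet> (\<psi> - ?q *s \<psi>f)" by simp
  also have "\<dots> = Re (braket \<psi> \<psi>) - Re (?q * cnj ?q) - Re (cnj ?q * ?q) + Re (?q * cnj ?q * braket \<psi>f \<psi>f)"
    unfolding inner_diff_left inner_diff_right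
    unfolding inner_eq_Re_braket braket_scale_left braket_scale_right
    by (simp add: cnj_braket[of \<psi>f \<psi>, symmetric] algebra_simps)
  also have "\<dots> = (norm \<psi>)\<^sup>2 - (cmod ?q)\<^sup>2"
    using assms unfolding cmod_power2 by (simp add: braket_self power2_eq_square)
  finally show ?thesis by simp
qed

lemma dist_class_le_overlap:
  assumes "norm \<psi>f = 1" "norm \<psi> = 1"
  shows "(dist_class \<psi> \<psi>f)\<^sup>2 \<le> 2 * (1 - (cmod (braket \<psi>f \<psi>))\<^sup>2)"
proof -
  let ?q = "braket \<psi>f \<psi>"
  \<comment> \<open>Rotating \<open>\<psi>f\<close> by the phase of the overlap makes the inner
    product with \<open>\<psi>\<close> real and equal to \<open>cmod ?q\<close>, which is the best
    phase. The modulus is at most 1, so passing from \<open>cmod ?q\<close> to its square weakens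
    the bound.\<close>
  let ?e = "cis (Arg ?q) *s \<psi>f"
  have nonneg: "0 \<le> dist_class \<psi> \<psi>f" unfolding dist_class_def by (rule cINF_greatest) auto
  have le: "dist_class \<psi> \<psi>f \<le> norm (\<psi> - ?e)"
    unfolding dist_class_def by (rule cINF_lower) (auto intro: bdd_belowI[of _ 0])
  have "?e \<bullet> ?e = Re (cnj (cis (Arg ?q)) * cis (Arg ?q) * braket \<psi>f \<psi>f)"
    by (simp only: inner_eq_Re_braket braket_scale_left braket_scale_right mult_ac)
  then have e: "?e \<bullet> ?e = 1"
    using assms(1) by (simp only: braket_self cis_cnj cis_mult) simp
  have "?e \<bullet> \<psi> = Re (cis (- Arg ?q) * ?q)"
    by (simp add: inner_eq_Re_braket braket_scale_left cis_cnj)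
  also have "\<dots> = Re (cis (- Arg ?q) * (complex_of_real (cmod ?q) * cis (Arg ?q)))"
    by (simp only: cmod_cis_Arg)
  also have "cis (- Arg ?q) * (complex_of_real (cmod ?q) * cis (Arg ?q)) = complex_of_real (cmod ?q)"
    by (simp add: cis_mult mult.left_commute)
  finally have "?e \<bullet> \<psi> = cmod ?q" by simp
  then have "(norm (\<psi> - ?e))\<^sup>2 = 2 - 2 * cmod ?q"
    using assms(2) e
    by (simp add: power2_norm_eq_inner inner_diff_left inner_diff_right inner_commute norm_eq_1)
  moreover have "(cmod ?q)\<^sup>2 \<le> cmod ?q"
  proof -
    have "(cmod ?q)\<^sup>2 \<le> 1\<^sup>2" using overlap_le_norm[OF assms(1), of \<psi>] assms(2) by simp
    then have "cmod ?q \<le> 1" by (rule power2_le_imp_le) simp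
    then show ?thesis using mult_left_le_one_le[of "cmod ?q" "cmod ?q"] by (simp add: power2_eq_square)
  qed
  ultimately show ?thesis using power_mono[OF le nonneg, of 2] by simp
qed

text \<open>Stands in for continuity of the drift: along bounded paths the drift stays bounded even
  where the feedback jumps.\<close>

definition bounded_on_balls :: "('a::real_normed_vector \<Rightarrow> 'b::real_normed_vector) \<Rightarrow> bool" where
  "bounded_on_balls f \<longleftrightarrow> (\<forall>K. \<exists>C. \<forall>y. norm y \<le> K \<longrightarrow> norm (f y) \<le> C)"

lemma bounded_on_balls_continuous:
  fixes f :: "'a::euclidean_space \<Rightarrow> 'b::real_normed_vector"
  assumes "continuous_on UNIV f"
  shows "bounded_on_balls f"
  unfolding bounded_on_balls_def
proof
  fix K
  have "compact (f ` cball 0 K)"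
    using assms by (intro compact_continuous_image) (auto intro: continuous_on_subset)
  then have "bounded (f ` cball 0 K)" by (rule compact_imp_bounded)
  then obtain C where "\<forall>x\<in>cball 0 K. norm (f x) \<le> C" by (auto simp: bounded_iff)
  then show "\<exists>C. \<forall>y. norm y \<le> K \<longrightarrow> norm (f y) \<le> C" by (intro exI[of _ C]) auto
qed

lemma bounded_on_balls_add:
  assumes "bounded_on_balls f" "bounded_on_balls g"
  shows "bounded_on_balls (\<lambda>y. f y + g y)"
  unfolding bounded_on_balls_def
proof
  fix K
  obtain C D where "\<forall>y. norm y \<le> K \<longrightarrow> norm (f y) \<le> C" "\<forall>y. norm y \<le> K \<longrightarrow> norm (g y) \<le> D"
    using assms unfolding bounded_on_balls_def by meson
  then have "norm (f y + g y) \<le> C + D" if "norm y \<le> K" for y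
    using that by (intro order_trans[OF norm_triangle_ineq] add_mono) auto
  then show "\<exists>C. \<forall>y. norm y \<le> K \<longrightarrow> norm (f y + g y) \<le> C" by blast
qed

lemma bounded_on_balls_scaleR:
  assumes "bounded_on_balls f" "bounded_on_balls g"
  shows "bounded_on_balls (\<lambda>y. f y *\<^sub>R g y)"
  unfolding bounded_on_balls_def
proof
  fix K
  obtain C D where CD: "\<forall>y. norm y \<le> K \<longrightarrow> norm (f y) \<le> C" "\<forall>y. norm y \<le> K \<longrightarrow> norm (g y) \<le> D"
    using assms unfolding bounded_on_balls_def by meson
  have "norm (f y *\<^sub>R g y) \<le> C * D" if "norm y \<le> K" for y
  proof -
    have "norm (f y) \<le> C" "norm (g y) \<le> D" using CD that by auto
    moreover from this(1) have "0 \<le> C" using norm_ge_zero order_trans by blast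
    ultimately show ?thesis by (simp add: mult_mono)
  qed
  then show "\<exists>C. \<forall>y. norm y \<le> K \<longrightarrow> norm (f y *\<^sub>R g y) \<le> C" by blast
qed

lemma bounded_on_balls_sum:
  assumes "finite J" "\<And>j. j \<in> J \<Longrightarrow> bounded_on_balls (f j)"
  shows "bounded_on_balls (\<lambda>y. \<Sum>j\<in>J. f j y)"
  using assms
proof (induction J rule: finite_induct)
  case empty
  then show ?case by (auto simp: bounded_on_balls_def)
next
  case (insert j J)
  then show ?case by (auto intro!: bounded_on_balls_add)
qed

lemma bounded_on_balls_dominated:
  assumes "bounded_on_balls g" "\<And>y. norm (f y) \<le> norm (g y)"
  shows "bounded_on_balls f"
  using assms unfolding bounded_on_balls_def by (meson order_trans)

section \<open>Continuity, measurability and local bounds of the coefficients\<close>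

lemma continuous_on_matrix_vector_mult [continuous_intros]:
  "continuous_on S f \<Longrightarrow> continuous_on S (\<lambda>x. (A :: 'n::finite cmat) *v f x)"
  unfolding matrix_vector_mult_def by (intro continuous_intros) auto

lemma continuous_on_vector_smult [continuous_intros]:
  fixes g :: "'a::topological_space \<Rightarrow> 'n::finite cvec"
  shows "continuous_on S f \<Longrightarrow> continuous_on S g \<Longrightarrow> continuous_on S (\<lambda>x. f x *s g x)"
  unfolding vector_scalar_mult_def by (intro continuous_intros) auto

lemma continuous_on_braket [continuous_intros]:
  "continuous_on S f \<Longrightarrow> continuous_on S g \<Longrightarrow> continuous_on S (\<lambda>x. braket (f x) (g x))"
  unfolding braket_def by (intro continuous_intros) auto

lemma continuous_on_diffusion: "continuous_on S (diffusion \<kappa> X)"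
  unfolding diffusion_def[abs_def] matrix_vector_mult_Xc by (intro continuous_intros)

text \<open>Separates the real feedback scalars, the only possibly discontinuous ingredients, from
  vector fields that are continuous in the state.\<close>

lemma drift_decomposition:
  fixes \<psi> :: "'n::finite cvec"
  shows "drift hbar \<kappa> X m \<alpha> H \<psi>f \<psi> =
    ((- \<i> / complex_of_real hbar) *s (H 0 *v \<psi>) - complex_of_real \<kappa> *s (Xc X \<psi> *v (Xc X \<psi> *v \<psi>)))
    + (\<Sum>j\<in>{1..m}. ctrl (\<alpha> j) (H j) \<psi>f \<psi> *\<^sub>R ((- \<i> / complex_of_real hbar) *s (H j *v \<psi>)))"
proof -
  have "c *s (\<Sum>j\<in>J. r j *\<^sub>R (v j :: complex^'n)) = (\<Sum>j\<in>J. r j *\<^sub>R (c *s v j))" for c J r and v :: "nat \<Rightarrow> _"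
    by (simp add: vec_eq_iff sum_component sum_distrib_left)
  then show ?thesis
    unfolding drift_def matrix_vector_mult_ham vector_add_ldistrib by simp
qed

lemma ctrl_measurable: "ctrl \<alpha> Hj \<psi>f \<in> borel_measurable borel"
proof -
  \<comment> \<open>By convention \<open>Arg 0 = 0\<close>, so the phase factor is 1 at the origin
    and the normalised number elsewhere: a Borel function whose only discontinuity is at 0.\<close>
  have "cis (Arg z) = (if z = 0 then 1 else z /\<^sub>R cmod z)" for z
    by (auto simp: cis_Arg sgn_div_norm Arg_zero)
  then have "(\<lambda>z. cis (Arg z)) \<in> borel_measurable borel" by simp
  moreover have "(\<lambda>\<psi>. braket \<psi> \<psi>f) \<in> borel_measurable borel" "(\<lambda>\<psi>. braket \<psi>f (Hj *v \<psi>)) \<in> borel_measurable borel"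
    by (intro borel_measurable_continuous_onI continuous_intros)+
  ultimately show ?thesis unfolding ctrl_def[abs_def] by measurable
qed

lemma ctrl_bounded_on_balls: "bounded_on_balls (ctrl \<alpha> Hj \<psi>f)"
proof (rule bounded_on_balls_dominated)
  show "bounded_on_balls (\<lambda>\<psi>. \<alpha> *\<^sub>R braket \<psi>f (Hj *v \<psi>))"
    by (intro bounded_on_balls_continuous continuous_intros)
  fix \<psi>
  have "\<bar>Im (cis (Arg (braket \<psi> \<psi>f)) * braket \<psi>f (Hj *v \<psi>))\<bar> \<le> cmod (cis (Arg (braket \<psi> \<psi>f)) * braket \<psi>f (Hj *v \<psi>))"
    by (rule abs_Im_le_cmod)
  also have "\<dots> = cmod (braket \<psi>f (Hj *v \<psi>))" by (simp add: norm_mult)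
  finally show "norm (ctrl \<alpha> Hj \<psi>f \<psi>) \<le> norm (\<alpha> *\<^sub>R braket \<psi>f (Hj *v \<psi>))"
    by (simp add: ctrl_def abs_mult mult_left_mono)
qed

lemma drift_measurable: "drift hbar \<kappa> X m \<alpha> H \<psi>f \<in> borel_measurable borel"
  unfolding drift_decomposition[abs_def] matrix_vector_mult_Xc
  by (intro borel_measurable_add borel_measurable_sum borel_measurable_scaleR ctrl_measurable
      borel_measurable_continuous_onI continuous_intros)

lemma drift_bounded_on_balls: "bounded_on_balls (drift hbar \<kappa> X m \<alpha> H \<psi>f)"
  unfolding drift_decomposition[abs_def] matrix_vector_mult_Xc
  by (intro bounded_on_balls_add bounded_on_balls_sum bounded_on_balls_scaleR ctrl_bounded_on_balls
      bounded_on_balls_continuous continuous_intros) auto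

section \<open>Ito's formula for quadratic forms of a solution\<close>

lemma locally_bounded_borel_path:
  fixes Y :: "real \<Rightarrow> 'b::euclidean_space" and c :: "'b \<Rightarrow> real"
  assumes Y: "continuous_on UNIV Y" and c: "c \<in> borel_measurable borel" "bounded_on_balls c"
  shows "locally_bounded_borel (\<lambda>r. c (Y r))"
  unfolding locally_bounded_borel_def
proof (intro conjI allI)
  show "(\<lambda>r. c (Y r)) \<in> borel_measurable borel"
    using borel_measurable_continuous_onI[OF Y] c(1) by (rule measurable_compose)
  fix T
  have "compact (Y ` {0..T})"
    using Y by (intro compact_continuous_image) (auto intro: continuous_on_subset)
  then have "bounded (Y ` {0..T})" by (rule compact_imp_bounded)
  then obtain K where K: "\<forall>r\<in>{0..T}. norm (Y r) \<le> K" by (auto simp: bounded_iff)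
  obtain C where "\<forall>y. norm y \<le> K \<longrightarrow> norm (c y) \<le> C" using c(2) unfolding bounded_on_balls_def by blast
  with K show "\<exists>C. \<forall>r\<in>{0..T}. \<bar>c (Y r)\<bar> \<le> C" by auto
qed

text \<open>Bounds on balls of integer radius are picked first. Composing them with the rounded-up
  path bound goes through the natural numbers, so the result is measurable however the bounds were
  picked.\<close>

lemma path_bound_measurable:
  fixes Y :: "real \<Rightarrow> 'w \<Rightarrow> 'b::euclidean_space" and c :: "'b \<Rightarrow> real"
  assumes Y: "\<And>t. Y t \<in> borel_measurable M" "\<And>\<omega>. \<omega> \<in> space M \<Longrightarrow> continuous_on UNIV (\<lambda>t. Y t \<omega>)"
    and c: "bounded_on_balls c"
  shows "\<exists>C\<in>borel_measurable M. \<forall>\<omega>\<in>space M. \<forall>r\<in>{0..T}. \<bar>c (Y r \<omega>)\<bar> \<le> C \<omega>"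
proof -
  obtain N :: "'w \<Rightarrow> real" where N [measurable]: "N \<in> borel_measurable M"
    and Nb: "\<And>\<omega> r. \<omega> \<in> space M \<Longrightarrow> r \<in> {0..T} \<Longrightarrow> norm (Y r \<omega>) \<le> N \<omega>"
    using path_norm_bound_measurable[OF Y] by blast
  have "\<forall>k::nat. \<exists>C. \<forall>y. norm y \<le> real k \<longrightarrow> norm (c y) \<le> C" using c unfolding bounded_on_balls_def by blast
  then obtain B where B: "\<And>k y. norm y \<le> real k \<Longrightarrow> norm (c y) \<le> B k" by metis
  show ?thesis
  proof (intro bexI ballI)
    have "(\<lambda>\<omega>. nat \<lceil>N \<omega>\<rceil>) \<in> measurable M (count_space UNIV)" by measurable
    then show "(\<lambda>\<omega>. B (nat \<lceil>N \<omega>\<rceil>)) \<in> borel_measurable M"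
      by (rule measurable_compose) simp
    fix \<omega> r assume "\<omega> \<in> space M" "r \<in> {0..T}"
    then have "norm (Y r \<omega>) \<le> N \<omega>" by (rule Nb)
    also have "N \<omega> \<le> real (nat \<lceil>N \<omega>\<rceil>)" by linarith
    finally show "\<bar>c (Y r \<omega>)\<bar> \<le> B (nat \<lceil>N \<omega>\<rceil>)" using B by fastforce
  qed
qed

lemma bounded_on_balls_inner:
  assumes "bounded_on_balls f"
  shows "bounded_on_balls (\<lambda>y. f y \<bullet> v)"
  unfolding bounded_on_balls_def
proof
  fix K
  obtain C where C: "\<forall>y. norm y \<le> K \<longrightarrow> norm (f y) \<le> C" using assms unfolding bounded_on_balls_def by blast
  have "norm (f y \<bullet> v) \<le> C * norm v" if "norm y \<le> K" for y
    using C that by (intro order_trans[OF Cauchy_Schwarz_ineq2[unfolded real_norm_def[symmetric]]] mult_right_mono) auto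
  then show "\<exists>C. \<forall>y. norm y \<le> K \<longrightarrow> norm (f y \<bullet> v) \<le> C" by blast
qed

context brownian
begin

lemma ito_sum_finite:
  assumes "finite J" "\<And>j. j \<in> J \<Longrightarrow> ito (f j) (I j)"
  shows "ito (\<lambda>t \<omega>. \<Sum>j\<in>J. f j t \<omega>) (\<lambda>t \<omega>. \<Sum>j\<in>J. I j t \<omega>)"
  unfolding ito_def
proof (intro allI impI)
  fix h :: real and a :: nat assume "0 < h"
  then have "vanishes (\<lambda>p \<omega>. \<Sum>j\<in>J. rsum (h / 2 ^ p) (f j) (a * 2 ^ p) \<omega> - I j (real a * h) \<omega>)"
    using assms by (intro vanishes_sum) (auto simp: ito_def)
  moreover have "rsum \<eta> (\<lambda>t \<omega>. \<Sum>j\<in>J. f j t \<omega>) n \<omega> = (\<Sum>j\<in>J. rsum \<eta> (f j) n \<omega>)" for \<eta> n \<omega>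
    unfolding rsum_def sum_distrib_right by (rule sum.swap)
  ultimately show "vanishes (\<lambda>p \<omega>. rsum (h / 2 ^ p) (\<lambda>t \<omega>. \<Sum>j\<in>J. f j t \<omega>) (a * 2 ^ p) \<omega> - (\<Sum>j\<in>J. I j (real a * h) \<omega>))"
    by (simp add: sum_subtractf)
qed

lemma ito_cong_AE:
  assumes "ito f I" and g: "\<And>t. g t \<in> borel_measurable M" and J: "\<And>t. 0 \<le> t \<Longrightarrow> J t \<in> borel_measurable M"
    and AE: "\<And>t. 0 \<le> t \<Longrightarrow> AE \<omega> in M. g t \<omega> = f t \<omega>" "\<And>t. 0 \<le> t \<Longrightarrow> AE \<omega> in M. J t \<omega> = I t \<omega>"
  shows "ito g J"
  unfolding ito_def
proof (intro allI impI)
  fix h :: real and a :: nat assume h: "0 < h"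
  show "vanishes (\<lambda>p \<omega>. rsum (h / 2 ^ p) g (a * 2 ^ p) \<omega> - J (real a * h) \<omega>)"
  proof (rule vanishes_cong_AE)
    show "vanishes (\<lambda>p \<omega>. rsum (h / 2 ^ p) f (a * 2 ^ p) \<omega> - I (real a * h) \<omega>)"
      using assms(1) h by (simp add: ito_def)
    show "(\<lambda>\<omega>. rsum (h / 2 ^ p) g (a * 2 ^ p) \<omega> - J (real a * h) \<omega>) \<in> borel_measurable M" for p
      using h by (intro borel_measurable_diff rsum_measurable g J) auto
    show "AE \<omega> in M. rsum (h / 2 ^ p) g (a * 2 ^ p) \<omega> - J (real a * h) \<omega>
        = rsum (h / 2 ^ p) f (a * 2 ^ p) \<omega> - I (real a * h) \<omega>" for p
    proof -
      have "AE \<omega> in M. \<forall>k. g (real k * (h / 2 ^ p)) \<omega> = f (real k * (h / 2 ^ p)) \<omega>"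
        using h by (intro AE_all_countable[THEN iffD2] allI AE(1)) auto
      moreover have "AE \<omega> in M. J (real a * h) \<omega> = I (real a * h) \<omega>" using h by (intro AE(2)) auto
      ultimately show ?thesis by eventually_elim (simp add: rsum_def)
    qed
  qed
qed

end

text \<open>The vector equation is recorded through its projections to every direction
  \<open>v\<close>, the form consumed by the scalar Ito formula. Initial value and continuity hold
  for every outcome.\<close>

locale ito_diffusion = brownian M F W for M :: "'w measure" and F W +
  fixes Y :: "real \<Rightarrow> 'w \<Rightarrow> 'b::euclidean_space" and b s :: "'b \<Rightarrow> 'b" and y0 :: 'b
  assumes YF: "\<And>t. 0 \<le> t \<Longrightarrow> Y t \<in> borel_measurable (F t)" and YM: "\<And>t. Y t \<in> borel_measurable M"
    and Yc: "\<And>\<omega>. \<omega> \<in> space M \<Longrightarrow> continuous_on UNIV (\<lambda>t. Y t \<omega>)"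
    and Y0: "\<And>\<omega>. \<omega> \<in> space M \<Longrightarrow> Y 0 \<omega> = y0"
    and b: "b \<in> borel_measurable borel" "bounded_on_balls b" and s: "continuous_on UNIV s"
    and ito: "\<And>v. ito (\<lambda>t \<omega>. s (Y t \<omega>) \<bullet> v)
      (\<lambda>t \<omega>. Y t \<omega> \<bullet> v - Y 0 \<omega> \<bullet> v - integral {0..t} (\<lambda>r. b (Y r \<omega>) \<bullet> v))"
begin

text \<open>Applied with the standard basis it describes the squared norm, with the two real
  directions of \<open>\<psi>f\<close> the squared overlap; \<open>c\<close> is the resulting drift.
  The scalar formula is summed over \<open>B\<close>.\<close>

lemma ito_quadratic:
  assumes B: "finite B"
  defines "c \<equiv> \<lambda>y. \<Sum>v\<in>B. 2 * (y \<bullet> v) * (b y \<bullet> v) + (s y \<bullet> v)\<^sup>2"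
  shows "ito (\<lambda>t \<omega>. \<Sum>v\<in>B. 2 * (Y t \<omega> \<bullet> v) * (s (Y t \<omega>) \<bullet> v))
    (\<lambda>t \<omega>. (\<Sum>v\<in>B. (Y t \<omega> \<bullet> v)\<^sup>2) - (\<Sum>v\<in>B. (y0 \<bullet> v)\<^sup>2) - integral {0..t} (\<lambda>r. c (Y r \<omega>)))"
    and "\<And>\<omega>. \<omega> \<in> space M \<Longrightarrow> locally_bounded_borel (\<lambda>r. c (Y r \<omega>))"
    and "\<And>t. 0 \<le> t \<Longrightarrow> (\<lambda>\<omega>. integral {0..t} (\<lambda>r. c (Y r \<omega>))) \<in> borel_measurable M"
proof -
  have sm: "s \<in> borel_measurable borel" using s by (rule borel_measurable_continuous_onI)
  have spaceF: "\<omega> \<in> space (F t) \<longleftrightarrow> \<omega> \<in> space M" for \<omega> t by (simp add: space_F)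
  define cv where "cv v y = 2 * (y \<bullet> v) * (b y \<bullet> v) + (s y \<bullet> v)\<^sup>2" for v y
  have cvm: "cv v \<in> borel_measurable borel" for v
    unfolding cv_def[abs_def] using b(1) sm by measurable
  have bv: "(\<lambda>y. b y \<bullet> v) \<in> borel_measurable borel" "bounded_on_balls (\<lambda>y. b y \<bullet> v)" for v
    using b by (auto intro: bounded_on_balls_inner)
  have cvb: "bounded_on_balls (cv v)" for v
  proof -
    have "bounded_on_balls (\<lambda>y. (2 * (y \<bullet> v)) *\<^sub>R (b y \<bullet> v))" "bounded_on_balls (\<lambda>y. (s y \<bullet> v)\<^sup>2)"
      using s by (intro bounded_on_balls_scaleR bounded_on_balls_continuous continuous_intros bv
          continuous_on_compose2[OF s]; auto)+
    from bounded_on_balls_add[OF this] show ?thesis by (simp add: cv_def[abs_def])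
  qed
  have cm: "c \<in> borel_measurable borel" unfolding c_def cv_def[symmetric] using cvm by measurable
  have cb: "bounded_on_balls c" unfolding c_def cv_def[symmetric] using B cvb by (rule bounded_on_balls_sum)
  show lb: "locally_bounded_borel (\<lambda>r. c (Y r \<omega>))" if "\<omega> \<in> space M" for \<omega>
    by (rule locally_bounded_borel_path[OF Yc[OF that] cm cb])
  show "(\<lambda>\<omega>. integral {0..t} (\<lambda>r. c (Y r \<omega>))) \<in> borel_measurable M" if "0 \<le> t" for t
    by (rule path_integral_measurable[OF YM that Yc cm lb])
  have each: "ito (\<lambda>t \<omega>. 2 * (Y t \<omega> \<bullet> v) * (s (Y t \<omega>) \<bullet> v))
      (\<lambda>t \<omega>. (Y t \<omega> \<bullet> v)\<^sup>2 - (Y 0 \<omega> \<bullet> v)\<^sup>2 - integral {0..t} (\<lambda>r. cv v (Y r \<omega>)))" for v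
    unfolding cv_def
  proof (rule ito_square)
    show "proc (\<lambda>t \<omega>. Y t \<omega> \<bullet> v)"
      unfolding proc_def using YF YM Yc by (auto intro!: continuous_intros)
    show "proc (\<lambda>t \<omega>. s (Y t \<omega>) \<bullet> v)"
      unfolding proc_def
    proof (intro conjI allI impI ballI)
      show "(\<lambda>\<omega>. s (Y t \<omega>) \<bullet> v) \<in> borel_measurable (F t)" if "0 \<le> t" for t
        using measurable_compose[OF YF[OF that] sm] by measurable
      show "(\<lambda>\<omega>. s (Y t \<omega>) \<bullet> v) \<in> borel_measurable M" for t
        using measurable_compose[OF YM[of t] sm] by measurable
      show "continuous_on UNIV (\<lambda>t. s (Y t \<omega>) \<bullet> v)" if "\<omega> \<in> space M" for \<omega>
        by (intro continuous_intros continuous_on_compose2[OF s Yc[OF that]]) auto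
    qed
    show "locally_bounded_borel (\<lambda>r. b (Y r \<omega>) \<bullet> v)" if "\<omega> \<in> space M" for \<omega>
      by (rule locally_bounded_borel_path[OF Yc[OF that] bv])
    show "\<exists>C\<in>borel_measurable M. \<forall>\<omega>\<in>space M. \<forall>r\<in>{0..T}. \<bar>b (Y r \<omega>) \<bullet> v\<bar> \<le> C \<omega>" for T
      by (rule path_bound_measurable[OF YM Yc bv(2)])
    show "(\<lambda>\<omega>. integral {0..t} (\<lambda>r. b (Y r \<omega>) \<bullet> v)) \<in> borel_measurable (F t)" if t: "0 \<le> t" for t
    proof (rule path_integral_measurable[OF _ t _ bv(1)])
      show "Y r \<in> borel_measurable (F t)" if "r \<in> {0..t}" for r
        using that by (intro F_measurable_mono[OF YF]) auto
    qed (auto simp: spaceF intro: Yc locally_bounded_borel_path[OF Yc bv])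
    show "(\<lambda>\<omega>. integral {0..t} (\<lambda>r. 2 * (Y r \<omega> \<bullet> v) * (b (Y r \<omega>) \<bullet> v) + (s (Y r \<omega>) \<bullet> v)\<^sup>2)) \<in> borel_measurable M"
      if "0 \<le> t" for t
      by (rule path_integral_measurable[OF YM that Yc cvm[of v, unfolded cv_def[abs_def]]])
         (auto intro: locally_bounded_borel_path[OF Yc cvm[of v, unfolded cv_def[abs_def]] cvb[of v, unfolded cv_def[abs_def]]])
    show "ito (\<lambda>t \<omega>. s (Y t \<omega>) \<bullet> v)
      (\<lambda>t \<omega>. Y t \<omega> \<bullet> v - Y 0 \<omega> \<bullet> v - integral {0..t} (\<lambda>r. b (Y r \<omega>) \<bullet> v))" by (rule ito)
  qed
  show "ito (\<lambda>t \<omega>. \<Sum>v\<in>B. 2 * (Y t \<omega> \<bullet> v) * (s (Y t \<omega>) \<bullet> v))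
    (\<lambda>t \<omega>. (\<Sum>v\<in>B. (Y t \<omega> \<bullet> v)\<^sup>2) - (\<Sum>v\<in>B. (y0 \<bullet> v)\<^sup>2) - integral {0..t} (\<lambda>r. c (Y r \<omega>)))"
  proof (rule ito_cong_AE[OF ito_sum_finite[OF B each]])
    show "(\<lambda>\<omega>. \<Sum>v\<in>B. 2 * (Y t \<omega> \<bullet> v) * (s (Y t \<omega>) \<bullet> v)) \<in> borel_measurable M" for t
      using measurable_compose[OF YM[of t] sm] YM[of t] by measurable
    show "(\<lambda>\<omega>. (\<Sum>v\<in>B. (Y t \<omega> \<bullet> v)\<^sup>2) - (\<Sum>v\<in>B. (y0 \<bullet> v)\<^sup>2) - integral {0..t} (\<lambda>r. c (Y r \<omega>))) \<in> borel_measurable M"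
      if "0 \<le> t" for t
      using path_integral_measurable[OF YM that Yc cm lb] YM[of t] by measurable
    show "AE \<omega> in M. (\<Sum>v\<in>B. (Y t \<omega> \<bullet> v)\<^sup>2) - (\<Sum>v\<in>B. (y0 \<bullet> v)\<^sup>2) - integral {0..t} (\<lambda>r. c (Y r \<omega>)) =
        (\<Sum>v\<in>B. (Y t \<omega> \<bullet> v)\<^sup>2 - (Y 0 \<omega> \<bullet> v)\<^sup>2 - integral {0..t} (\<lambda>r. cv v (Y r \<omega>)))" if "0 \<le> t" for t
    proof (rule AE_I2)
      fix \<omega> assume \<omega>: "\<omega> \<in> space M"
      have "integral {0..t} (\<lambda>r. c (Y r \<omega>)) = (\<Sum>v\<in>B. integral {0..t} (\<lambda>r. cv v (Y r \<omega>)))"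
        unfolding c_def cv_def[symmetric]
        by (intro Henstock_Kurzweil_Integration.integral_sum B locally_bounded_borel_integrable
            locally_bounded_borel_path[OF Yc[OF \<omega>] cvm cvb]) auto
      then show "(\<Sum>v\<in>B. (Y t \<omega> \<bullet> v)\<^sup>2) - (\<Sum>v\<in>B. (y0 \<bullet> v)\<^sup>2) - integral {0..t} (\<lambda>r. c (Y r \<omega>)) =
        (\<Sum>v\<in>B. (Y t \<omega> \<bullet> v)\<^sup>2 - (Y 0 \<omega> \<bullet> v)\<^sup>2 - integral {0..t} (\<lambda>r. cv v (Y r \<omega>)))"
        by (simp add: sum_subtractf Y0[OF \<omega>])
    qed
  qed auto
qed

end

text \<open>Redefining the driving Wiener process and the solution on a null set makes all paths
  continuous; completeness of the filtration keeps both adapted.\<close>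

lemma sde_solution_ito_diffusion:
  fixes Y :: "real \<Rightarrow> 'w \<Rightarrow> 'b::euclidean_space"
  assumes W: "wiener M W" and compl: "complete_measure M" and sol: "sde_solution M W b s y0 Y"
    and b: "b \<in> borel_measurable borel" "bounded_on_balls b" and s: "continuous_on UNIV s"
  obtains V Z where "ito_diffusion M (cfilt M W) V Z b s y0" "AE \<omega> in M. \<forall>t\<ge>0. Z t \<omega> = Y t \<omega>"
proof -
  interpret prob_space M using W by (simp add: wiener_def)
  have WM: "W t \<in> borel_measurable M" for t using W by (simp add: wiener_def)
  have YM: "Y t \<in> borel_measurable M" for t using sol by (simp add: sde_solution_def)
  have good: "AE \<omega> in M. continuous_on {0..} (\<lambda>t. W t \<omega>) \<and> continuous_on {0..} (\<lambda>t. Y t \<omega>) \<and> Y 0 \<omega> = y0"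
    using W sol unfolding wiener_def sde_solution_def by (intro AE_conjI) auto
  then obtain N where N: "N \<in> null_sets M"
    "{\<omega> \<in> space M. \<not> (continuous_on {0..} (\<lambda>t. W t \<omega>) \<and> continuous_on {0..} (\<lambda>t. Y t \<omega>) \<and> Y 0 \<omega> = y0)} \<subseteq> N"
    unfolding eventually_ae_filter by blast
  have NM [measurable]: "N \<in> events" using N(1) by auto
  define G where "G = space M - N"
  have G [measurable]: "G \<in> events" by (simp add: G_def)
  have GI: "continuous_on {0..} (\<lambda>t. W t \<omega>)" "continuous_on {0..} (\<lambda>t. Y t \<omega>)" "Y 0 \<omega> = y0" if "\<omega> \<in> G" for \<omega>
    using that N(2) by (auto simp: G_def)
  have AEG: "AE \<omega> in M. \<omega> \<in> G" using AE_not_in[OF N(1)] AE_space by eventually_elim (auto simp: G_def)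
  \<comment> \<open>Negative times receive the value at 0 and exceptional paths a constant, so that
    every path is continuous on the whole line.\<close>
  define V where "V t \<omega> = (if \<omega> \<in> G then W (max 0 t) \<omega> else 0)" for t \<omega>
  define Z where "Z t \<omega> = (if \<omega> \<in> G then Y (max 0 t) \<omega> else y0)" for t \<omega>
  have VM [measurable]: "V t \<in> borel_measurable M" for t
    unfolding V_def[abs_def] by (intro measurable_If_set WM) auto
  have ZM [measurable]: "Z t \<in> borel_measurable M" for t
    unfolding Z_def[abs_def] by (intro measurable_If_set YM) auto
  have Vc: "continuous_on UNIV (\<lambda>t. V t \<omega>)" for \<omega>
    by (cases "\<omega> \<in> G") (auto simp: V_def intro!: continuous_on_compose2[OF GI(1)] continuous_intros)
  have Zc: "continuous_on UNIV (\<lambda>t. Z t \<omega>)" for \<omega>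
    by (cases "\<omega> \<in> G") (auto simp: Z_def intro!: continuous_on_compose2[OF GI(2)] continuous_intros)
  have V_eq: "AE \<omega> in M. \<forall>t\<ge>0. V t \<omega> = W t \<omega>" using AEG by eventually_elim (auto simp: V_def)
  have Z_eq: "AE \<omega> in M. \<forall>t\<ge>0. Z t \<omega> = Y t \<omega>" using AEG by eventually_elim (auto simp: Z_def)
  have Z0: "Z 0 \<omega> = y0" for \<omega> using GI(3) by (auto simp: Z_def)
  have brownian: "brownian M (cfilt M W) V" by (rule wiener_brownian[OF W VM V_eq Vc])
  interpret B: brownian M "cfilt M W" V by (rule brownian)
  have ZF: "Z t \<in> borel_measurable (cfilt M W t)" if t: "0 \<le> t" for t
  proof -
    obtain g where g: "g \<in> borel_measurable (nat_filt M W t)" "AE \<omega> in M. Y t \<omega> = g \<omega>"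
      using sol t unfolding sde_solution_def adapted_def by blast
    have "AE \<omega> in M. Z t \<omega> = g \<omega>" using g(2) Z_eq by eventually_elim (use t in auto)
    then show ?thesis by (rule measurable_cfilt_AE[OF ZM g(1)])
  qed
  have sm: "s \<in> borel_measurable borel" using s by (rule borel_measurable_continuous_onI)
  have bv: "(\<lambda>y. b y \<bullet> v) \<in> borel_measurable borel" "bounded_on_balls (\<lambda>y. b y \<bullet> v)" for v
    using b by (auto intro: bounded_on_balls_inner)
  have lb: "locally_bounded_borel (\<lambda>r. b (Z r \<omega>) \<bullet> v)" for \<omega> v
    by (rule locally_bounded_borel_path[OF Zc bv])
  have int_b: "(\<lambda>r. b (Z r \<omega>)) integrable_on {0..t}" for \<omega> t
    by (subst integrable_componentwise_iff) (auto intro: locally_bounded_borel_integrable[OF lb])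
  have int_inner: "integral {0..t} (\<lambda>r. b (Z r \<omega>)) \<bullet> v = integral {0..t} (\<lambda>r. b (Z r \<omega>) \<bullet> v)" for \<omega> t v
  proof -
    have "integral {0..t} ((\<lambda>x. x \<bullet> v) \<circ> (\<lambda>r. b (Z r \<omega>))) = integral {0..t} (\<lambda>r. b (Z r \<omega>)) \<bullet> v"
      by (rule integral_linear[OF int_b bounded_linear_inner_left])
    then show ?thesis by (simp add: o_def)
  qed
  have intM: "(\<lambda>\<omega>. integral {0..t} (\<lambda>r. b (Z r \<omega>))) \<in> borel_measurable M" if "0 \<le> t" for t
    unfolding borel_measurable_euclidean_space[where f="\<lambda>\<omega>. integral {0..t} (\<lambda>r. b (Z r \<omega>))"] int_inner
    by (intro ballI path_integral_measurable[OF ZM that Zc bv(1) lb])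
  have ito: "B.ito (\<lambda>t \<omega>. s (Z t \<omega>) \<bullet> v)
      (\<lambda>t \<omega>. Z t \<omega> \<bullet> v - Z 0 \<omega> \<bullet> v - integral {0..t} (\<lambda>r. b (Z r \<omega>) \<bullet> v))" for v
    unfolding B.ito_def
  proof (intro allI impI)
    fix h :: real and a :: nat assume h: "0 < h"
    define t where "t = real a * h"
    have t: "0 \<le> t" using h by (simp add: t_def)
    show "vanishes (\<lambda>p \<omega>. B.rsum (h / 2 ^ p) (\<lambda>t \<omega>. s (Z t \<omega>) \<bullet> v) (a * 2 ^ p) \<omega>
      - (Z (real a * h) \<omega> \<bullet> v - Z 0 \<omega> \<bullet> v - integral {0..real a * h} (\<lambda>r. b (Z r \<omega>) \<bullet> v)))"
    \<comment> \<open>For \<open>a = 0\<close> the sums are empty, and the grid sizes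
      \<open>a * 2 ^ p\<close> would not form a subsequence of the sums defining the
      integral.\<close>
    proof (cases "a = 0")
      case True
      then show ?thesis by (simp add: B.rsum_def vanishes_zero)
    next
      case False
      define Q where "Q N \<omega> = ito_sum V (\<lambda>r \<omega>. s (Z r \<omega>)) t N \<omega>
        - (Z t \<omega> - y0 - integral {0..t} (\<lambda>r. b (Z r \<omega>)))" for N \<omega>
      have QM [measurable]: "Q N \<in> borel_measurable M" for N
      proof -
        have "(\<lambda>\<omega>. s (Z r \<omega>)) \<in> borel_measurable M" for r by (rule measurable_compose[OF ZM sm])
        then show ?thesis unfolding Q_def[abs_def] ito_sum_def using intM[OF t]
          by (intro borel_measurable_diff borel_measurable_sum borel_measurable_scaleR VM ZM
              borel_measurable_const)
      qed
      have lim: "(\<lambda>N. prob {\<omega> \<in> space M. e < norm (Q N \<omega>)}) \<longlonglongrightarrow> 0" if e: "0 < e" for e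
      proof -
        let ?A = "\<lambda>N. {\<omega> \<in> space M. e < dist (ito_sum W (\<lambda>r \<omega>. s (Y r \<omega>)) t N \<omega>)
          (Y t \<omega> - y0 - integral {0..t} (\<lambda>r. b (Y r \<omega>)))}"
        have AM: "{\<omega> \<in> space M. e < norm (Q N \<omega>)} \<in> events" for N by measurable
        have eq: "AE \<omega> in M. \<omega> \<in> {\<omega> \<in> space M. e < norm (Q N \<omega>)} \<longleftrightarrow> \<omega> \<in> ?A N" for N
          using V_eq Z_eq
        proof eventually_elim
          case (elim \<omega>)
          have "ito_sum V (\<lambda>r \<omega>. s (Z r \<omega>)) t N \<omega> = ito_sum W (\<lambda>r \<omega>. s (Y r \<omega>)) t N \<omega>"
            unfolding ito_sum_def using elim t by (intro sum.cong refl) simp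
          moreover have "integral {0..t} (\<lambda>r. b (Z r \<omega>)) = integral {0..t} (\<lambda>r. b (Y r \<omega>))"
            using elim by (intro Henstock_Kurzweil_Integration.integral_cong) auto
          ultimately have "norm (Q N \<omega>) = dist (ito_sum W (\<lambda>r \<omega>. s (Y r \<omega>)) t N \<omega>)
              (Y t \<omega> - y0 - integral {0..t} (\<lambda>r. b (Y r \<omega>)))"
            using elim t by (simp add: Q_def dist_norm)
          then show ?case by simp
        qed
        \<comment> \<open>Outside \<open>events\<close> the value of \<open>prob\<close> is 0, so
          the hypothesis on the original sums carries information only once these sets are
          measurable; completeness gives this from almost sure agreement.\<close>
        have "?A N \<in> events" for N
          by (rule complete_measure.in_sets_AE[OF compl eq AM]) auto
        then have "prob {\<omega> \<in> space M. e < norm (Q N \<omega>)} = prob (?A N)" for N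
          using eq AM by (intro measure_eq_AE) auto
        moreover have "(\<lambda>N. prob (?A N)) \<longlonglongrightarrow> 0"
          using sol t e unfolding sde_solution_def is_ito_integral_def by blast
        ultimately show ?thesis by simp
      qed
      have sub: "strict_mono (\<lambda>p. a * 2 ^ p)"
        using False by (intro strict_monoI) (simp add: power_strict_increasing)
      have sum_eq: "B.rsum (h / 2 ^ p) (\<lambda>t \<omega>. s (Z t \<omega>) \<bullet> v) (a * 2 ^ p) \<omega>
        - (Z (real a * h) \<omega> \<bullet> v - Z 0 \<omega> \<bullet> v - integral {0..real a * h} (\<lambda>r. b (Z r \<omega>) \<bullet> v))
        = Q (a * 2 ^ p) \<omega> \<bullet> v" for p \<omega>
      proof -
        have "real k * t / real (a * 2 ^ p) = real k * (h / 2 ^ p)" for k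
          using False by (simp add: t_def)
        then have "ito_sum V (\<lambda>r \<omega>. s (Z r \<omega>)) t (a * 2 ^ p) \<omega> \<bullet> v
            = B.rsum (h / 2 ^ p) (\<lambda>t \<omega>. s (Z t \<omega>) \<bullet> v) (a * 2 ^ p) \<omega>"
          unfolding ito_sum_def B.rsum_def by (simp only: inner_sum_left inner_scaleR_left mult.commute)
        then show ?thesis
          by (simp add: Q_def inner_diff_left int_inner Z0 t_def[symmetric])
      qed
      show ?thesis
        unfolding sum_eq
      proof (rule vanishesI_prob_gt)
        show "(\<lambda>\<omega>. Q (a * 2 ^ p) \<omega> \<bullet> v) \<in> borel_measurable M" for p by measurable
        fix d :: real assume d: "0 < d"
        \<comment> \<open>The added 1 covers \<open>v = 0\<close>.\<close>
        define e where "e = d / (norm v + 1)"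
        have v1: "0 < norm v + 1" by (simp add: add_nonneg_pos)
        have e: "0 < e" using d v1 by (simp add: e_def)
        have sub_lim: "(\<lambda>p. prob {\<omega> \<in> space M. e < norm (Q (a * 2 ^ p) \<omega>)}) \<longlonglongrightarrow> 0"
          using LIMSEQ_subseq_LIMSEQ[OF lim[OF e] sub] by (simp add: o_def)
        show "(\<lambda>p. prob {\<omega> \<in> space M. d < \<bar>Q (a * 2 ^ p) \<omega> \<bullet> v\<bar>}) \<longlonglongrightarrow> 0"
        proof (rule tendsto_sandwich[OF _ _ tendsto_const sub_lim]; intro always_eventually allI)
          fix p
          show "prob {\<omega> \<in> space M. d < \<bar>Q (a * 2 ^ p) \<omega> \<bullet> v\<bar>} \<le> prob {\<omega> \<in> space M. e < norm (Q (a * 2 ^ p) \<omega>)}"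
          proof (rule finite_measure_mono)
            show "{\<omega> \<in> space M. d < \<bar>Q (a * 2 ^ p) \<omega> \<bullet> v\<bar>} \<subseteq> {\<omega> \<in> space M. e < norm (Q (a * 2 ^ p) \<omega>)}"
            proof safe
              fix \<omega> assume "d < \<bar>Q (a * 2 ^ p) \<omega> \<bullet> v\<bar>"
              also have "\<dots> \<le> norm (Q (a * 2 ^ p) \<omega>) * norm v" by (rule Cauchy_Schwarz_ineq2)
              also have "\<dots> \<le> norm (Q (a * 2 ^ p) \<omega>) * (norm v + 1)" by (intro mult_left_mono) auto
              finally show "e < norm (Q (a * 2 ^ p) \<omega>)" using v1 by (simp add: e_def pos_divide_less_eq)
            qed
          qed measurable
        qed auto
      qed
    qed
  qed
  have "ito_diffusion M (cfilt M W) V Z b s y0"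
    by unfold_locales (auto intro: ZF Zc Z0 b s ito)
  then show ?thesis using Z_eq by (rule that)
qed

section \<open>Invariance of the sphere and the exit bound\<close>

context ito_diffusion
begin

text \<open>By continuity the rational times, clamped into the interval, decide the event. It takes
  over the role of a stopping time at the exit from a ball: known at time \<open>t\<close> and
  shrinking as \<open>t\<close> grows.\<close>

lemma sup_norm_event:
  assumes "0 \<le> t"
  shows "{\<omega> \<in> space M. \<forall>r\<in>{0..t}. norm (Y r \<omega>) \<le> K} \<in> sets (F t)"
proof -
  let ?f = "\<lambda>\<omega> q. norm (Y (max 0 (min t q)) \<omega>)"
  have "(\<forall>r\<in>{0..t}. norm (Y r \<omega>) \<le> K) \<longleftrightarrow> (\<forall>q\<in>\<rat>. ?f \<omega> q \<le> K)" if \<omega>: "\<omega> \<in> space M" for \<omega>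
  proof
    assume all: "\<forall>q\<in>\<rat>. ?f \<omega> q \<le> K"
    have "continuous_on UNIV (?f \<omega>)"
      by (intro continuous_on_norm continuous_on_compose2[OF Yc[OF \<omega>]] continuous_intros) auto
    then have "closed {q. ?f \<omega> q \<le> K}" by (intro closed_Collect_le continuous_on_const)
    then have "closure \<rat> \<subseteq> {q. ?f \<omega> q \<le> K}" using all by (intro closure_minimal) auto
    then have "?f \<omega> r \<le> K" for r using Rats_closure_real by auto
    then have "norm (Y (max 0 (min t r)) \<omega>) \<le> K" for r by blast
    then show "\<forall>r\<in>{0..t}. norm (Y r \<omega>) \<le> K" by (metis atLeastAtMost_iff max.absorb2 min.absorb2)
  qed (use assms in auto)
  then have eq: "{\<omega> \<in> space M. \<forall>r\<in>{0..t}. norm (Y r \<omega>) \<le> K} = {\<omega> \<in> space (F t). \<forall>q\<in>\<rat>. ?f \<omega> q \<le> K}"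
    by (auto simp: space_F)
  have "(\<lambda>\<omega>. ?f \<omega> q) \<in> borel_measurable (F t)" for q
  proof -
    have "Y (max 0 (min t q)) \<in> borel_measurable (F t)"
      using assms by (intro F_measurable_mono[OF YF]) auto
    then show ?thesis by measurable
  qed
  then have "{\<omega> \<in> space (F t). ?f \<omega> q \<le> K} \<in> sets (F t)" for q
    unfolding borel_measurable_iff_le by blast
  then have "(\<Inter>q\<in>\<rat>. {\<omega> \<in> space (F t). ?f \<omega> q \<le> K}) \<in> sets (F t)"
    using Rats_0 by (intro sets.countable_INT') (auto simp: countable_rat)
  moreover have "(\<Inter>q\<in>\<rat>. {\<omega> \<in> space (F t). ?f \<omega> q \<le> K}) = {\<omega> \<in> space (F t). \<forall>q\<in>\<rat>. ?f \<omega> q \<le> K}"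
    using Rats_0 by blast
  ultimately show ?thesis unfolding eq by simp
qed

text \<open>The coefficient \<open>\<theta>\<close> is bounded on balls only, so uniqueness for the
  linear equation of the deviation \<open>D\<close> is applied on \<open>Q K\<close>. A continuous
  path on a bounded interval lies in \<open>Q K t\<close> for some \<open>K\<close>, and rational
  times then give all times.\<close>

lemma norm_preserved:
  assumes balance: "\<And>y. 2 * (y \<bullet> b y) + s y \<bullet> s y = 0"
    and \<theta>: "\<And>y. y \<bullet> s y = \<theta> y * (1 - (norm y)\<^sup>2)" "continuous_on UNIV \<theta>"
    and unit: "norm y0 = 1"
  shows "AE \<omega> in M. \<forall>t\<ge>0. norm (Y t \<omega>) = 1"
proof -
  define g where "g t \<omega> = 2 * (Y t \<omega> \<bullet> s (Y t \<omega>))" for t \<omega>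
  define D where "D t \<omega> = (norm (Y t \<omega>))\<^sup>2 - 1" for t \<omega>
  have sm: "s \<in> borel_measurable borel" using s by (rule borel_measurable_continuous_onI)
  note YM [measurable]
  have gF: "g t \<in> borel_measurable (F t)" if "0 \<le> t" for t
    unfolding g_def[abs_def] using YF[OF that] measurable_compose[OF YF[OF that] sm] by measurable
  have gM: "g t \<in> borel_measurable M" for t
    unfolding g_def[abs_def] using measurable_compose[OF YM[of t] sm] by measurable
  have DM: "D t \<in> borel_measurable M" for t unfolding D_def[abs_def] by measurable
  have basis: "(\<Sum>v\<in>Basis. 2 * (y \<bullet> v) * (z \<bullet> v)) = 2 * (y \<bullet> z)" for y z :: 'b
    by (simp add: euclidean_inner[of y z] sum_distrib_left mult.assoc)
  have basis2: "(\<Sum>v\<in>Basis. (y \<bullet> v)\<^sup>2) = (norm y)\<^sup>2" for y :: 'b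
    unfolding power2_norm_eq_inner by (simp add: euclidean_inner[of y y] power2_eq_square)
  have zero: "(\<Sum>v\<in>Basis. 2 * (y \<bullet> v) * (b y \<bullet> v) + (s y \<bullet> v)\<^sup>2) = 0" for y
    using balance[of y] by (simp add: sum.distrib basis basis2 power2_norm_eq_inner)
  have ito_D: "ito g D"
    using ito_quadratic(1)[OF finite_Basis] unit
    unfolding zero basis basis2 g_def[symmetric] by (simp add: D_def[abs_def])
  define Q where "Q K t = {\<omega> \<in> space M. \<forall>r\<in>{0..t}. norm (Y r \<omega>) \<le> real K}" for K :: nat and t
  have zero_Q: "AE \<omega> in M. \<omega> \<in> Q K t \<longrightarrow> D t \<omega> = 0" if t: "0 \<le> t" for K t
  proof -
    obtain C where C: "\<forall>y. norm y \<le> real K \<longrightarrow> norm (\<theta> y) \<le> C"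
      using bounded_on_balls_continuous[OF \<theta>(2)] unfolding bounded_on_balls_def by blast
    have C0: "0 \<le> C" using C[rule_format, of 0] by (simp add: order_trans[OF abs_ge_zero])
    show ?thesis
    proof (rule ito_linear_unique[OF gF gM DM ito_D])
      show "Q K t \<in> sets (F t)" if "0 \<le> t" for t unfolding Q_def using that by (rule sup_norm_event)
      show "Q K t \<subseteq> Q K s" if "0 \<le> s" "s \<le> t" for s t using that by (auto simp: Q_def)
      show "\<bar>g t \<omega>\<bar> \<le> (2 * C) * \<bar>D t \<omega>\<bar>" if "0 \<le> t" "\<omega> \<in> Q K t" for t \<omega>
      proof -
        have "\<bar>\<theta> (Y t \<omega>)\<bar> \<le> C" using that C by (auto simp: Q_def)
        moreover have "\<bar>g t \<omega>\<bar> = 2 * \<bar>\<theta> (Y t \<omega>)\<bar> * \<bar>D t \<omega>\<bar>"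
          unfolding g_def D_def \<theta>(1) by (simp add: abs_mult abs_minus_commute)
        ultimately show ?thesis by (simp add: mult_right_mono)
      qed
      show "\<bar>D t \<omega>\<bar> \<le> (real K)\<^sup>2 + 1" if "0 \<le> t" "\<omega> \<in> Q K t" for t \<omega>
      proof -
        have "(norm (Y t \<omega>))\<^sup>2 \<le> (real K)\<^sup>2" using that by (intro power_mono) (auto simp: Q_def)
        moreover have "0 \<le> (norm (Y t \<omega>))\<^sup>2" by simp
        ultimately show ?thesis unfolding D_def by linarith
      qed
    qed (use C0 t in auto)
  qed
  have "AE \<omega> in M. norm (Y t \<omega>) = 1" if t: "0 \<le> t" for t
  proof -
    have "AE \<omega> in M. \<forall>K. \<omega> \<in> Q K t \<longrightarrow> D t \<omega> = 0" 
      unfolding AE_all_countable using zero_Q[OF t] by blast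
    with AE_space show ?thesis
    proof eventually_elim
      case (elim \<omega>)
      have "bounded ((\<lambda>r. Y r \<omega>) ` {0..t})"
        using Yc[OF elim(1)] by (intro compact_imp_bounded compact_continuous_image) (auto intro: continuous_on_subset)
      then obtain B where "\<forall>r\<in>{0..t}. norm (Y r \<omega>) \<le> B" by (auto simp: bounded_iff)
      moreover obtain K :: nat where "B \<le> real K" using real_arch_simple by blast
      ultimately have "\<omega> \<in> Q K t" using elim(1) by (force simp: Q_def)
      then have "D t \<omega> = 0" using elim(2) by blast
      then have "(norm (Y t \<omega>))\<^sup>2 = 1\<^sup>2" by (simp add: D_def)
      then show ?case by (rule power2_eq_imp_eq) auto
    qed
  qed
  then have "AE \<omega> in M. \<forall>q\<in>\<rat>. norm (Y (max 0 q) \<omega>) = 1"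
    by (simp add: AE_ball_countable countable_rat)
  with AE_space show ?thesis
  proof eventually_elim
    case (elim \<omega>)
    have "continuous_on UNIV (\<lambda>q. norm (Y (max 0 q) \<omega>))"
      by (intro continuous_on_norm continuous_on_compose2[OF Yc[OF elim(1)]] continuous_intros) auto
    then have "closed {q. norm (Y (max 0 q) \<omega>) = 1}" by (intro closed_Collect_eq continuous_on_const)
    then have "closure \<rat> \<subseteq> {q. norm (Y (max 0 q) \<omega>) = 1}" using elim(2) by (intro closure_minimal) auto
    then have "norm (Y (max 0 q) \<omega>) = 1" for q using Rats_closure_real by auto
    then show ?case by (metis max.absorb2)
  qed
qed

text \<open>\<open>L - P\<close> is a constant plus the integral of a nonnegative function along the
  path, hence nondecreasing; \<open>1 - L\<close> is therefore a supermartingale as soon as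
  \<open>P\<close> is an Ito integral with bounded integrand.\<close>

lemma quadratic_exit_bound:
  assumes B: "finite B" and unit: "AE \<omega> in M. \<forall>t\<ge>0. norm (Y t \<omega>) = 1"
    and growth: "\<And>y. 0 \<le> (\<Sum>v\<in>B. 2 * (y \<bullet> v) * (b y \<bullet> v) + (s y \<bullet> v)\<^sup>2)"
    and le1: "\<And>y. norm y = 1 \<Longrightarrow> (\<Sum>v\<in>B. (y \<bullet> v)\<^sup>2) \<le> 1" and \<delta>: "0 < \<delta>"
  obtains E where "E \<in> events" "prob E \<le> (1 - (\<Sum>v\<in>B. (y0 \<bullet> v)\<^sup>2)) / \<delta>"
    "\<And>\<omega> t. \<omega> \<in> space M \<Longrightarrow> 0 \<le> t \<Longrightarrow> \<delta> < 1 - (\<Sum>v\<in>B. (Y t \<omega> \<bullet> v)\<^sup>2) \<Longrightarrow> \<omega> \<in> E"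
proof -
  define c where "c y = (\<Sum>v\<in>B. 2 * (y \<bullet> v) * (b y \<bullet> v) + (s y \<bullet> v)\<^sup>2)" for y
  define L where "L t \<omega> = (\<Sum>v\<in>B. (Y t \<omega> \<bullet> v)\<^sup>2)" for t \<omega>
  define \<gamma> where "\<gamma> y = (\<Sum>v\<in>B. 2 * (y \<bullet> v) * (s y \<bullet> v))" for y
  define P where "P t \<omega> = L t \<omega> - (\<Sum>v\<in>B. (y0 \<bullet> v)\<^sup>2) - integral {0..t} (\<lambda>r. c (Y r \<omega>))" for t \<omega>
  note quad = ito_quadratic[OF B, folded c_def, folded L_def \<gamma>_def, folded P_def]
  note YM [measurable]
  have \<gamma>c: "continuous_on UNIV \<gamma>"
    unfolding \<gamma>_def[abs_def] by (intro continuous_intros continuous_on_compose2[OF s]) auto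
  have \<gamma>m: "\<gamma> \<in> borel_measurable borel" using \<gamma>c by (rule borel_measurable_continuous_onI)
  obtain C where C: "\<forall>y. norm y \<le> 1 \<longrightarrow> norm (\<gamma> y) \<le> C"
    using bounded_on_balls_continuous[OF \<gamma>c] unfolding bounded_on_balls_def by blast
  have C0: "0 \<le> C" using C[rule_format, of 0] by (simp add: order_trans[OF abs_ge_zero])
  \<comment> \<open>Clipping changes nothing almost surely, because the state has norm 1, but it
    provides the everywhere valid bound that the submartingale estimate asks for.\<close>
  define g where "g t \<omega> = max (- C) (min C (\<gamma> (Y t \<omega>)))" for t \<omega>
  have gF: "g t \<in> borel_measurable (F t)" if "0 \<le> t" for t
    unfolding g_def[abs_def] using measurable_compose[OF YF[OF that] \<gamma>m] by measurable
  have gM: "g t \<in> borel_measurable M" for t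
    unfolding g_def[abs_def] using measurable_compose[OF YM[of t] \<gamma>m] by measurable
  have gC: "\<bar>g t \<omega>\<bar> \<le> C" for t \<omega> using C0 by (auto simp: g_def)
  have LF: "L t \<in> borel_measurable (F t)" if "0 \<le> t" for t
    unfolding L_def[abs_def] using YF[OF that] by measurable
  have LM: "L t \<in> borel_measurable M" for t unfolding L_def[abs_def] by measurable
  have Lc: "continuous_on UNIV (\<lambda>t. L t \<omega>)" if "\<omega> \<in> space M" for \<omega>
    unfolding L_def by (intro continuous_intros Yc that)
  have L01: "AE \<omega> in M. 0 \<le> L t \<omega> \<and> L t \<omega> \<le> 1" if "0 \<le> t" for t
    using unit by eventually_elim (use le1 that in \<open>auto simp: L_def intro: sum_nonneg\<close>)
  have ito_g: "ito g P"
  proof (rule ito_cong_AE[OF quad(1) gM])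
    show "P t \<in> borel_measurable M" if "0 \<le> t" for t
      unfolding P_def[abs_def] by (intro borel_measurable_diff LM quad(3) that) auto
    show "AE \<omega> in M. g t \<omega> = \<gamma> (Y t \<omega>)" if "0 \<le> t" for t
      using unit
    proof eventually_elim
      case (elim \<omega>)
      then have "\<bar>\<gamma> (Y t \<omega>)\<bar> \<le> C" using C that by auto
      then show ?case by (auto simp: g_def)
    qed
  qed simp
  have dom: "P t \<omega> - P r \<omega> \<le> L t \<omega> - L r \<omega>" if "\<omega> \<in> space M" "0 \<le> r" "r \<le> t" for r t \<omega>
  proof -
    have "integral {0..r} (\<lambda>r. c (Y r \<omega>)) \<le> integral {0..t} (\<lambda>r. c (Y r \<omega>))"
      using growth that
      by (intro integral_subset_le locally_bounded_borel_integrable[OF quad(2)]) (auto simp: c_def)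
    then show ?thesis by (simp add: P_def)
  qed
  have super: "expectation (\<lambda>\<omega>. indicator A \<omega> * ((1 - L (real (Suc k) * h) \<omega>) - (1 - L (real k * h) \<omega>))) \<le> 0"
    if h: "0 < h" and A: "A \<in> sets (F (real k * h))" for h k A
  proof -
    have grid: "0 \<le> real k * h" "0 \<le> real (Suc k) * h" "real k * h \<le> real (Suc k) * h"
      using h by (auto intro: mult_right_mono)
    have "0 \<le> expectation (\<lambda>\<omega>. indicator A \<omega> * (L (real (Suc k) * h) \<omega> - L (real k * h) \<omega>))"
    proof (rule ito_dominated_submartingale[OF gF gC ito_g LM h _ A])
      show "AE \<omega> in M. \<bar>L (real (Suc k) * h) \<omega> - L (real k * h) \<omega>\<bar> \<le> 1"
        using L01[OF grid(1)] L01[OF grid(2)] by eventually_elim auto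
      show "AE \<omega> in M. P (real (Suc k) * h) \<omega> - P (real k * h) \<omega> \<le> L (real (Suc k) * h) \<omega> - L (real k * h) \<omega>"
        using grid by (intro AE_I2 dom) auto
      show "k \<le> Suc k" by (rule le_SucI) (rule order_refl)
    qed
    moreover have "(\<lambda>\<omega>. indicator A \<omega> * ((1 - L (real (Suc k) * h) \<omega>) - (1 - L (real k * h) \<omega>)))
        = (\<lambda>\<omega>. - (indicator A \<omega> * (L (real (Suc k) * h) \<omega> - L (real k * h) \<omega>)))"
      by (auto simp: algebra_simps)
    ultimately show ?thesis by simp
  qed
  obtain E where "E \<in> events" "prob E \<le> (1 - (\<Sum>v\<in>B. (y0 \<bullet> v)\<^sup>2)) / \<delta>"
    "\<And>\<omega> t. \<omega> \<in> space M \<Longrightarrow> 0 \<le> t \<Longrightarrow> \<delta> < 1 - L t \<omega> \<Longrightarrow> \<omega> \<in> E"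
  proof (rule supermartingale_maximal[of "\<lambda>t \<omega>. 1 - L t \<omega>"])
    show "(\<lambda>\<omega>. 1 - L t \<omega>) \<in> borel_measurable (F t)" if "0 \<le> t" for t using LF[OF that] by measurable
    show "continuous_on UNIV (\<lambda>t. 1 - L t \<omega>)" if "\<omega> \<in> space M" for \<omega> by (intro continuous_intros Lc that)
    show "AE \<omega> in M. 0 \<le> 1 - L t \<omega> \<and> 1 - L t \<omega> \<le> 1" if "0 \<le> t" for t
      using L01[OF that] by eventually_elim auto
    show "AE \<omega> in M. 1 - L 0 \<omega> = 1 - (\<Sum>v\<in>B. (y0 \<bullet> v)\<^sup>2)"
      by (rule AE_I2) (simp add: L_def Y0)
  qed (use super \<delta> in auto)
  then show ?thesis using that by (simp add: L_def)
qed

end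

lemma closed_loop_exit_probability:
  fixes X :: "'n::finite cmat" and \<psi>0 :: "'n cvec"
  assumes W: "wiener M W" and compl: "complete_measure M"
    and pos: "0 < hbar" "0 < \<kappa>" and X: "hermitian X" and H: "\<forall>j\<in>{0..m}. hermitian (H j)"
    and \<alpha>: "\<forall>j\<in>{1..m}. 0 < \<alpha> j" and unit: "norm \<psi>f = 1" "norm \<psi>0 = 1"
    and H0: "H 0 *v \<psi>f = lamH *s \<psi>f" and Xf: "X *v \<psi>f = lamX *s \<psi>f"
    and sol: "sde_solution M W (drift hbar \<kappa> X m \<alpha> H \<psi>f) (diffusion \<kappa> X) \<psi>0 Y"
    and \<epsilon>: "0 < \<epsilon>"
  shows "measure M {\<omega> \<in> space M. ereal \<epsilon> \<le> (SUP t\<in>{0..}. ereal (dist_class (Y t \<omega>) \<psi>f))}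
    \<le> 8 / \<epsilon>\<^sup>2 * (1 - (cmod (braket \<psi>f \<psi>0))\<^sup>2)"
proof -
  obtain V Z where dif: "ito_diffusion M (cfilt M W) V Z (drift hbar \<kappa> X m \<alpha> H \<psi>f) (diffusion \<kappa> X) \<psi>0"
    and ZY: "AE \<omega> in M. \<forall>t\<ge>0. Z t \<omega> = Y t \<omega>"
    by (rule sde_solution_ito_diffusion[OF W compl sol drift_measurable drift_bounded_on_balls continuous_on_diffusion])
  interpret ito_diffusion M "cfilt M W" V Z "drift hbar \<kappa> X m \<alpha> H \<psi>f" "diffusion \<kappa> X" \<psi>0 by (rule dif)
  have norm_Z: "AE \<omega> in M. \<forall>t\<ge>0. norm (Z t \<omega>) = 1"
  proof (rule norm_preserved[OF drift_diffusion_norm_balance[OF X H pos(2)] inner_diffusion])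
    show "continuous_on UNIV (\<lambda>\<psi>. sqrt (2 * \<kappa>) * Re (braket \<psi> (X *v \<psi>)))" by (intro continuous_intros)
  qed (fact unit)
  define B where "B = {\<psi>f, \<i> *s \<psi>f}"
  \<comment> \<open>The set sum over \<open>B\<close> splits into its two terms only if the vectors
    are distinct.\<close>
  have ne: "\<psi>f \<noteq> \<i> *s \<psi>f"
  proof
    assume "\<psi>f = \<i> *s \<psi>f"
    then have "\<psi>f \<bullet> \<psi>f = \<psi>f \<bullet> (\<i> *s \<psi>f)" by simp
    then show False using unit(1) by (simp add: inner_imaginary braket_self norm_eq_1)
  qed
  have sumB: "(\<Sum>v\<in>B. f v) = f \<psi>f + f (\<i> *s \<psi>f)" for f :: "'n cvec \<Rightarrow> real" using ne by (simp add: B_def)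
  \<comment> \<open>A distance beyond \<open>\<epsilon> / 2\<close> forces \<epsilon>^2 / 4 < 2 (1 -
    |q|^2), that is 1 - |q|^2 > \<epsilon>^2 / 8.\<close>
  define \<delta> where "\<delta> = \<epsilon>\<^sup>2 / 8"
  have \<delta>: "0 < \<delta>" using \<epsilon> by (simp add: \<delta>_def)
  have le1: "(\<Sum>v\<in>B. (y \<bullet> v)\<^sup>2) \<le> 1" if "norm y = 1" for y
    using overlap_le_norm[OF unit(1), of y] that by (simp add: sumB overlap_square)
  obtain E where E: "E \<in> events" "prob E \<le> (1 - (\<Sum>v\<in>B. (\<psi>0 \<bullet> v)\<^sup>2)) / \<delta>"
    "\<And>\<omega> t. \<omega> \<in> space M \<Longrightarrow> 0 \<le> t \<Longrightarrow> \<delta> < 1 - (\<Sum>v\<in>B. (Z t \<omega> \<bullet> v)\<^sup>2) \<Longrightarrow> \<omega> \<in> E"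
  proof (rule quadratic_exit_bound[of B])
    show "finite B" by (simp add: B_def)
    show "0 \<le> (\<Sum>v\<in>B. 2 * (y \<bullet> v) * (drift hbar \<kappa> X m \<alpha> H \<psi>f y \<bullet> v) + (diffusion \<kappa> X y \<bullet> v)\<^sup>2)" for y
      unfolding sumB by (rule overlap_drift_nonneg[OF X H pos \<alpha> unit(1) H0 Xf])
  qed (use norm_Z le1 \<delta> in auto)
  let ?A = "{\<omega> \<in> space M. ereal \<epsilon> \<le> (SUP t\<in>{0..}. ereal (dist_class (Y t \<omega>) \<psi>f))}"
  have "AE \<omega> in M. \<omega> \<in> ?A \<longrightarrow> \<omega> \<in> E"
    using ZY norm_Z AE_space
  proof eventually_elim
    case (elim \<omega>)
    show ?case
    proof
      assume A: "\<omega> \<in> ?A"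
      \<comment> \<open>A supremum of at least \<open>\<epsilon>\<close> may fail to be attained; a
        strictly smaller threshold guarantees a time at which it is exceeded.\<close>
      have "ereal (\<epsilon> / 2) < ereal \<epsilon>" using \<epsilon> by simp
      also have "ereal \<epsilon> \<le> (SUP t\<in>{0..}. ereal (dist_class (Y t \<omega>) \<psi>f))" using A by blast
      finally obtain t where "t \<in> {0..}" "ereal (\<epsilon> / 2) < ereal (dist_class (Y t \<omega>) \<psi>f)"
        unfolding less_SUP_iff by blast
      then have t: "0 \<le> t" "\<epsilon> / 2 < dist_class (Y t \<omega>) \<psi>f" by (simp_all del: less_divide_eq_numeral1)
      have "(\<epsilon> / 2)\<^sup>2 < (dist_class (Z t \<omega>) \<psi>f)\<^sup>2"
        using t elim(1) \<epsilon> by (intro power_strict_mono) auto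
      also have "\<dots> \<le> 2 * (1 - (cmod (braket \<psi>f (Z t \<omega>)))\<^sup>2)"
        using dist_class_le_overlap[OF unit(1)] elim(2) t by auto
      finally have "\<delta> < 1 - (\<Sum>v\<in>B. (Z t \<omega> \<bullet> v)\<^sup>2)"
        by (simp add: sumB overlap_square \<delta>_def power_divide)
      then show "\<omega> \<in> E" using E(3) elim(3) t(1) by blast
    qed
  qed
  \<comment> \<open>If \<open>?A\<close> is not an event, its \<open>measure\<close> is 0 and the
    bound is immediate; otherwise the almost sure inclusion applies.\<close>
  then have "prob ?A \<le> prob E"
    using E(1) by (cases "?A \<in> events") (auto intro: finite_measure_mono_AE simp: measure_notin_sets)
  also have "\<dots> \<le> (1 - (cmod (braket \<psi>f \<psi>0))\<^sup>2) / \<delta>"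
    using E(2) by (simp add: sumB overlap_square)
  also have "\<dots> = 8 / \<epsilon>\<^sup>2 * (1 - (cmod (braket \<psi>f \<psi>0))\<^sup>2)" by (simp add: \<delta>_def)
  finally show ?thesis .
qed

theorem theorem2:
  fixes M :: "'w measure" and W :: "real \<Rightarrow> 'w \<Rightarrow> real"
    and hbar \<kappa> :: real and X :: "'n::finite cmat"
    and m :: nat and H :: "nat \<Rightarrow> 'n cmat" and \<alpha> :: "nat \<Rightarrow> real"
    and \<psi>f :: "'n cvec" and lamHf lamXf :: complex
    and sol :: "'n cvec \<Rightarrow> real \<Rightarrow> 'w \<Rightarrow> 'n cvec"
  assumes n2: "CARD('n) \<ge> 2"
    and hbar: "hbar > 0" and kappa: "\<kappa> > 0"
    and wien: "wiener M W" and compl: "complete_measure M"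
    and Xherm: "hermitian X"
    and alpha: "\<forall>j\<in>{1..m}. \<alpha> j > 0"
    and A1: "\<forall>j\<in>{0..m}. hermitian (H j) \<and> cscale \<i> (H j) \<in> su"
    and psif: "\<psi>f \<in> sphere 0 1"
    and A2: "H 0 *v \<psi>f = lamHf *s \<psi>f"
    and A2deg: "\<exists>v. H 0 *v v = lamHf *s v \<and> \<not> (\<exists>c. v = c *s \<psi>f)"
    and A3: "\<exists>j\<in>{1..m}. \<not> is_eigvec (H j) \<psi>f"
    and A4: "X *v \<psi>f = lamXf *s \<psi>f"
    and sols: "\<forall>\<psi>0\<in>sphere 0 1.
       sde_solution M W (drift hbar \<kappa> X m \<alpha> H \<psi>f) (diffusion \<kappa> X) \<psi>0 (sol \<psi>0)"
  shows "\<forall>\<epsilon>>0. ((\<lambda>\<psi>0. measure M {\<omega>\<in>space M.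
            ereal \<epsilon> \<le> (SUP t\<in>{0..}. ereal (dist_class (sol \<psi>0 t \<omega>) \<psi>f))})
          \<longlongrightarrow> 0) (at \<psi>f within sphere 0 1)"
proof (intro allI impI)
  fix \<epsilon> :: real assume \<epsilon>: "0 < \<epsilon>"
  have unit: "norm \<psi>f = 1" using psif by simp
  \<comment> \<open>Depends on the initial state only through its overlap with
    \<open>\<psi>f\<close>, hence is continuous, and it is 0 at \<open>\<psi>f\<close>
    itself.\<close>
  let ?bound = "\<lambda>\<psi>0. 8 / \<epsilon>\<^sup>2 * (1 - (cmod (braket \<psi>f \<psi>0))\<^sup>2)"
  have "continuous_on UNIV ?bound" by (intro continuous_intros)
  then have "(?bound \<longlongrightarrow> ?bound \<psi>f) (at \<psi>f within sphere 0 1)"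
    by (auto simp: continuous_on_def intro: tendsto_within_subset)
  then have lim: "(?bound \<longlongrightarrow> 0) (at \<psi>f within sphere 0 1)" using unit by (simp add: braket_self)
  show "((\<lambda>\<psi>0. measure M {\<omega>\<in>space M.
            ereal \<epsilon> \<le> (SUP t\<in>{0..}. ereal (dist_class (sol \<psi>0 t \<omega>) \<psi>f))})
          \<longlongrightarrow> 0) (at \<psi>f within sphere 0 1)"
  proof (rule tendsto_sandwich[OF _ _ tendsto_const lim])
    show "\<forall>\<^sub>F \<psi>0 in at \<psi>f within sphere 0 1. measure M {\<omega>\<in>space M.
        ereal \<epsilon> \<le> (SUP t\<in>{0..}. ereal (dist_class (sol \<psi>0 t \<omega>) \<psi>f))} \<le> ?bound \<psi>0"
      unfolding eventually_at_filter
    proof (intro always_eventually allI impI)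
      fix \<psi>0 :: "'n cvec" assume \<psi>0: "\<psi>0 \<in> sphere 0 1"
      have H: "\<forall>j\<in>{0..m}. hermitian (H j)" and n0: "norm \<psi>0 = 1" using A1 \<psi>0 by auto
      show "measure M {\<omega>\<in>space M.
          ereal \<epsilon> \<le> (SUP t\<in>{0..}. ereal (dist_class (sol \<psi>0 t \<omega>) \<psi>f))} \<le> ?bound \<psi>0"
        by (rule closed_loop_exit_probability[OF wien compl hbar kappa Xherm H alpha unit n0 A2 A4
            bspec[OF sols \<psi>0] \<epsilon>])
    qed
  qed simp
qed

end
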